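(* Let $0\le k$, $2k\le n$, and let $w$ be a row strict tableau of shape $(n-k,k)$. Then $\mathcal Y_w$ is the subset of the irreducible component $Y_{S(w)}$ consisting of exactly those flags $F_\bullet$ which satisfy the additional property: if $i\in w_\wedge\cap S(w)_\vee$, then $F_i$ coincides with the $i$-th subspace of the fixed point $\mathcal F_\bullet(w)$. In particular, for any standard tableau $S$, $\mathcal Y_S=Y_S$.
   Context: $V=\mathbb C^n$ has basis $p_1,\dots,p_{n-k},q_1,\dots,q_k$; $N p_i=p_{i-1}$, $N q_i=q_{i-1}$, $p_0=q_0=0$. The Springer fiber $Y$ consists of complete flags $F_\bullet$ in $V$ with $NF_i\subset F_{i-1}$. A row strict tableau $w$ of shape $(n-k,k)$ is a filling by $1,\dots,n$ with rows (top of length $n-k$, bottom of length $k$) decreasing; it is standard if columns also decrease. $w_\wedge,w_\vee$ are the sets of entries of the top and bottom row; the weight sequence of $w$ has $\wedge$ at $i\in w_\wedge$, $\vee$ at $i\in w_\vee$. $\mathcal F_\bullet(w)$ is the flag whose $i$-th space is spanned by $p_j$ $(j\le t_i)$ and $q_r$ $(r\le b_i)$, where $t_i,b_i$ are the numbers of entries of $w$ that are $\le i$ in the top, bottom row. With $\mathbb C^*$ acting by $t\cdot p_i=t^{-1}p_i$, $t\cdot q_i=tq_i$, let $\mathcal Y_w^0=\{y\in Y:\lim_{t\to\infty}t\cdot y=\mathcal F_\bullet(w)\}$ and $\mathcal Y_w=\overline{\mathcal Y_w^0}$. For $S$ standard, $\mathbf m(S)$ is the unique crossingless matching of $1,\dots,n$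 ($k$ cups below the points, $n-2k$ downward rays) for which $S_\vee$ is the set of left endpoints of cups; $\sigma:S_\vee\to S_\wedge$ sends the left end of a cup to its right end, $\delta(i)=(\sigma(i)-i+1)/2$. With $t_i,b_i$ computed for $S$, $Y_S$ is the set of flags in $Y$ with $N^{\delta(i)}(F_{\sigma(i)})=F_{i-1}$ for $i\in S_\vee$ and $F_i=N^{-b_i}(\operatorname{im}N^{\,n-k-t_i+b_i})$ for $i\in S_\wedge\setminus\sigma(S_\vee)$; the $Y_S$ are precisely the irreducible components of $Y$. The diagram $C(w)$ and tableau $S(w)$: in the weight sequence of $w$, recursively join neighbouring pairs $\vee\wedge$ (neighbouring after ignoring already joined points) by cups; the remaining symbols read $\wedge\cdots\wedge\vee\cdots\vee$. Then join the remaining $\vee$'s to remaining $\wedge$'s by further non-crossing cups in the only possible way (recursively joining neighbouring pairs $\wedge\vee$) and put rays at the remaining $n-2k$ points. The result $C(w)$ has $k$ cups, and $S(w)$ is the standard tableau with $\mathbf m(S(w))=C(w)$; i.e. $S(w)_\vee$ is the set of left endpoints of cups of $C(w)$. *)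

theory Defs
  imports "HOL-Analysis.Analysis"
begin

section \<open>Row strict tableaux with two rows\<close>

type_synonym tableau = "nat list \<times> nat list"

abbreviation top_entries :: "tableau \<Rightarrow> nat set" where
  "top_entries w \<equiv> set (fst w)"

abbreviation bot_entries :: "tableau \<Rightarrow> nat set" where
  "bot_entries w \<equiv> set (snd w)"

text \<open>The two length conditions together with the last condition force every number in
  \<open>{1..n}\<close> to occur exactly once.\<close>

definition row_strict :: "nat \<Rightarrow> nat \<Rightarrow> tableau \<Rightarrow> bool" where
  "row_strict n k w \<longleftrightarrow>
     length (fst w) = n - k \<and> length (snd w) = k \<and>
     sorted_wrt (>) (fst w) \<and> sorted_wrt (>) (snd w) \<and>
     top_entries w \<union> bot_entries w = {1..n}"

definition standard :: "nat \<Rightarrow> nat \<Rightarrow> tableau \<Rightarrow> bool" where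
  "standard n k w \<longleftrightarrow> row_strict n k w \<and> (\<forall>j<k. fst w ! j > snd w ! j)"

definition top_count :: "tableau \<Rightarrow> nat \<Rightarrow> nat" where
  "top_count w i = card {j \<in> top_entries w. j \<le> i}"

definition bot_count :: "tableau \<Rightarrow> nat \<Rightarrow> nat" where
  "bot_count w i = card {j \<in> bot_entries w. j \<le> i}"

section \<open>Cup diagrams\<close>

text \<open>A cup diagram is given by its set of cups, each cup being the pair of its left and right
  endpoint; the points of \<open>{1..n}\<close> that are not on a cup carry downward rays. As the cups are
  drawn below the points, a ray starting strictly between the endpoints of a cup would cross it.\<close>

definition endpoints :: "(nat \<times> nat) set \<Rightarrow> nat set" where
  "endpoints M = fst ` M \<union> snd ` M"

definition crossingless_matching :: "nat \<Rightarrow> nat \<Rightarrow> (nat \<times> nat) set \<Rightarrow> bool" where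
  "crossingless_matching n k M \<longleftrightarrow>
     card M = k \<and> finite M \<and>
     (\<forall>(a, b) \<in> M. 1 \<le> a \<and> a < b \<and> b \<le> n) \<and>
     (\<forall>(a, b) \<in> M. \<forall>(c, d) \<in> M. (a, b) \<noteq> (c, d) \<longrightarrow> {a, b} \<inter> {c, d} = {}) \<and>
     (\<forall>(a, b) \<in> M. \<forall>(c, d) \<in> M. \<not> (a < c \<and> c < b \<and> b < d)) \<and>
     (\<forall>(a, b) \<in> M. {a<..<b} \<subseteq> endpoints M)"

definition matching_of :: "nat \<Rightarrow> nat \<Rightarrow> tableau \<Rightarrow> (nat \<times> nat) set" where
  "matching_of n k S = (THE M. crossingless_matching n k M \<and> fst ` M = bot_entries S)"

definition cup_end :: "nat \<Rightarrow> nat \<Rightarrow> tableau \<Rightarrow> nat \<Rightarrow> nat" where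
  "cup_end n k S i = (THE j. (i, j) \<in> matching_of n k S)"

definition cup_width :: "nat \<Rightarrow> nat \<Rightarrow> tableau \<Rightarrow> nat \<Rightarrow> nat" where
  "cup_width n k S i = (cup_end n k S i - i + 1) div 2"

text \<open>\<open>join_cups J L R\<close> is the result of recursively joining, by a cup, a point \<open>a \<in> L\<close> to a
  point \<open>b \<in> R\<close> on its right such that all points strictly in between are already joined. Here
  \<open>J\<close> is the set of points that were joined beforehand. The cups in between lie strictly inside
  \<open>(a, b)\<close>, since a cup leaving that interval could only have been drawn after \<open>a\<close> or \<open>b\<close> was
  joined; requiring this also prevents a point from being joined twice.\<close>

inductive_set join_cups :: "nat set \<Rightarrow> nat set \<Rightarrow> nat set \<Rightarrow> (nat \<times> nat) set"
  for J L R :: "nat set" where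
  join: "(a, b) \<in> join_cups J L R"
    if "a \<in> L - J" "b \<in> R - J" "a < b"
       "\<And>c. a < c \<Longrightarrow> c < b \<Longrightarrow>
          c \<in> J \<or> (\<exists>x y. (x, y) \<in> join_cups J L R \<and> a < x \<and> y < b \<and> (c = x \<or> c = y))"

definition cup_diagram :: "tableau \<Rightarrow> (nat \<times> nat) set" where
  "cup_diagram w =
     (let M = join_cups {} (bot_entries w) (top_entries w)
      in M \<union> join_cups (endpoints M) (top_entries w) (bot_entries w))"

definition standardization :: "nat \<Rightarrow> nat \<Rightarrow> tableau \<Rightarrow> tableau" where
  "standardization n k w = (THE S. standard n k S \<and> matching_of n k S = cup_diagram w)"

section \<open>Flags and the Springer fiber\<close>

text \<open>\<open>V\<close> is an \<open>n\<close>-dimensional subspace of some \<open>complex ^ 'm\<close>. A complete flag in \<open>V\<close> is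
  represented by the function \<open>i \<mapsto> F\<^sub>i\<close>; since flags are compared as functions on all of \<open>nat\<close>,
  it is continued by \<open>F\<^sub>i = V\<close> for \<open>i > n\<close>, which is what \<open>min i n\<close> amounts to.\<close>

type_synonym 'm flag = "nat \<Rightarrow> (complex ^ 'm) set"

definition flags :: "nat \<Rightarrow> (complex ^ 'm::finite) set \<Rightarrow> 'm flag set" where
  "flags n V = {F. (\<forall>i. vec.subspace (F i) \<and> F i \<subseteq> V \<and> vec.dim (F i) = min i n) \<and>
                   (\<forall>i. F i \<subseteq> F (Suc i))}"

text \<open>The classical topology of the flag variety: a subspace is identified with the orthogonal
  projection onto it (the map \<open>closest_point\<close> for a linear subspace), and projections are
  topologized by pointwise convergence, which in finite dimension is norm convergence.\<close>

definition flag_topology :: "nat \<Rightarrow> (complex ^ 'm::finite) set \<Rightarrow> 'm flag topology" where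
  "flag_topology n V = pullback_topology (flags n V) (\<lambda>F i. closest_point (F i)) euclidean"

definition springer_fiber ::
  "nat \<Rightarrow> (complex ^ 'm::finite) set \<Rightarrow> (complex ^ 'm \<Rightarrow> complex ^ 'm) \<Rightarrow> 'm flag set" where
  "springer_fiber n V N = {F \<in> flags n V. \<forall>i\<in>{1..n}. N ` F i \<subseteq> F (i - 1)}"

definition fixed_flag ::
  "(nat \<Rightarrow> complex ^ 'm::finite) \<Rightarrow> (nat \<Rightarrow> complex ^ 'm) \<Rightarrow> tableau \<Rightarrow> 'm flag" where
  "fixed_flag p q w i = vec.span (p ` {1..top_count w i} \<union> q ` {1..bot_count w i})"

section \<open>Attracting cells, their closures, and the sets \<open>Y\<^sub>S\<close>\<close>

definition cell ::
  "nat \<Rightarrow> (complex ^ 'm::finite) set \<Rightarrow> (complex ^ 'm \<Rightarrow> complex ^ 'm) \<Rightarrow>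
   (complex \<Rightarrow> complex ^ 'm \<Rightarrow> complex ^ 'm) \<Rightarrow> 'm flag \<Rightarrow> 'm flag set" where
  "cell n V N act F\<^sub>0 =
     {F \<in> springer_fiber n V N.
        limitin (subtopology (flag_topology n V) (springer_fiber n V N))
          (\<lambda>t i. act t ` F i) F\<^sub>0 at_infinity}"

definition cell_closure ::
  "nat \<Rightarrow> (complex ^ 'm::finite) set \<Rightarrow> (complex ^ 'm \<Rightarrow> complex ^ 'm) \<Rightarrow>
   (complex \<Rightarrow> complex ^ 'm \<Rightarrow> complex ^ 'm) \<Rightarrow> 'm flag \<Rightarrow> 'm flag set" where
  "cell_closure n V N act F\<^sub>0 =
     subtopology (flag_topology n V) (springer_fiber n V N) closure_of cell n V N act F\<^sub>0"

definition component ::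
  "nat \<Rightarrow> nat \<Rightarrow> (complex ^ 'm::finite) set \<Rightarrow> (complex ^ 'm \<Rightarrow> complex ^ 'm) \<Rightarrow>
   tableau \<Rightarrow> 'm flag set" where
  "component n k V N S =
     {F \<in> springer_fiber n V N.
        (\<forall>i \<in> bot_entries S.
           (N ^^ cup_width n k S i) ` F (cup_end n k S i) = F (i - 1)) \<and>
        (\<forall>i \<in> top_entries S - cup_end n k S ` bot_entries S.
           F i = {v \<in> V. (N ^^ bot_count S i) v
                           \<in> (N ^^ (n - k - top_count S i + bot_count S i)) ` V})}"

end

theory Submission
  imports Defs
begin

text \<open>
  Let \<open>P\<close> be the span of the \<open>p\<^sub>i\<close>. As \<open>t\<close> tends to infinity, \<open>t \<cdot> F\<^sub>i\<close> tends to the sum of \<open>F\<^sub>i \<inter> P\<close>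
  and the projection of \<open>F\<^sub>i\<close> to the span of the \<open>q\<^sub>j\<close>; both are spanned by initial segments of the
  basis because the flag is compatible with \<open>N\<close>. Hence the cell of \<open>w\<close> consists of the flags in the
  Springer fiber for which \<open>F\<^sub>i \<inter> P\<close> is spanned by the first \<open>t\<^sub>i\<close> vectors \<open>p\<^sub>j\<close>, where \<open>t\<^sub>i\<close> counts the
  entries \<open>\<le> i\<close> of the top row (\<open>cell_eq_p_cell\<close>).

  The closure is determined by induction on the number of first-round cups, that is, of pairs
  \<open>\<or>\<and>\<close> of neighbours after removal of the pairs already joined. If \<open>w\<close> has \<open>\<or>\<close> at \<open>i\<close> and \<open>\<and>\<close> at
  \<open>i + 1\<close>, then the flags of the cell satisfy \<open>N F\<^sub>i\<^sub>+\<^sub>1 \<subseteq> F\<^sub>i\<^sub>-\<^sub>1\<close>, so that \<open>F\<^sub>i\<^sub>+\<^sub>1\<close> is the preimage of \<open>F\<^sub>i\<^sub>-\<^sub>1\<close>.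
  Such a flag is the same as a flag in \<open>N V\<close>, which has two positions less, together with a line in
  the plane \<open>F\<^sub>i\<^sub>+\<^sub>1 / F\<^sub>i\<^sub>-\<^sub>1\<close> (\<open>collapse_flag\<close>, \<open>expand_flag\<close>). Under this correspondence the cell of
  \<open>w\<close> becomes the set of pairs of a flag in the cell of the shorter weight sequence and a line that
  is transversal to \<open>P\<close>, whereas the set described in the theorem becomes the set of pairs of a flag
  in the corresponding set for the shorter sequence and an arbitrary line. So the former is
  contained in the latter, and it is dense: approximate the shorter flag by induction, lift the
  approximation along \<open>N\<close>, and perturb the line to a transversal one (\<open>approximates_expand\<close>). If no
  pair \<open>\<or>\<and>\<close> is left, then the weight sequence is \<open>\<and>\<dots>\<and>\<or>\<dots>\<or>\<close> and both sets consist of the fixed flag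
  (\<open>nested_cell_eq\<close>). As the conditions defining the set are closed (\<open>closedin_cup_variety\<close>), it is the
  closure of the cell (\<open>closure_of_p_cell\<close>).

  It remains to translate between the two definitions of the cup diagram. The predicate \<open>diagram\<close>
  builds it by inserting innermost cups, which is what the induction needs; it agrees with the
  diagram obtained by joining points (\<open>cup_diagram_eq\<close>), and a crossingless matching is determined by
  its left endpoints (\<open>crossingless_matching_eq_join_cups\<close>). The subspace prescribed at a ray is
  spanned by basis vectors, and the cups to its left contain one top and one bottom entry of \<open>w\<close>
  each, so that it is also the subspace of the fixed flag of \<open>w\<close> (\<open>ray_space\<close>, \<open>ray_counts\<close>). For a
  standard tableau all cups are drawn in the first round, and the additional condition is void.
\<close>

section \<open>Convergence of subspaces\<close>

lemma closest_point_subspace_orthogonal: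
  fixes S :: "'a::euclidean_space set"
  assumes S: "subspace S" and y: "y \<in> S"
  shows "(x - closest_point S x) \<bullet> y = 0"
proof -
  let ?c = "closest_point S x"
  have cS: "closed S" "S \<noteq> {}" "convex S"
    using S closed_subspace subspace_imp_convex subspace_0 by auto
  have c: "?c \<in> S" using cS by (simp add: closest_point_in_set)
  have "(x - ?c) \<bullet> ((?c + y) - ?c) \<le> 0"
    by (rule closest_point_dot) (use cS c S y in \<open>auto intro: subspace_add\<close>)
  moreover have "(x - ?c) \<bullet> ((?c - y) - ?c) \<le> 0"
    by (rule closest_point_dot) (use cS c S y in \<open>auto intro: subspace_diff\<close>)
  ultimately show ?thesis by simp
qed

lemma closest_point_in_subspace:
  fixes S :: "'a::euclidean_space set"
  assumes "subspace S" shows "closest_point S x \<in> S"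
  using assms closed_subspace subspace_0 by (intro closest_point_in_set) auto

lemma closest_point_subspace_unique:
  fixes S :: "'a::euclidean_space set"
  assumes S: "subspace S" and y: "y \<in> S" and o: "\<And>z. z \<in> S \<Longrightarrow> (x - y) \<bullet> z = 0"
  shows "closest_point S x = y"
proof -
  have d: "closest_point S x - y \<in> S"
    using S y closest_point_in_subspace subspace_diff by blast
  have "(closest_point S x - y) \<bullet> (closest_point S x - y)
      = (x - y) \<bullet> (closest_point S x - y) - (x - closest_point S x) \<bullet> (closest_point S x - y)"
    by (simp add: algebra_simps inner_diff_left)
  then show ?thesis using o[OF d] closest_point_subspace_orthogonal[OF S d] by simp
qed

lemma closest_point_subspace_add:
  fixes S :: "'a::euclidean_space set"
  assumes S: "subspace S"
  shows "closest_point S (x + y) = closest_point S x + closest_point S y"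
proof (rule closest_point_subspace_unique[OF S])
  show "closest_point S x + closest_point S y \<in> S"
    using S closest_point_in_subspace subspace_add by blast
  fix z assume z: "z \<in> S"
  show "(x + y - (closest_point S x + closest_point S y)) \<bullet> z = 0"
    using closest_point_subspace_orthogonal[OF S z, of x] closest_point_subspace_orthogonal[OF S z, of y]
    by (simp add: algebra_simps inner_diff_left inner_add_left)
qed

text \<open>Membership in a subspace becomes a family of equations between inner products, each of
  which depends continuously on the projection.\<close>
lemma mem_subspace_iff_inner:
  fixes S :: "'a::euclidean_space set"
  assumes S: "subspace S"
  shows "x \<in> S \<longleftrightarrow> (\<forall>u. x \<bullet> (u - closest_point S u) = 0)"
proof
  assume "x \<in> S" then show "\<forall>u. x \<bullet> (u - closest_point S u) = 0"
    using closest_point_subspace_orthogonal[OF S] by (simp add: inner_commute)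
next
  assume h: "\<forall>u. x \<bullet> (u - closest_point S u) = 0"
  have "(x - closest_point S x) \<bullet> (x - closest_point S x) = 0"
    using h[rule_format, of x] closest_point_subspace_orthogonal[OF S closest_point_in_subspace[OF S, of x], of x]
    by (simp add: inner_diff_right inner_commute)
  then have "closest_point S x = x" by simp
  then show "x \<in> S" using closest_point_in_subspace[OF S, of x] by simp
qed

text \<open>Parseval's identity for the orthogonal projection onto \<open>S\<close>.\<close>
lemma orthonormal_basis_projection:
  fixes S :: "'a::euclidean_space set"
  assumes S: "subspace S"
  obtains C where "finite C" "card C = dim S" "C \<subseteq> S" "\<And>c. c \<in> C \<Longrightarrow> norm c = 1"
    "\<And>x. (norm (closest_point S x))\<^sup>2 = (\<Sum>c\<in>C. (x \<bullet> c)\<^sup>2)"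
proof -
  obtain C where C: "C \<subseteq> S" "pairwise orthogonal C" "\<And>x. x \<in> C \<Longrightarrow> norm x = 1"
    "independent C" "card C = dim S" "span C = S"
    using orthonormal_basis_subspace[OF S] by metis
  have fin: "finite C" using C(4) independent_imp_finite by blast
  have cc: "c \<bullet> d = (if c = d then 1 else 0)" if "c \<in> C" "d \<in> C" for c d
    using C(2,3) that by (auto simp: pairwise_def orthogonal_def dot_square_norm)
  have P: "closest_point S x = (\<Sum>c\<in>C. (x \<bullet> c) *\<^sub>R c)" for x
  proof (rule closest_point_subspace_unique[OF S])
    show "(\<Sum>c\<in>C. (x \<bullet> c) *\<^sub>R c) \<in> S"
      using S C(1) by (intro subspace_sum subspace_scale) auto
    fix z assume "z \<in> S"
    then have "z \<in> span C" using C(6) by simp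
    then show "(x - (\<Sum>c\<in>C. (x \<bullet> c) *\<^sub>R c)) \<bullet> z = 0"
    proof (induction rule: span_induct)
      case base
      show ?case by (simp add: subspace_def inner_add_right)
    next
      case (step d)
      have "(\<Sum>c\<in>C. (x \<bullet> c) *\<^sub>R c) \<bullet> d = (\<Sum>c\<in>C. (x \<bullet> c) * (c \<bullet> d))"
        by (simp add: inner_sum_left)
      also have "\<dots> = (\<Sum>c\<in>C. if c = d then x \<bullet> d else 0)"
        using cc step by (intro sum.cong) auto
      finally show ?case using step fin by (simp add: inner_diff_left)
    qed
  qed
  have "(norm (closest_point S x))\<^sup>2 = (\<Sum>c\<in>C. (x \<bullet> c)\<^sup>2)" for x
  proof -
    have "(norm (closest_point S x))\<^sup>2 = (\<Sum>c\<in>C. \<Sum>d\<in>C. (x \<bullet> c) * ((x \<bullet> d) * (c \<bullet> d)))"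
      by (simp add: P power2_norm_eq_inner inner_sum_left inner_sum_right sum_distrib_left)
        (rule sum.swap[THEN trans], simp add: inner_commute mult_ac)
    also have "\<dots> = (\<Sum>c\<in>C. \<Sum>d\<in>C. if c = d then (x \<bullet> c)\<^sup>2 else 0)"
      using cc by (intro sum.cong) (auto simp: power2_eq_square)
    also have "\<dots> = (\<Sum>c\<in>C. (x \<bullet> c)\<^sup>2)" using fin by simp
    finally show ?thesis .
  qed
  then show ?thesis using that[of C] fin C by auto
qed

text \<open>The trace of the product of the two projections can be computed in a basis of either
  subspace. If it is close to the common dimension, then the unit vectors of \<open>S\<close> are close to
  \<open>W\<close>, hence almost orthogonal to what is orthogonal to \<open>W\<close>.\<close>
lemma norm_projection_of_orthogonal_le:
  fixes S W :: "'a::euclidean_space set"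
  assumes S: "subspace S" and W: "subspace W" and dim: "dim S = dim W"
    and B: "finite B" "\<And>x. (norm (closest_point W x))\<^sup>2 = (\<Sum>b\<in>B. (x \<bullet> b)\<^sup>2)"
  shows "(norm (closest_point S (x - closest_point W x)))\<^sup>2
      \<le> (norm (x - closest_point W x))\<^sup>2 * (dim W - (\<Sum>b\<in>B. (norm (closest_point S b))\<^sup>2))"
proof -
  let ?y = "x - closest_point W x"
  obtain C where C: "finite C" "card C = dim S" "C \<subseteq> S" "\<And>c. c \<in> C \<Longrightarrow> norm c = 1"
    "\<And>x. (norm (closest_point S x))\<^sup>2 = (\<Sum>c\<in>C. (x \<bullet> c)\<^sup>2)"
    using orthonormal_basis_projection[OF S] by blast
  have pyth: "(norm (c - closest_point W c))\<^sup>2 = 1 - (norm (closest_point W c))\<^sup>2" if "c \<in> C" for c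
  proof -
    have "(norm c)\<^sup>2 = 1" using C(4)[OF that] by simp
    moreover have "(c - closest_point W c) \<bullet> closest_point W c = 0"
      by (rule closest_point_subspace_orthogonal[OF W closest_point_in_subspace[OF W]])
    ultimately show ?thesis
      by (simp add: power2_norm_eq_inner inner_diff_left inner_diff_right inner_commute)
  qed
  have "(norm (closest_point S ?y))\<^sup>2 = (\<Sum>c\<in>C. (?y \<bullet> c)\<^sup>2)" by (rule C(5))
  also have "\<dots> = (\<Sum>c\<in>C. (?y \<bullet> (c - closest_point W c))\<^sup>2)"
    using closest_point_subspace_orthogonal[OF W closest_point_in_subspace[OF W], of x]
    by (simp add: inner_diff_right)
  also have "\<dots> \<le> (\<Sum>c\<in>C. (norm ?y)\<^sup>2 * (norm (c - closest_point W c))\<^sup>2)"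
    by (intro sum_mono) (metis Cauchy_Schwarz_ineq2 abs_ge_zero power2_abs power_mono power_mult_distrib)
  also have "\<dots> = (norm ?y)\<^sup>2 * (\<Sum>c\<in>C. 1 - (norm (closest_point W c))\<^sup>2)"
    using pyth by (simp add: sum_distrib_left)
  also have "(\<Sum>c\<in>C. 1 - (norm (closest_point W c))\<^sup>2) = dim W - (\<Sum>c\<in>C. (norm (closest_point W c))\<^sup>2)"
    using C(2) dim by (simp add: sum_subtractf)
  also have "(\<Sum>c\<in>C. (norm (closest_point W c))\<^sup>2) = (\<Sum>b\<in>B. (norm (closest_point S b))\<^sup>2)"
    unfolding B(2) C(5) by (subst sum.swap) (simp add: inner_commute)
  finally show ?thesis .
qed

text \<open>For subspaces of the same dimension it is enough to approximate the vectors of the limit: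
  the other half of the convergence of projections is forced by the dimension.\<close>
lemma closest_point_tendsto:
  fixes S :: "'b \<Rightarrow> 'a::euclidean_space set"
  assumes W: "subspace W" and S: "\<forall>\<^sub>F m in \<Phi>. subspace (S m) \<and> dim (S m) = dim W"
    and lim: "\<And>x. x \<in> W \<Longrightarrow> \<exists>u. (\<forall>\<^sub>F m in \<Phi>. u m \<in> S m) \<and> (u \<longlongrightarrow> x) \<Phi>"
  shows "((\<lambda>m. closest_point (S m) x) \<longlongrightarrow> closest_point W x) \<Phi>"
proof -
  let ?P = "\<lambda>m. closest_point (S m)"
  have inW: "((\<lambda>m. ?P m x) \<longlongrightarrow> x) \<Phi>" if x: "x \<in> W" for x
  proof -
    obtain u where u: "\<forall>\<^sub>F m in \<Phi>. u m \<in> S m" "(u \<longlongrightarrow> x) \<Phi>" using lim[OF x] by blast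
    have "((\<lambda>m. dist (?P m x) x) \<longlongrightarrow> 0) \<Phi>"
    proof (rule tendsto_sandwich)
      show "\<forall>\<^sub>F m in \<Phi>. 0 \<le> dist (?P m x) x" by simp
      show "\<forall>\<^sub>F m in \<Phi>. dist (?P m x) x \<le> dist (u m) x"
        using S u(1) by eventually_elim (metis closed_subspace closest_point_le dist_commute)
      show "((\<lambda>m. dist (u m) x) \<longlongrightarrow> 0) \<Phi>" using u(2) tendsto_dist_iff by blast
    qed simp
    then show ?thesis using tendsto_dist_iff by blast
  qed
  obtain B where B: "finite B" "card B = dim W" "B \<subseteq> W" "\<And>b. b \<in> B \<Longrightarrow> norm b = 1"
    "\<And>x. (norm (closest_point W x))\<^sup>2 = (\<Sum>b\<in>B. (x \<bullet> b)\<^sup>2)"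
    using orthonormal_basis_projection[OF W] by blast
  let ?y = "x - closest_point W x"
  have d: "((\<lambda>m. (\<Sum>b\<in>B. (norm (?P m b))\<^sup>2)) \<longlongrightarrow> (\<Sum>b\<in>B. (norm b)\<^sup>2)) \<Phi>"
    by (intro tendsto_sum tendsto_power tendsto_norm inW) (use B in auto)
  have "(\<Sum>b\<in>B. (norm b)\<^sup>2) = real (dim W)" using B by simp
  with d have d: "((\<lambda>m. (\<Sum>b\<in>B. (norm (?P m b))\<^sup>2)) \<longlongrightarrow> real (dim W)) \<Phi>" by simp
  have "((\<lambda>m. (norm ?y)\<^sup>2 * (dim W - (\<Sum>b\<in>B. (norm (?P m b))\<^sup>2))) \<longlongrightarrow> (norm ?y)\<^sup>2 * (real (dim W) - real (dim W))) \<Phi>"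
    by (intro tendsto_intros d)
  then have z: "((\<lambda>m. (norm ?y)\<^sup>2 * (dim W - (\<Sum>b\<in>B. (norm (?P m b))\<^sup>2))) \<longlongrightarrow> 0) \<Phi>" by simp
  have "((\<lambda>m. (norm (?P m ?y))\<^sup>2) \<longlongrightarrow> 0) \<Phi>"
  proof (rule tendsto_sandwich[OF _ _ tendsto_const z])
    show "\<forall>\<^sub>F m in \<Phi>. (norm (?P m ?y))\<^sup>2 \<le> (norm ?y)\<^sup>2 * (dim W - (\<Sum>b\<in>B. (norm (?P m b))\<^sup>2))"
      using S
    proof eventually_elim
      case (elim m)
      then show ?case using norm_projection_of_orthogonal_le[of "S m" W B x] W B by auto
    qed
  qed simp
  then have "((\<lambda>m. norm (?P m ?y)) \<longlongrightarrow> 0) \<Phi>"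
    using tendsto_real_sqrt by fastforce
  then have "((\<lambda>m. ?P m ?y) \<longlongrightarrow> 0) \<Phi>" using tendsto_norm_zero_iff by blast
  with inW[OF closest_point_in_subspace[OF W, of x]]
  have "((\<lambda>m. ?P m (closest_point W x) + ?P m ?y) \<longlongrightarrow> closest_point W x + 0) \<Phi>"
    by (rule tendsto_add)
  moreover have "\<forall>\<^sub>F m in \<Phi>. ?P m (closest_point W x) + ?P m ?y = ?P m x"
    using S by eventually_elim (metis add.commute closest_point_subspace_add diff_add_cancel)
  ultimately show ?thesis using tendsto_cong by fastforce
qed

lemma scaleR_eq_complex_scale: "r *\<^sub>R x = complex_of_real r *s x" for x :: "complex ^ 'm"
  by (simp add: vec_eq_iff) (simp add: scaleR_conv_of_real)

lemma subspace_of_vec_subspace: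
  fixes W :: "(complex ^ 'm::finite) set"
  assumes "vec.subspace W" shows "subspace W"
proof -
  show ?thesis
    unfolding subspace_def using assms
    by (auto simp: scaleR_eq_complex_scale vec.subspace_0 vec.subspace_add vec.subspace_scale)
qed

lemma linear_of_vec_linear:
  assumes "Vector_Spaces.linear (*s) (*s) f"
  shows "linear (f :: complex ^ 'm::finite \<Rightarrow> complex ^ 'm)"
proof -
  interpret f: Vector_Spaces.linear "(*s)" "(*s)" f by fact
  show ?thesis by (rule linearI) (auto simp: scaleR_eq_complex_scale f.add f.scale)
qed

text \<open>The topology of flags speaks of real projections, whereas dimensions of flags are complex. Only
  equality of dimensions has to be transferred, and for this a complex isomorphism suffices.\<close>
lemma dim_eq_of_vec_dim_eq:
  fixes W S :: "(complex ^ 'm::finite) set"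
  assumes W: "vec.subspace W" and S: "vec.subspace S" and d: "vec.dim S = vec.dim W"
  shows "dim S = dim W"
proof -
  obtain f where f: "Vector_Spaces.linear (*s) (*s) f" "f ` S = W" "inj_on f S"
    using vec.subspace_isomorphism[OF S W d] by blast
  have "linear f" by (rule linear_of_vec_linear[OF f(1)])
  moreover have "inj_on f (span S)"
    using f(3) subspace_of_vec_subspace[OF S] by (simp add: span_eq_iff[THEN iffD2])
  ultimately have "dim (f ` S) = dim S" by (rule dim_image_eq)
  then show ?thesis using f(2) by simp
qed

lemma limitin_euclidean_fun_iff:
  fixes f :: "'b \<Rightarrow> 'i \<Rightarrow> 'c::topological_space"
  shows "limitin euclidean f l \<Phi> \<longleftrightarrow> (\<forall>i. limitin euclidean (\<lambda>c. f c i) (l i) \<Phi>)"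
  by (simp flip: euclidean_product_topology add: limitin_componentwise)

lemma limitin_flag_topology_iff:
  "limitin (flag_topology n V) G F \<Phi> \<longleftrightarrow>
     F \<in> flags n V \<and> (\<forall>\<^sub>F m in \<Phi>. G m \<in> flags n V) \<and>
     (\<forall>i x. ((\<lambda>m. closest_point (G m i) x) \<longlongrightarrow> closest_point (F i) x) \<Phi>)"
proof -
  have *: "(\<forall>i x. ((\<lambda>m. closest_point (G m i) x) \<longlongrightarrow> closest_point (F i) x) \<Phi>) \<longleftrightarrow>
    limitin euclidean (\<lambda>m i. closest_point (G m i)) (\<lambda>i. closest_point (F i)) \<Phi>"
    by (subst limitin_euclidean_fun_iff) (subst limitin_euclidean_fun_iff, simp add: limitin_canonical_iff)
  show ?thesis
    unfolding *
  proof (intro iffI conjI)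
    assume h: "limitin (flag_topology n V) G F \<Phi>"
    show F: "F \<in> flags n V"
      using h by (simp add: limitin_def flag_topology_def topspace_pullback_topology)
    have U: "\<forall>\<^sub>F m in \<Phi>. G m \<in> (\<lambda>F i. closest_point (F i)) -` U \<inter> flags n V"
      if "open U" "(\<lambda>i. closest_point (F i)) \<in> U" for U
    proof -
      have "openin (flag_topology n V) ((\<lambda>F i. closest_point (F i)) -` U \<inter> flags n V)"
        using that by (auto simp: flag_topology_def openin_pullback_topology)
      then show ?thesis using h F that by (auto simp: limitin_def)
    qed
    show "\<forall>\<^sub>F m in \<Phi>. G m \<in> flags n V"
      using U[of UNIV] by simp
    show "limitin euclidean (\<lambda>m i. closest_point (G m i)) (\<lambda>i. closest_point (F i)) \<Phi>"
      unfolding limitin_def by (auto intro: eventually_mono[OF U])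
  next
    assume h: "F \<in> flags n V \<and> (\<forall>\<^sub>F m in \<Phi>. G m \<in> flags n V) \<and>
      limitin euclidean (\<lambda>m i. closest_point (G m i)) (\<lambda>i. closest_point (F i)) \<Phi>"
    show "limitin (flag_topology n V) G F \<Phi>"
      unfolding limitin_def
    proof (intro conjI allI impI)
      show "F \<in> topspace (flag_topology n V)"
        using h by (simp add: flag_topology_def topspace_pullback_topology)
      fix S assume S: "openin (flag_topology n V) S \<and> F \<in> S"
      then obtain U where U: "open U" "S = (\<lambda>F i. closest_point (F i)) -` U \<inter> flags n V"
        by (auto simp: flag_topology_def openin_pullback_topology)
      then have "\<forall>\<^sub>F m in \<Phi>. (\<lambda>i. closest_point (G m i)) \<in> U"
        using h S by (auto simp: limitin_def)
      moreover have "\<forall>\<^sub>F m in \<Phi>. G m \<in> flags n V" using h by simp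
      ultimately show "\<forall>\<^sub>F m in \<Phi>. G m \<in> S"
        by eventually_elim (use U in auto)
    qed
  qed
qed

lemma flagsD:
  assumes "F \<in> flags n V"
  shows "vec.subspace (F i)" "F i \<subseteq> V" "vec.dim (F i) = min i n" "F i \<subseteq> F (Suc i)"
  using assms by (auto simp: flags_def)

lemma flags_mono:
  assumes "F \<in> flags n V" "i \<le> j" shows "F i \<subseteq> F j"
  using assms lift_Suc_mono_le[of F i j] by (auto simp: flags_def)

text \<open>The spaces of two flags have the same dimensions, so that approximating every vector of every
  space of the limit suffices.\<close>
lemma limitin_flag_topologyI:
  assumes F: "F \<in> flags n V" and G: "\<forall>\<^sub>F m in \<Phi>. G m \<in> flags n V"
    and lim: "\<And>i x. x \<in> F i \<Longrightarrow> \<exists>u. (\<forall>\<^sub>F m in \<Phi>. u m \<in> G m i) \<and> (u \<longlongrightarrow> x) \<Phi>"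
  shows "limitin (flag_topology n V) G F \<Phi>"
  unfolding limitin_flag_topology_iff
proof (intro conjI allI F G)
  fix i x
  show "((\<lambda>m. closest_point (G m i) x) \<longlongrightarrow> closest_point (F i) x) \<Phi>"
  proof (rule closest_point_tendsto[OF _ _ lim])
    show "subspace (F i)" using F by (simp add: flagsD subspace_of_vec_subspace)
    show "\<forall>\<^sub>F m in \<Phi>. subspace (G m i) \<and> dim (G m i) = dim (F i)"
      using G by eventually_elim
        (metis F dim_eq_of_vec_dim_eq flagsD(1,3) subspace_of_vec_subspace)
  qed
qed

lemma continuous_map_flag_projections:
  fixes g :: "(nat \<Rightarrow> complex ^ 'm::finite \<Rightarrow> complex ^ 'm) \<Rightarrow> 'b::topological_space"
  assumes "continuous_on UNIV g"
  shows "continuous_map (flag_topology n V) euclidean (\<lambda>F. g (\<lambda>i. closest_point (F i)))"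
proof -
  have "continuous_map euclidean euclidean g" using assms by simp
  from continuous_map_pullback[OF this, of "flags n V" "\<lambda>F i. closest_point (F i)"]
  show ?thesis unfolding flag_topology_def by (simp add: o_def)
qed

lemma continuous_on_eval2: "continuous_on UNIV (\<lambda>f::nat \<Rightarrow> complex ^ 'm::finite \<Rightarrow> complex ^ 'm. f i x)"
  using continuous_on_product_then_coordinatewise[OF continuous_on_product_coordinates] .

text \<open>Incidence conditions are closed. By self-adjointness of projections the condition is
  equivalent to the vanishing of continuous functions of the flag.\<close>
lemma closedin_flag_incidence:
  assumes A: "Vector_Spaces.linear (*s) (*s) A"
  shows "closedin (flag_topology n V) {F \<in> flags n V. A ` F i \<subseteq> F j}"
proof -
  have ts: "topspace (flag_topology n V) = flags n V"
    by (simp add: flag_topology_def topspace_pullback_topology)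
  have linA: "linear A" by (rule linear_of_vec_linear[OF A])
  have cont: "continuous_map (flag_topology n V) euclidean
      (\<lambda>F. A (closest_point (F i) x) \<bullet> (u - closest_point (F j) u))" for x u
  proof -
    have "continuous_on UNIV (\<lambda>f. A (f i x))"
      using linear_continuous_on[of A UNIV] linA linear_conv_bounded_linear
      by (intro continuous_on_compose2[OF _ continuous_on_eval2, of UNIV A]) auto
    then have "continuous_on UNIV (\<lambda>f. A (f i x) \<bullet> (u - f j u))"
      by (intro continuous_intros continuous_on_eval2)
    from continuous_map_flag_projections[OF this] show ?thesis .
  qed
  have "closedin (flag_topology n V)
     {F \<in> topspace (flag_topology n V). A (closest_point (F i) x) \<bullet> (u - closest_point (F j) u) \<in> {0}}" for x u
    by (rule closedin_continuous_map_preimage[OF cont]) simp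
  then have "closedin (flag_topology n V)
     (\<Inter>(x,u)\<in>UNIV. {F \<in> topspace (flag_topology n V). A (closest_point (F i) x) \<bullet> (u - closest_point (F j) u) \<in> {0}})"
    by (intro closedin_Inter) auto
  also have "(\<Inter>(x,u)\<in>UNIV. {F \<in> topspace (flag_topology n V). A (closest_point (F i) x) \<bullet> (u - closest_point (F j) u) \<in> {0}})
     = {F \<in> flags n V. A ` F i \<subseteq> F j}" (is "?L = ?R")
  proof -
    have "F \<in> ?L \<longleftrightarrow> F \<in> ?R" for F
    proof (cases "F \<in> flags n V")
      case True
      have s: "subspace (F i)" "subspace (F j)" using flagsD(1)[OF True] subspace_of_vec_subspace by auto
      have "F \<in> ?L \<longleftrightarrow> (\<forall>x. A (closest_point (F i) x) \<in> F j)"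
        using True s by (simp add: ts mem_subspace_iff_inner[of "F j"])
      also have "\<dots> \<longleftrightarrow> A ` F i \<subseteq> F j"
        using closest_point_self closest_point_in_subspace[OF s(1)] by (metis image_subset_iff)
      finally show ?thesis using True by simp
    qed (auto simp: ts)
    then show ?thesis by blast
  qed
  finally show ?thesis .
qed

lemma closedin_flag_contains:
  "closedin (flag_topology n V) {F \<in> flags n V. W \<subseteq> F i}"
proof -
  have ts: "topspace (flag_topology n V) = flags n V"
    by (simp add: flag_topology_def topspace_pullback_topology)
  have "closedin (flag_topology n V) {F \<in> topspace (flag_topology n V). closest_point (F i) x \<in> {x}}" for x
    using closedin_continuous_map_preimage[OF continuous_map_flag_projections[OF continuous_on_eval2], of "{x}"] by simp
  then have "closedin (flag_topology n V)
     (\<Inter>x\<in>insert 0 W. {F \<in> topspace (flag_topology n V). closest_point (F i) x \<in> {x}})"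
    by (intro closedin_Inter) auto
  also have "(\<Inter>x\<in>insert 0 W. {F \<in> topspace (flag_topology n V). closest_point (F i) x \<in> {x}})
     = {F \<in> flags n V. W \<subseteq> F i}" (is "?L = ?R")
  proof -
    have "F \<in> ?L \<longleftrightarrow> F \<in> ?R" for F
    proof (cases "F \<in> flags n V")
      case True
      have s: "subspace (F i)" using flagsD(1)[OF True] subspace_of_vec_subspace by auto
      have "closest_point (F i) x = x \<longleftrightarrow> x \<in> F i" for x
        using s closed_subspace subspace_0 by (intro closest_point_refl) auto
      then show ?thesis using True s subspace_0 by (auto simp: ts)
    qed (auto simp: ts)
    then show ?thesis by blast
  qed
  finally show ?thesis .
qed

section \<open>Cup diagrams\<close>

text \<open>A set of cups that can be drawn by the recursion, and that leaves no further pair to be joined,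
  is the result of the recursion: a cup drawn differently would have to share a point with a cup
  nested inside it.\<close>
lemma join_cups_eqI:
  assumes M: "\<And>a b. (a, b) \<in> M \<Longrightarrow> a \<in> L - J \<and> b \<in> R - J \<and> a < b"
    and nest: "\<And>a b c. (a, b) \<in> M \<Longrightarrow> a < c \<Longrightarrow> c < b \<Longrightarrow>
       c \<in> J \<or> (\<exists>x y. (x, y) \<in> M \<and> a < x \<and> y < b \<and> (c = x \<or> c = y))"
    and disj: "\<And>a b c d. (a, b) \<in> M \<Longrightarrow> (c, d) \<in> M \<Longrightarrow> {a, b} \<inter> {c, d} \<noteq> {} \<Longrightarrow> (a, b) = (c, d)"
    and max: "\<And>a b. a \<in> L - J \<Longrightarrow> b \<in> R - J \<Longrightarrow> a < b \<Longrightarrow> a \<in> endpoints M \<or> b \<in> endpoints M"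
    and LR: "L \<inter> R = {}"
  shows "join_cups J L R = M"
proof (intro equalityI subrelI)
  fix a b assume "(a, b) \<in> M"
  then show "(a, b) \<in> join_cups J L R"
  proof (induction "b - a" arbitrary: a b rule: less_induct)
    case less
    show ?case
    proof (rule join_cups.join)
      fix c assume c: "a < c" "c < b"
      show "c \<in> J \<or> (\<exists>x y. (x, y) \<in> join_cups J L R \<and> a < x \<and> y < b \<and> (c = x \<or> c = y))"
      proof (cases "c \<in> J")
        case False
        then obtain x y where xy: "(x, y) \<in> M" "a < x" "y < b" "c = x \<or> c = y"
          using nest[OF less.prems c] by blast
        then have "y - x < b - a" using M[OF xy(1)] by linarith
        then show ?thesis using less.hyps xy by blast
      qed simp
    qed (use M[OF less.prems] in auto)
  qed
next
  fix a b assume "(a, b) \<in> join_cups J L R"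
  then show "(a, b) \<in> M"
  proof (induction rule: join_cups.induct)
    case (join a b)
    have inner: "\<exists>x y. (x, y) \<in> M \<and> a < x \<and> y < b \<and> (c = x \<or> c = y)" if "a < c" "c < b" "c \<notin> J" for c
      using join(4)[OF that(1,2)] that(3) by blast
    have "a \<in> endpoints M \<or> b \<in> endpoints M" using max join(1-3) by blast
    then consider b' where "(a, b') \<in> M" | a' where "(a', b) \<in> M"
      using M LR join(1,2) by (fastforce simp: endpoints_def)
    then show ?case
    proof cases
      case 1
      have b'J: "b' \<notin> J" "a < b'" using M[OF 1] by auto
      consider "b' < b" | "b' = b" | "b < b'" by linarith
      then show ?thesis
      proof cases
        assume "b' < b"
        then obtain x y where "(x, y) \<in> M" "a < x" "b' = x \<or> b' = y" using inner b'J by blast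
        then show ?thesis using disj[OF 1, of x y] by auto
      next
        assume "b < b'"
        then obtain x y where xy: "(x, y) \<in> M" "a < x" "b = x \<or> b = y"
          using nest[OF 1 join(3)] join(2) by blast
        then have "b = y" using M[OF xy(1)] join(2) LR by auto
        then have "x < b" "x \<notin> J" using M[OF xy(1)] by auto
        then obtain x' y' where "(x', y') \<in> M" "y' < b" "x = x' \<or> x = y'" using inner xy(2) by blast
        then show ?thesis using disj[OF xy(1), of x' y'] \<open>b = y\<close> by auto
      qed (use 1 in simp)
    next
      case 2
      have a'J: "a' \<notin> J" "a' < b" using M[OF 2] by auto
      consider "a < a'" | "a' = a" | "a' < a" by linarith
      then show ?thesis
      proof cases
        assume "a < a'"
        then obtain x y where "(x, y) \<in> M" "y < b" "a' = x \<or> a' = y" using inner a'J by blast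
        then show ?thesis using disj[OF 2, of x y] by auto
      next
        assume "a' < a"
        then obtain x y where xy: "(x, y) \<in> M" "y < b" "a = x \<or> a = y"
          using nest[OF 2 _ join(3)] join(1) by blast
        then have "a = x" using M[OF xy(1)] join(1) LR by auto
        then have "a < y" "y \<notin> J" using M[OF xy(1)] by auto
        then obtain x' y' where "(x', y') \<in> M" "a < x'" "y = x' \<or> y = y'" using inner xy(2) by blast
        then show ?thesis using disj[OF xy(1), of x' y'] \<open>a = x\<close> by auto
      qed (use 2 in simp)
    qed
  qed
qed

text \<open>The relabelling of points when two new neighbours \<open>i\<close> and \<open>i + 1\<close> are inserted.\<close>
definition skip :: "nat \<Rightarrow> nat \<Rightarrow> nat" where
  "skip i j = (if j < i then j else j + 2)"

lemma skip_less_iff [simp]: "skip i a < skip i b \<longleftrightarrow> a < b"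
  by (auto simp: skip_def)

lemma skip_eq_iff [simp]: "skip i a = skip i b \<longleftrightarrow> a = b"
  by (auto simp: skip_def)

lemma inj_skip: "inj (skip i)"
  by (simp add: inj_def)

lemma skip_neq [simp]: "skip i a \<noteq> i" "i \<noteq> skip i a" "skip i a \<noteq> Suc i" "Suc i \<noteq> skip i a"
  by (auto simp: skip_def)

lemma skip_gap: "skip i a < i \<longleftrightarrow> a < i" "skip i a < Suc i \<longleftrightarrow> a < i"
    "i < skip i a \<longleftrightarrow> i \<le> a" "Suc i < skip i a \<longleftrightarrow> i \<le> a"
  by (auto simp: skip_def)

lemma skip_cases:
  obtains "c = i" | "c = Suc i" | c' where "c = skip i c'"
proof -
  have "c = i \<or> c = Suc i \<or> c = skip i c \<or> c = skip i (c - 2)"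
    by (auto simp: skip_def)
  then show ?thesis using that by blast
qed

lemma skip_range: "i \<in> {1..n + 1} \<Longrightarrow> skip i a \<in> {1..n + 2} \<longleftrightarrow> a \<in> {1..n}"
  by (auto simp: skip_def)

lemma insert_cup_cases:
  assumes "(a, b) \<in> insert (i, i + 1) (map_prod (skip i) (skip i) ` M)"
  obtains "a = i" "b = Suc i" | x y where "a = skip i x" "b = skip i y" "(x, y) \<in> M"
  using assms by auto

text \<open>An inductive description of the passage from the set \<open>B\<close> of positions of \<open>\<or>\<close> to the cup
  diagram. A neighbouring pair \<open>\<or>\<and>\<close> is always joined and may be removed first; if there is none,
  the sequence is \<open>\<and>\<dots>\<and>\<or>\<dots>\<or>\<close> and its cups are nested around the middle. Geometrically, removing
  an innermost cup corresponds to replacing a flag by one in the image of \<open>N\<close>, which is why the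
  main results are proved by induction on this predicate.\<close>
inductive diagram :: "nat \<Rightarrow> nat \<Rightarrow> nat set \<Rightarrow> (nat \<times> nat) set \<Rightarrow> bool" where
  nested: "2 * k \<le> n \<Longrightarrow> diagram n k {n - k + 1..n} ((\<lambda>d. (n - k + 1 - d, n - k + d)) ` {1..k})"
| adjacent: "diagram n k B M \<Longrightarrow> i \<in> {1..n + 1} \<Longrightarrow>
    diagram (n + 2) (k + 1) (insert i (skip i ` B)) (insert (i, i + 1) (map_prod (skip i) (skip i) ` M))"

lemma diagram_set: "diagram n k B M \<Longrightarrow> B \<subseteq> {1..n} \<and> card B = k \<and> 2 * k \<le> n"
proof (induction rule: diagram.induct)
  case (nested k n)
  then show ?case by auto
next
  case (adjacent n k B M i)
  have "finite B" using adjacent.IH finite_subset by blast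
  then have "card (insert i (skip i ` B)) = k + 1"
    using adjacent.IH by (simp add: image_iff card_image inj_skip[THEN inj_on_subset])
  moreover have "skip i ` B \<subseteq> {1..n + 2}" using adjacent.IH skip_range[OF adjacent.hyps(2)] by blast
  ultimately show ?case using adjacent.IH adjacent.hyps(2) by auto
qed

lemma diagram_exists:
  assumes "B \<subseteq> {1..n}" "card B = k" "2 * k \<le> n"
  shows "\<exists>M. diagram n k B M"
  using assms
proof (induction k arbitrary: n B)
  case 0
  then have "B = {n - 0 + 1..n}" using finite_subset[of B "{1..n}"] by auto
  then show ?case using diagram.nested[of 0 n] by auto
next
  case (Suc k)
  have finB: "finite B" using Suc.prems finite_subset by blast
  show ?case
  proof (cases "\<exists>i\<in>B. i + 1 \<in> {1..n} - B")
    case True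
    then obtain i where i: "i \<in> B" "i + 1 \<le> n" "i + 1 \<notin> B" by auto
    define B' where "B' = skip i -` B"
    have n: "n = (n - 2) + 2" using Suc.prems by auto
    have i': "i \<in> {1..(n - 2) + 1}" using i Suc.prems by auto
    have sB: "skip i ` B' = B - {i}"
    proof
      show "skip i ` B' \<subseteq> B - {i}" by (auto simp: B'_def)
      show "B - {i} \<subseteq> skip i ` B'"
      proof
        fix c assume c: "c \<in> B - {i}"
        show "c \<in> skip i ` B'"
          by (rule skip_cases[of c i]) (use c i in \<open>auto simp: B'_def\<close>)
      qed
    qed
    have "card (skip i ` B') = card B'" by (simp add: card_image inj_skip[THEN inj_on_subset])
    then have "card B' = k" using sB Suc.prems(2) i(1) finB by simp
    moreover have "B' \<subseteq> {1..n - 2}"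
    proof
      fix a assume "a \<in> B'"
      then have "skip i a \<in> {1..(n - 2) + 2}" using Suc.prems(1) n by (auto simp: B'_def)
      then show "a \<in> {1..n - 2}" using skip_range[OF i'] by blast
    qed
    moreover have "2 * k \<le> n - 2" using Suc.prems by simp
    ultimately obtain M where "diagram (n - 2) k B' M" using Suc.IH[of B' "n - 2"] by blast
    from diagram.adjacent[OF this i'] show ?thesis
      using sB i n by (metis Suc_eq_plus1 insert_Diff)
  next
    case False
    \<comment> \<open>Without a neighbouring pair \<open>\<or>\<and>\<close> the set \<open>B\<close> is closed upwards, hence a final segment.\<close>
    define m where "m = Min B"
    have "B \<noteq> {}" using Suc.prems by auto
    then have m: "m \<in> B" "\<And>x. x \<in> B \<Longrightarrow> m \<le> x" using finB by (auto simp: m_def)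
    have "x \<in> B" if "m \<le> x" "x \<le> n" for x
      using that
    proof (induction x rule: dec_induct)
      case (step x) then show ?case using False by auto
    qed (use m in simp)
    then have B: "B = {m..n}" using m Suc.prems(1) by auto
    then have "Suc k = Suc n - m" using Suc.prems(2) by simp
    then have "m = n - Suc k + 1" using Suc.prems(3) by arith
    then show ?thesis using diagram.nested[OF Suc.prems(3)] B by blast
  qed
qed

lemma diagram_cup_bounds: "diagram n k B M \<Longrightarrow> (a, b) \<in> M \<Longrightarrow> 1 \<le> a \<and> a < b \<and> b \<le> n \<and> odd (b - a)"
proof (induction arbitrary: a b rule: diagram.induct)
  case (nested k n) then show ?case by auto
next
  case (adjacent n k B M i)
  show ?case
  proof (cases "(a, b) = (i, i + 1)")
    case True then show ?thesis using adjacent.hyps by auto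
  next
    case False
    then obtain x y where xy: "a = skip i x" "b = skip i y" "(x, y) \<in> M" using adjacent.prems by auto
    have "1 \<le> x \<and> x < y \<and> y \<le> n \<and> odd (y - x)" using adjacent.IH[OF xy(3)] .
    then show ?thesis using xy by (auto simp: skip_def)
  qed
qed

lemma diagram_cup_alternates: "diagram n k B M \<Longrightarrow> (a, b) \<in> M \<Longrightarrow> a \<in> B \<longleftrightarrow> b \<notin> B"
proof (induction arbitrary: a b rule: diagram.induct)
  case (nested k n) then show ?case by auto
next
  case (adjacent n k B M i)
  show ?case
  proof (cases "(a, b) = (i, i + 1)")
    case True then show ?thesis by (auto simp: image_iff)
  next
    case False
    then obtain x y where xy: "a = skip i x" "b = skip i y" "(x, y) \<in> M" using adjacent.prems by auto
    show ?thesis using adjacent.IH[OF xy(3)] unfolding xy(1,2) by (simp add: image_iff)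
  qed
qed

lemma endpoints_insert: "endpoints (insert (a, b) M) = {a, b} \<union> endpoints M"
  by (auto simp: endpoints_def)

lemma endpoints_map: "endpoints (map_prod f f ` M) = f ` endpoints M"
  by (simp add: endpoints_def image_Un image_image)

lemma diagram_covers: "diagram n k B M \<Longrightarrow> B \<subseteq> endpoints M"
proof (induction rule: diagram.induct)
  case (nested k n)
  show ?case
  proof
    fix x assume "x \<in> {n - k + 1..n}"
    then have "(n - k + 1 - (x - (n - k)), x) \<in> (\<lambda>d. (n - k + 1 - d, n - k + d)) ` {1..k}"
      by (intro image_eqI[of _ _ "x - (n - k)"]) auto
    from imageI[OF this, of snd] show "x \<in> endpoints ((\<lambda>d. (n - k + 1 - d, n - k + d)) ` {1..k})"
      unfolding endpoints_def by simp
  qed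
next
  case (adjacent n k B M i)
  show ?case unfolding endpoints_insert endpoints_map using adjacent.IH by blast
qed

lemma diagram_disjoint:
  "diagram n k B M \<Longrightarrow> (a, b) \<in> M \<Longrightarrow> (c, d) \<in> M \<Longrightarrow> {a, b} \<inter> {c, d} \<noteq> {} \<Longrightarrow> (a, b) = (c, d)"
proof (induction arbitrary: a b c d rule: diagram.induct)
  case (nested k n) then show ?case by auto
next
  case (adjacent n k B M i)
  from adjacent.prems(1) show ?case
  proof (cases rule: insert_cup_cases)
    case 1
    from adjacent.prems(2) show ?thesis
      by (cases rule: insert_cup_cases) (use 1 adjacent.prems(3) in simp_all)
  next
    case ab: (2 x y)
    from adjacent.prems(2) show ?thesis
    proof (cases rule: insert_cup_cases)
      case (2 u v)
      then show ?thesis using adjacent.IH[OF ab(3), of u v] ab adjacent.prems(3) by simp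
    qed (use ab adjacent.prems(3) in simp)
  qed
qed

lemma diagram_noncrossing:
  "diagram n k B M \<Longrightarrow> (a, b) \<in> M \<Longrightarrow> (c, d) \<in> M \<Longrightarrow> \<not> (a < c \<and> c < b \<and> b < d)"
proof (induction arbitrary: a b c d rule: diagram.induct)
  case (nested k n) then show ?case by auto
next
  case (adjacent n k B M i)
  from adjacent.prems(1) show ?case
  proof (cases rule: insert_cup_cases)
    case 1
    from adjacent.prems(2) show ?thesis
      by (cases rule: insert_cup_cases) (use 1 in \<open>simp_all add: skip_gap\<close>)
  next
    case ab: (2 x y)
    from adjacent.prems(2) show ?thesis
    proof (cases rule: insert_cup_cases)
      case (2 u v)
      then show ?thesis using adjacent.IH[OF ab(3), of u v] ab by simp
    qed (use ab in \<open>auto simp: skip_gap\<close>)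
  qed
qed

text \<open>Cups that begin with \<open>\<or>\<close> are drawn in the first round, so that everything below them has
  been joined in the first round, too.\<close>
lemma diagram_inside_cup:
  "diagram n k B M \<Longrightarrow> (a, b) \<in> M \<Longrightarrow> a < c \<Longrightarrow> c < b \<Longrightarrow>
    \<exists>x y. (x, y) \<in> M \<and> (a \<in> B \<longrightarrow> x \<in> B) \<and> a < x \<and> y < b \<and> (c = x \<or> c = y)"
proof (induction arbitrary: a b c rule: diagram.induct)
  case (nested k n)
  obtain d where d: "1 \<le> d" "d \<le> k" "a = n - k + 1 - d" "b = n - k + d" using nested.prems(1) by auto
  define e where "e = (if c \<le> n - k then n - k + 1 - c else c - (n - k))"
  have e: "1 \<le> e \<and> e \<le> k \<and> a < n - k + 1 - e \<and> n - k + e < b \<and> (c = n - k + 1 - e \<or> c = n - k + e)"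
    using d nested.prems(2,3) nested.hyps unfolding e_def by (cases "c \<le> n - k") (simp, linarith)+
  then have "(n - k + 1 - e, n - k + e) \<in> (\<lambda>d. (n - k + 1 - d, n - k + d)) ` {1..k}" by simp
  moreover have "a \<notin> {n - k + 1..n}" using d nested.hyps by simp
  ultimately show ?case using e by blast
next
  case (adjacent n k B M i)
  let ?M = "insert (i, i + 1) (map_prod (skip i) (skip i) ` M)"
  from adjacent.prems(1) show ?case
  proof (cases rule: insert_cup_cases)
    case 1 then show ?thesis using adjacent.prems(2,3) by simp
  next
    case ab: (2 x y)
    have aB: "a \<in> insert i (skip i ` B) \<longleftrightarrow> x \<in> B"
      unfolding ab(1) by (simp add: image_iff)
    have gap: ?thesis if "a < i" "Suc i < b" "c = i \<or> c = Suc i"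
    proof (intro exI conjI)
      show "(i, i + 1) \<in> ?M" by simp
    qed (use that in auto)
    show ?thesis
    proof (rule skip_cases[of c i])
      fix c' assume c': "c = skip i c'"
      then have "x < c'" "c' < y" using adjacent.prems(2,3) ab by simp_all
      from adjacent.IH[OF ab(3) this] obtain u v where
        uv: "(u, v) \<in> M" "x \<in> B \<longrightarrow> u \<in> B" "x < u" "v < y" "c' = u \<or> c' = v" by blast
      show ?thesis
      proof (intro exI conjI)
        show "(skip i u, skip i v) \<in> ?M" using uv(1) by (intro insertI2 image_eqI[of _ _ "(u, v)"]) simp_all
        show "a \<in> insert i (skip i ` B) \<longrightarrow> skip i u \<in> insert i (skip i ` B)"
          using uv(2) aB by blast
      qed (use uv(3-5) ab c' in \<open>simp_all\<close>)
    next
      assume c: "c = i"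
      show ?thesis by (rule gap) (use adjacent.prems(2,3) ab c in \<open>simp_all add: skip_gap\<close>)
    next
      assume c: "c = Suc i"
      show ?thesis by (rule gap) (use adjacent.prems(2,3) ab c in \<open>simp_all add: skip_gap\<close>)
    qed
  qed
qed

text \<open>The first round ends only when the remaining sequence is \<open>\<and>\<dots>\<and>\<or>\<dots>\<or>\<close>.\<close>
lemma diagram_maximal:
  "diagram n k B M \<Longrightarrow> a \<in> B \<Longrightarrow> b \<notin> B \<Longrightarrow> a < b \<Longrightarrow> b \<le> n \<Longrightarrow>
    a \<in> endpoints {c \<in> M. fst c \<in> B} \<or> b \<in> endpoints {c \<in> M. fst c \<in> B}"
proof (induction arbitrary: a b rule: diagram.induct)
  case (nested k n) then show ?case by auto
next
  case (adjacent n k B M i)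
  let ?B = "insert i (skip i ` B)" and ?M = "insert (i, i + 1) (map_prod (skip i) (skip i) ` M)"
  have *: "{c \<in> ?M. fst c \<in> ?B} = insert (i, i + 1) (map_prod (skip i) (skip i) ` {c \<in> M. fst c \<in> B})"
    by (auto simp: image_iff) (metis map_prod_simp)+
  show ?case unfolding * endpoints_insert endpoints_map
  proof (rule skip_cases[of a i], simp, simp)
    fix a' assume a': "a = skip i a'"
    show "a \<in> {i, i + 1} \<union> skip i ` endpoints {c \<in> M. fst c \<in> B} \<or>
          b \<in> {i, i + 1} \<union> skip i ` endpoints {c \<in> M. fst c \<in> B}"
    proof (rule skip_cases[of b i], simp, simp)
      fix b' assume b': "b = skip i b'"
      have "a' \<in> B" using adjacent.prems(1) a' by auto
      moreover have "b' \<notin> B" "a' < b'" using adjacent.prems a' b' by auto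
      moreover have "b' \<le> n" using adjacent.prems(4) b' adjacent.hyps(2) by (auto simp: skip_def split: if_splits)
      ultimately show ?thesis using adjacent.IH a' b' by auto
    qed
  qed
qed

lemma diagram_finite: assumes "diagram n k B M" shows "finite M"
proof (rule finite_subset)
  show "M \<subseteq> {1..n} \<times> {1..n}"
  proof (rule subrelI)
    fix a b assume "(a, b) \<in> M"
    from diagram_cup_bounds[OF assms this] show "(a, b) \<in> {1..n} \<times> {1..n}" by simp
  qed
qed simp

text \<open>Cups can be counted by the entries of the bottom row, whichever end carries the \<open>\<or>\<close>.\<close>
lemma diagram_bij_betw:
  assumes D: "diagram n k B M"
  shows "bij_betw (\<lambda>(a, b). if a \<in> B then a else b) M B"
proof (rule bij_betw_imageI)
  show "inj_on (\<lambda>(a, b). if a \<in> B then a else b) M"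
  proof (rule inj_onI, clarify)
    fix a b c d assume ab: "(a, b) \<in> M" and cd: "(c, d) \<in> M"
      and eq: "(if a \<in> B then a else b) = (if c \<in> B then c else d)"
    have "{a, b} \<inter> {c, d} \<noteq> {}" using eq by (auto split: if_splits)
    from diagram_disjoint[OF D ab cd this] show "a = c \<and> b = d" by simp
  qed
  show "(\<lambda>(a, b). if a \<in> B then a else b) ` M = B"
  proof
    show "(\<lambda>(a, b). if a \<in> B then a else b) ` M \<subseteq> B"
    proof clarify
      fix a b assume "(a, b) \<in> M"
      from diagram_cup_alternates[OF D this] show "(if a \<in> B then a else b) \<in> B" by simp
    qed
    show "B \<subseteq> (\<lambda>(a, b). if a \<in> B then a else b) ` M"
    proof
      fix x assume x: "x \<in> B"
      then obtain a b where ab: "(a, b) \<in> M" "x = a \<or> x = b"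
        using diagram_covers[OF D] by (force simp: endpoints_def)
      then show "x \<in> (\<lambda>(a, b). if a \<in> B then a else b) ` M"
        using diagram_cup_alternates[OF D ab(1)] x by (intro image_eqI[of _ _ "(a, b)"]) auto
    qed
  qed
qed

lemma diagram_crossingless:
  assumes D: "diagram n k B M"
  shows "crossingless_matching n k M"
  unfolding crossingless_matching_def
proof (intro conjI)
  show "card M = k" using bij_betw_same_card[OF diagram_bij_betw[OF D]] diagram_set[OF D] by simp
  show "finite M" using D by (rule diagram_finite)
  show "\<forall>(a, b)\<in>M. 1 \<le> a \<and> a < b \<and> b \<le> n" using diagram_cup_bounds[OF D] by blast
  show "\<forall>(a, b)\<in>M. \<forall>(c, d)\<in>M. (a, b) \<noteq> (c, d) \<longrightarrow> {a, b} \<inter> {c, d} = {}"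
    using diagram_disjoint[OF D] by blast
  show "\<forall>(a, b)\<in>M. \<forall>(c, d)\<in>M. \<not> (a < c \<and> c < b \<and> b < d)"
    using diagram_noncrossing[OF D] by blast
  show "\<forall>(a, b)\<in>M. {a<..<b} \<subseteq> endpoints M"
  proof clarify
    fix a b c assume "(a, b) \<in> M" "c \<in> {a<..<b}"
    then obtain x y where "(x, y) \<in> M" "c = x \<or> c = y"
      using diagram_inside_cup[OF D, of a b c] by auto
    then show "c \<in> endpoints M" by (force simp: endpoints_def)
  qed
qed

lemma crossingless_matchingD:
  assumes M: "crossingless_matching n k M" and ab: "(a, b) \<in> M"
  shows "1 \<le> a" "a < b" "b \<le> n" "a < c \<Longrightarrow> c < b \<Longrightarrow> c \<in> endpoints M"
    and "(c, d) \<in> M \<Longrightarrow> {a, b} \<inter> {c, d} \<noteq> {} \<Longrightarrow> (a, b) = (c, d)"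
    and "(c, d) \<in> M \<Longrightarrow> \<not> (a < c \<and> c < b \<and> b < d)"
proof -
  have *: "\<forall>(a, b)\<in>M. 1 \<le> a \<and> a < b \<and> b \<le> n" "\<forall>(a, b)\<in>M. {a<..<b} \<subseteq> endpoints M"
    "\<forall>(a, b)\<in>M. \<forall>(c, d)\<in>M. (a, b) \<noteq> (c, d) \<longrightarrow> {a, b} \<inter> {c, d} = {}"
    "\<forall>(a, b)\<in>M. \<forall>(c, d)\<in>M. \<not> (a < c \<and> c < b \<and> b < d)"
    using M by (simp_all add: crossingless_matching_def)
  show "1 \<le> a" "a < b" "b \<le> n" using *(1) ab by auto
  show "c \<in> endpoints M" if "a < c" "c < b" using bspec[OF *(2) ab] that by auto
  show "(a, b) = (c, d)" if "(c, d) \<in> M" "{a, b} \<inter> {c, d} \<noteq> {}"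
    using *(3) ab that by fast
  show "\<not> (a < c \<and> c < b \<and> b < d)" if "(c, d) \<in> M"
    using *(4) ab that by fast
qed

lemma crossingless_matching_inj:
  assumes M: "crossingless_matching n k M"
  shows "inj_on fst M" "inj_on snd M"
proof -
  show "inj_on fst M"
  proof (rule inj_onI)
    fix x y assume "x \<in> M" "y \<in> M" "fst x = fst y"
    then show "x = y"
      using crossingless_matchingD(5)[OF M, of "fst x" "snd x" "fst y" "snd y"]
      by (cases x, cases y) simp
  qed
  show "inj_on snd M"
  proof (rule inj_onI)
    fix x y assume "x \<in> M" "y \<in> M" "snd x = snd y"
    then show "x = y"
      using crossingless_matchingD(5)[OF M, of "fst x" "snd x" "fst y" "snd y"]
      by (cases x, cases y) simp
  qed
qed

lemma row_strict_entries:
  assumes "row_strict n k w" "k \<le> n"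
  shows "card (bot_entries w) = k" "card (top_entries w) = n - k"
    "top_entries w = {1..n} - bot_entries w" "bot_entries w \<subseteq> {1..n}"
proof -
  have d: "distinct (fst w)" "distinct (snd w)"
    using assms(1) by (auto simp: row_strict_def sorted_wrt_iff_nth_less distinct_conv_nth)
      (metis linorder_neqE_nat order_less_irrefl)+
  then show c: "card (bot_entries w) = k" "card (top_entries w) = n - k"
    using assms(1) by (auto simp: row_strict_def distinct_card)
  have u: "top_entries w \<union> bot_entries w = {1..n}" using assms(1) by (simp add: row_strict_def)
  have "card (top_entries w \<union> bot_entries w) + card (top_entries w \<inter> bot_entries w) = n"
    using card_Un_Int[of "top_entries w" "bot_entries w"] c assms(2) by simp
  then have "card (top_entries w \<inter> bot_entries w) = 0" using u by simp
  then show "top_entries w = {1..n} - bot_entries w" "bot_entries w \<subseteq> {1..n}" using u by auto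
qed

lemma endpointsE:
  assumes "x \<in> endpoints M" obtains a b where "(a, b) \<in> M" "x = a \<or> x = b"
  using assms unfolding endpoints_def by fastforce

lemma endpointsI: "(a, b) \<in> M \<Longrightarrow> x = a \<or> x = b \<Longrightarrow> x \<in> endpoints M"
  unfolding endpoints_def by force

text \<open>The cups whose left end is in the bottom row are those of the first round, the others those of
  the second.\<close>
lemma cup_diagram_eq:
  assumes D: "diagram n k (bot_entries w) M" and w: "row_strict n k w" "k \<le> n"
  shows "cup_diagram w = M"
proof -
  let ?B = "bot_entries w" and ?T = "top_entries w"
  define M1 where "M1 = {c \<in> M. fst c \<in> ?B}"
  define M2 where "M2 = {c \<in> M. fst c \<notin> ?B}"
  have M1: "(a, b) \<in> M1 \<longleftrightarrow> (a, b) \<in> M \<and> a \<in> ?B" and M2: "(a, b) \<in> M2 \<longleftrightarrow> (a, b) \<in> M \<and> a \<notin> ?B" for a b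
    by (simp_all add: M1_def M2_def)
  have T: "x \<in> ?T \<longleftrightarrow> 1 \<le> x \<and> x \<le> n \<and> x \<notin> ?B" for x
    using row_strict_entries(3)[OF w] by auto
  have disj: "(a, b) = (c, d)" if "(a, b) \<in> M" "(c, d) \<in> M" "{a, b} \<inter> {c, d} \<noteq> {}" for a b c d
    using diagram_disjoint[OF D that] .
  have J1: "join_cups {} ?B ?T = M1"
  proof (rule join_cups_eqI)
    fix a b assume "(a, b) \<in> M1"
    then show "a \<in> ?B - {} \<and> b \<in> ?T - {} \<and> a < b"
      using diagram_cup_alternates[OF D, of a b] diagram_cup_bounds[OF D, of a b] by (simp add: M1 T)
  next
    fix a b c assume "(a, b) \<in> M1" "a < c" "c < b"
    then show "c \<in> {} \<or> (\<exists>x y. (x, y) \<in> M1 \<and> a < x \<and> y < b \<and> (c = x \<or> c = y))"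
      using diagram_inside_cup[OF D, of a b c] unfolding M1 by blast
  next
    fix a b assume "a \<in> ?B - {}" "b \<in> ?T - {}" "a < b"
    then show "a \<in> endpoints M1 \<or> b \<in> endpoints M1"
      using diagram_maximal[OF D, of a b] unfolding M1_def by (simp add: T)
  next
    fix a b c d assume "(a, b) \<in> M1" "(c, d) \<in> M1" "{a, b} \<inter> {c, d} \<noteq> {}"
    then show "(a, b) = (c, d)" using disj unfolding M1 by blast
  next
    show "?B \<inter> ?T = {}" using T by blast
  qed
  have J2: "join_cups (endpoints M1) ?T ?B = M2"
  proof (rule join_cups_eqI)
    fix a b assume ab: "(a, b) \<in> M2"
    have "x \<notin> endpoints M1" if "x = a \<or> x = b" for x
    proof
      assume "x \<in> endpoints M1"
      then obtain c d where cd: "(c, d) \<in> M1" "x = c \<or> x = d" by (rule endpointsE)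
      then have "{a, b} \<inter> {c, d} \<noteq> {}" using that by blast
      then have "(a, b) = (c, d)" using disj ab cd(1) unfolding M1 M2 by blast
      then show False using ab cd(1) by (simp add: M1 M2)
    qed
    then show "a \<in> ?T - endpoints M1 \<and> b \<in> ?B - endpoints M1 \<and> a < b"
      using ab diagram_cup_alternates[OF D, of a b] diagram_cup_bounds[OF D, of a b] by (simp add: M2 T)
  next
    fix a b c assume ab: "(a, b) \<in> M2" "a < c" "c < b"
    then obtain x y where xy: "(x, y) \<in> M" "a < x" "y < b" "c = x \<or> c = y"
      using diagram_inside_cup[OF D, of a b c] unfolding M2 by blast
    show "c \<in> endpoints M1 \<or> (\<exists>x y. (x, y) \<in> M2 \<and> a < x \<and> y < b \<and> (c = x \<or> c = y))"
      using xy endpointsI[of x y M1 c] M1 M2 by blast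
  next
    fix a b assume b: "b \<in> ?B - endpoints M1"
    then have "b \<in> endpoints M" using diagram_covers[OF D] by blast
    then obtain x y where xy: "(x, y) \<in> M" "b = x \<or> b = y" by (rule endpointsE)
    then have "(x, y) \<in> M2" using b endpointsI[of x y M1 b] M1 M2 by blast
    then show "a \<in> endpoints M2 \<or> b \<in> endpoints M2" using endpointsI[of x y M2 b] xy(2) by blast
  next
    fix a b c d assume "(a, b) \<in> M2" "(c, d) \<in> M2" "{a, b} \<inter> {c, d} \<noteq> {}"
    then show "(a, b) = (c, d)" using disj unfolding M2 by blast
  next
    show "?T \<inter> ?B = {}" using T by blast
  qed
  show ?thesis unfolding cup_diagram_def Let_def J1 J2 by (auto simp: M1_def M2_def)
qed

text \<open>A crossingless matching is determined by its left endpoints, since it is the result of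
  joining them to neighbouring points on their right.\<close>
lemma crossingless_matching_eq_join_cups:
  assumes M: "crossingless_matching n k M"
  shows "M = join_cups {} (fst ` M) ({1..n} - fst ` M)"
proof (rule join_cups_eqI[symmetric])
  note disj = crossingless_matchingD(5)[OF M] and bd = crossingless_matchingD(1-3)[OF M]
    and nc = crossingless_matchingD(6)[OF M]
  show "(a, b) = (c, d)" if "(a, b) \<in> M" "(c, d) \<in> M" "{a, b} \<inter> {c, d} \<noteq> {}" for a b c d
    using disj[OF that] .
  fix a b assume ab: "(a, b) \<in> M"
  have "b \<notin> fst ` M"
  proof
    assume "b \<in> fst ` M"
    then obtain d where "(b, d) \<in> M" by auto
    then show False using disj[OF ab, of b d] bd[OF ab] by auto
  qed
  then show "a \<in> fst ` M - {} \<and> b \<in> {1..n} - fst ` M - {} \<and> a < b"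
    using ab bd[OF ab] by force
  fix c assume c: "a < c" "c < b"
  then have "c \<in> endpoints M" using crossingless_matchingD(4)[OF M ab] by blast
  then obtain x y where xy: "(x, y) \<in> M" "c = x \<or> c = y" by (force simp: endpoints_def)
  have "(a, b) \<noteq> (x, y)" using c xy by auto
  then have "{a, b} \<inter> {x, y} = {}" using disj[OF ab xy(1)] by blast
  then have "a < x" "y < b"
    using nc[OF ab xy(1)] nc[OF xy(1) ab] bd[OF xy(1)] c xy(2) by auto
  then show "c \<in> {} \<or> (\<exists>x y. (x, y) \<in> M \<and> a < x \<and> y < b \<and> (c = x \<or> c = y))"
    using xy by blast
qed (auto simp: endpoints_def)

lemma matching_of_eq:
  assumes "crossingless_matching n k M" "fst ` M = bot_entries S"
  shows "matching_of n k S = M"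
  unfolding matching_of_def
proof (rule the_equality)
  fix M' assume M': "crossingless_matching n k M' \<and> fst ` M' = bot_entries S"
  have "M' = join_cups {} (bot_entries S) ({1..n} - bot_entries S)"
    using crossingless_matching_eq_join_cups[of n k M'] M' by simp
  also have "\<dots> = M"
    using crossingless_matching_eq_join_cups[OF assms(1)] assms(2) by simp
  finally show "M' = M" .
qed (use assms in simp)

lemma card_ge_nth:
  assumes "sorted_wrt (>) xs" "j < length xs"
  shows "{x \<in> set xs. xs ! j \<le> x} = (!) xs ` {..j}" "card {x \<in> set xs. xs ! j \<le> (x::nat)} = Suc j"
proof -
  have lt: "xs ! b < xs ! a" if "a < b" "b < length xs" for a b
    using assms(1) that by (simp add: sorted_wrt_iff_nth_less)
  have iff: "xs ! j \<le> xs ! l \<longleftrightarrow> l \<le> j" if "l < length xs" for l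
    using lt[of l j] lt[of j l] assms(2) that by (cases l j rule: linorder_cases) auto
  show 1: "{x \<in> set xs. xs ! j \<le> x} = (!) xs ` {..j}"
  proof (intro equalityI subsetI)
    fix x assume x: "x \<in> {x \<in> set xs. xs ! j \<le> x}"
    then obtain l where "l < length xs" "x = xs ! l" by (auto simp: in_set_conv_nth)
    then show "x \<in> (!) xs ` {..j}" using iff[of l] x by simp
  next
    fix x assume "x \<in> (!) xs ` {..j}"
    then obtain l where "l \<le> j" "x = xs ! l" by auto
    then show "x \<in> {x \<in> set xs. xs ! j \<le> x}" using iff[of l] assms(2) by simp
  qed
  have "inj_on ((!) xs) {..j}"
  proof (rule inj_onI)
    fix a b assume "a \<in> {..j}" "b \<in> {..j}" "xs ! a = xs ! b"
    then show "a = b" using lt[of a b] lt[of b a] assms(2) by (cases a b rule: linorder_cases) auto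
  qed
  then show "card {x \<in> set xs. xs ! j \<le> x} = Suc j" unfolding 1 by (simp add: card_image)
qed

text \<open>The column condition as a ballot condition on the weight sequence read from the right: the
  \<open>j\<close>-th largest bottom entry is exceeded by at least \<open>j\<close> top entries.\<close>
lemma standard_iff:
  assumes "2 * k \<le> n"
  shows "standard n k S \<longleftrightarrow> row_strict n k S \<and>
    (\<forall>b \<in> bot_entries S. card {x \<in> bot_entries S. b \<le> x} \<le> card {x \<in> top_entries S. b \<le> x})"
    (is "_ \<longleftrightarrow> _ \<and> ?R")
proof (cases "row_strict n k S")
  case True
  then have l: "length (fst S) = n - k" "length (snd S) = k" "sorted_wrt (>) (fst S)" "sorted_wrt (>) (snd S)"
    by (auto simp: row_strict_def)
  have disj: "top_entries S \<inter> bot_entries S = {}" using row_strict_entries[OF True] assms by auto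
  have "?R \<longleftrightarrow> (\<forall>j<k. card {x \<in> bot_entries S. snd S ! j \<le> x} \<le> card {x \<in> top_entries S. snd S ! j \<le> x})"
    by (simp only: all_set_conv_all_nth l(2))
  also have "\<dots> \<longleftrightarrow> (\<forall>j<k. Suc j \<le> card {x \<in> top_entries S. snd S ! j \<le> x})"
    using card_ge_nth(2)[OF l(4)] l(2) by simp
  also have "\<dots> \<longleftrightarrow> (\<forall>j<k. fst S ! j > snd S ! j)"
  proof (intro all_cong)
    fix j assume j: "j < k"
    then have jn: "j < length (fst S)" using assms l by simp
    show "Suc j \<le> card {x \<in> top_entries S. snd S ! j \<le> x} \<longleftrightarrow> fst S ! j > snd S ! j"
    proof
      assume "snd S ! j < fst S ! j"
      then have "{x \<in> top_entries S. fst S ! j \<le> x} \<subseteq> {x \<in> top_entries S. snd S ! j \<le> x}" by auto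
      from card_mono[OF _ this] show "Suc j \<le> card {x \<in> top_entries S. snd S ! j \<le> x}"
        using card_ge_nth(2)[OF l(3) jn] by simp
    next
      assume h: "Suc j \<le> card {x \<in> top_entries S. snd S ! j \<le> x}"
      show "snd S ! j < fst S ! j"
      proof (rule ccontr)
        assume "\<not> snd S ! j < fst S ! j"
        moreover have m: "fst S ! j \<in> top_entries S" "snd S ! j \<in> bot_entries S"
          using j jn l(2) by simp_all
        then have "fst S ! j \<noteq> snd S ! j" using disj by auto
        ultimately have "fst S ! j < snd S ! j" by simp
        then have "fst S ! j \<notin> {x \<in> top_entries S. snd S ! j \<le> x}"
          "fst S ! j \<in> {x \<in> top_entries S. fst S ! j \<le> x}"
          "{x \<in> top_entries S. snd S ! j \<le> x} \<subseteq> {x \<in> top_entries S. fst S ! j \<le> x}"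
          using m(1) by auto
        then have "{x \<in> top_entries S. snd S ! j \<le> x} \<subset> {x \<in> top_entries S. fst S ! j \<le> x}"
          by blast
        from psubset_card_mono[OF _ this] h show False using card_ge_nth(2)[OF l(3) jn] by simp
      qed
    qed
  qed
  finally show ?thesis using True by (simp add: standard_def)
qed (simp add: standard_def)

text \<open>Cups end to the right of where they begin.\<close>
lemma left_endpoints_ballot:
  assumes M: "crossingless_matching n k M"
  shows "card {x \<in> fst ` M. b \<le> x} \<le> card {x \<in> {1..n} - fst ` M. b \<le> x}"
proof -
  have J: "M = join_cups {} (fst ` M) ({1..n} - fst ` M)"
    by (rule crossingless_matching_eq_join_cups[OF M])
  have snd_range: "x < y \<and> y \<in> {1..n} - fst ` M" if "(x, y) \<in> M" for x y
  proof -
    have "(x, y) \<in> join_cups {} (fst ` M) ({1..n} - fst ` M)" using that by (subst (asm) J)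
    then show ?thesis by cases simp
  qed
  note inj = crossingless_matching_inj[OF M]
  let ?K = "{c \<in> M. b \<le> fst c}"
  have "card {x \<in> fst ` M. b \<le> x} = card (fst ` ?K)" by (rule arg_cong[of _ _ card]) auto
  also have "\<dots> = card (snd ` ?K)"
    using card_image[OF inj_on_subset[OF inj(1)], of ?K] card_image[OF inj_on_subset[OF inj(2)], of ?K]
    by auto
  also have "\<dots> \<le> card {x \<in> {1..n} - fst ` M. b \<le> x}"
  proof (rule card_mono, simp, clarify)
    fix x y assume "(x, y) \<in> M" "b \<le> fst (x, y)"
    then show "snd (x, y) \<in> {1..n} - fst ` M \<and> b \<le> snd (x, y)" using snd_range[of x y] by auto
  qed
  finally show ?thesis .
qed

lemma standard_exists:
  assumes M: "crossingless_matching n k M" and nk: "2 * k \<le> n"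
  shows "\<exists>S. standard n k S \<and> bot_entries S = fst ` M"
proof -
  define S where "S = (rev (sorted_list_of_set ({1..n} - fst ` M)), rev (sorted_list_of_set (fst ` M)))"
  have fin: "finite (fst ` M)" using M by (simp add: crossingless_matching_def)
  have sub: "fst ` M \<subseteq> {1..n}"
  proof clarify
    fix a b assume "(a, b) \<in> M"
    from crossingless_matchingD(1-3)[OF M this] show "fst (a, b) \<in> {1..n}" by simp
  qed
  have c: "card (fst ` M) = k" using M by (simp add: card_image crossingless_matching_inj(1)[OF M] crossingless_matching_def)
  have bt: "bot_entries S = fst ` M" "top_entries S = {1..n} - fst ` M" using fin by (auto simp: S_def)
  have len: "length (fst S) = n - k" "length (snd S) = k"
    using c card_Diff_subset[OF fin sub] by (simp_all add: S_def)
  have sorted: "sorted_wrt (>) (fst S)" "sorted_wrt (>) (snd S)"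
    by (simp_all add: S_def sorted_wrt_rev)
  have "top_entries S \<union> bot_entries S = {1..n}" unfolding bt using sub by blast
  then have "row_strict n k S" using len sorted by (simp add: row_strict_def)
  moreover have "\<forall>b \<in> bot_entries S. card {x \<in> bot_entries S. b \<le> x} \<le> card {x \<in> top_entries S. b \<le> x}"
    unfolding bt using left_endpoints_ballot[OF M] by blast
  ultimately have "standard n k S" unfolding standard_iff[OF nk] by blast
  then show ?thesis using bt(1) by blast
qed

lemma row_strict_eqI:
  assumes "row_strict n k S" "row_strict n k S'" "k \<le> n" "bot_entries S = bot_entries S'"
  shows "S = S'"
proof -
  have *: "xs = ys" if "sorted_wrt (>) xs" "sorted_wrt (>) ys" "set xs = set ys" for xs ys :: "nat list"
  proof -
    have "sorted_wrt (<) (rev xs)" "sorted_wrt (<) (rev ys)" using that by (auto simp: sorted_wrt_rev)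
    then have "rev xs = rev ys" using that(3) strict_sorted_equal[of "rev xs" "rev ys"] by simp
    then show ?thesis by simp
  qed
  have "sorted_wrt (>) (fst S)" "sorted_wrt (>) (snd S)" "sorted_wrt (>) (fst S')" "sorted_wrt (>) (snd S')"
    using assms(1,2) by (simp_all add: row_strict_def)
  moreover have "top_entries S = top_entries S'"
    using row_strict_entries(3)[OF assms(1,3)] row_strict_entries(3)[OF assms(2,3)] assms(4) by simp
  ultimately have "fst S = fst S'" "snd S = snd S'" using *[of "fst S" "fst S'"] *[of "snd S" "snd S'"] assms(4)
    by simp_all
  then show ?thesis by (rule prod_eqI)
qed

text \<open>For a standard tableau the second round finds nothing to do: if the \<open>\<or>\<close> at \<open>b\<close> were left over
  by the first round, every \<open>\<and>\<close> to its right would be joined to a \<open>\<or>\<close> to the right of \<open>b\<close>, and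
  the ballot condition would fail at \<open>b\<close>.\<close>
lemma diagram_standard:
  assumes D: "diagram n k (bot_entries S) M" and S: "standard n k S"
  shows "fst ` M = bot_entries S"
proof -
  have nk: "2 * k \<le> n" using diagram_set[OF D] by simp
  have rs: "row_strict n k S" using S by (simp add: standard_def)
  let ?B = "bot_entries S"
  have T: "top_entries S = {1..n} - ?B" using row_strict_entries[OF rs] nk by simp
  let ?M1 = "{c \<in> M. fst c \<in> ?B}"
  have fstB: "a \<in> ?B" if ab: "(a, b) \<in> M" for a b
  proof (rule ccontr)
    assume a: "a \<notin> ?B"
    then have b: "b \<in> ?B" using diagram_cup_alternates[OF D ab] by simp
    have bM1: "b \<notin> endpoints ?M1"
    proof
      assume "b \<in> endpoints ?M1"
      then obtain c d where cd: "(c, d) \<in> ?M1" "b = c \<or> b = d" by (rule endpointsE)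
      then have "(a, b) = (c, d)" using diagram_disjoint[OF D ab, of c d] by auto
      then show False using cd(1) a by simp
    qed
    let ?K = "{c \<in> ?M1. b \<le> snd c}"
    have K: "b < x" if "(x, y) \<in> ?K" for x y
    proof (rule ccontr)
      have xy: "(x, y) \<in> M" "x \<in> ?B" "b \<le> y" using that by simp_all
      assume "\<not> b < x"
      moreover have "b \<noteq> x" "b \<noteq> y" using bM1 xy endpointsI[of x y ?M1 b] by auto
      ultimately have "x < b" "b < y" using xy by simp_all
      then obtain u v where "(u, v) \<in> M" "u \<in> ?B" "b = u \<or> b = v"
        using diagram_inside_cup[OF D xy(1)] xy(2) by blast
      then show False using bM1 endpointsI[of u v ?M1 b] by simp
    qed
    note inj = crossingless_matching_inj[OF diagram_crossingless[OF D]]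
    have "{x \<in> top_entries S. b \<le> x} \<subseteq> snd ` ?K"
    proof
      fix x assume x: "x \<in> {x \<in> top_entries S. b \<le> x}"
      then have "x \<notin> ?B" "b < x" "x \<le> n" using T b by (auto simp: le_less)
      then have "x \<in> endpoints ?M1" using diagram_maximal[OF D b] bM1 by blast
      then obtain c d where cd: "(c, d) \<in> ?M1" "x = c \<or> x = d" by (rule endpointsE)
      then have "x = d" using \<open>x \<notin> ?B\<close> by auto
      then show "x \<in> snd ` ?K" using cd x by (intro image_eqI[of _ _ "(c, d)"]) auto
    qed
    then have "card {x \<in> top_entries S. b \<le> x} \<le> card (snd ` ?K)"
      using diagram_finite[OF D] by (intro card_mono) auto
    also have "\<dots> = card (fst ` ?K)"
      using card_image[OF inj_on_subset[OF inj(1)], of ?K] card_image[OF inj_on_subset[OF inj(2)], of ?K]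
      by auto
    also have "\<dots> < card {x \<in> ?B. b \<le> x}"
    proof (rule psubset_card_mono)
      show "fst ` ?K \<subset> {x \<in> ?B. b \<le> x}"
      proof (rule psubsetI)
        show "fst ` ?K \<subseteq> {x \<in> ?B. b \<le> x}"
        proof
          fix x assume "x \<in> fst ` ?K"
          then obtain y where "(x, y) \<in> ?K" by auto
          then show "x \<in> {x \<in> ?B. b \<le> x}" using K[of x y] by simp
        qed
        have "b \<notin> fst ` ?K"
        proof
          assume "b \<in> fst ` ?K"
          then obtain y where "(b, y) \<in> ?K" by auto
          then show False using K[of b y] by simp
        qed
        then show "fst ` ?K \<noteq> {x \<in> ?B. b \<le> x}" using b by blast
      qed
    qed simp
    finally show False using S b nk by (simp add: standard_iff leD)
  qed
  show ?thesis
  proof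
    show "fst ` M \<subseteq> ?B" using fstB by auto
    show "?B \<subseteq> fst ` M"
    proof
      fix b assume b: "b \<in> ?B"
      then have "b \<in> endpoints M" using diagram_covers[OF D] by blast
      then obtain x y where xy: "(x, y) \<in> M" "b = x \<or> b = y" by (rule endpointsE)
      then have "b = x" using diagram_cup_alternates[OF D xy(1)] fstB[OF xy(1)] b by blast
      then show "b \<in> fst ` M" using xy(1) by (intro image_eqI[of _ _ "(x, y)"]) auto
    qed
  qed
qed

lemma matching_of_standard:
  assumes "standard n k S" "2 * k \<le> n"
  obtains M where "diagram n k (bot_entries S) M" "matching_of n k S = M" "fst ` M = bot_entries S"
proof -
  have rs: "row_strict n k S" and kn: "k \<le> n" using assms by (simp_all add: standard_def)
  obtain M where M: "diagram n k (bot_entries S) M"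
    using diagram_exists[OF row_strict_entries(4,1)[OF rs kn] assms(2)] by blast
  have fst: "fst ` M = bot_entries S" by (rule diagram_standard[OF M assms(1)])
  show ?thesis by (rule that[OF M matching_of_eq[OF diagram_crossingless[OF M] fst] fst])
qed

lemma standardization_diagram:
  assumes D: "diagram n k (bot_entries w) M" and w: "row_strict n k w" and nk: "2 * k \<le> n"
  shows "standard n k (standardization n k w)" "matching_of n k (standardization n k w) = M"
    "bot_entries (standardization n k w) = fst ` M"
proof -
  have C: "cup_diagram w = M" using cup_diagram_eq[OF D w] nk by simp
  obtain S where S: "standard n k S" "bot_entries S = fst ` M"
    using standard_exists[OF diagram_crossingless[OF D] nk] by blast
  have SM: "matching_of n k S = M" by (rule matching_of_eq[OF diagram_crossingless[OF D] S(2)[symmetric]])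
  have "standardization n k w = S"
    unfolding standardization_def
  proof (rule the_equality)
    show "standard n k S \<and> matching_of n k S = cup_diagram w" using S SM C by simp
    fix S' assume S': "standard n k S' \<and> matching_of n k S' = cup_diagram w"
    then obtain M' where "matching_of n k S' = M'" "fst ` M' = bot_entries S'"
      using matching_of_standard[of n k S'] nk by blast
    then have "fst ` M = bot_entries S'" using S' C by simp
    then have "bot_entries S' = bot_entries S" using S(2) by simp
    moreover have "row_strict n k S'" "row_strict n k S" using S(1) S' by (simp_all add: standard_def)
    ultimately show "S' = S" using row_strict_eqI[of n k S' S] nk by simp
  qed
  then show "standard n k (standardization n k w)" "matching_of n k (standardization n k w) = M"
    "bot_entries (standardization n k w) = fst ` M" by (simp_all only: S SM)
qed

lemma standardization_standard:
  assumes S: "standard n k S" and nk: "2 * k \<le> n"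
  shows "standardization n k S = S"
proof -
  have rs: "row_strict n k S" using S by (simp add: standard_def)
  obtain M where M: "diagram n k (bot_entries S) M" "fst ` M = bot_entries S"
    using matching_of_standard[OF S nk] by blast
  have "bot_entries (standardization n k S) = bot_entries S"
    using standardization_diagram(3)[OF M(1) rs nk] M(2) by simp
  moreover have "row_strict n k (standardization n k S)"
    using standardization_diagram(1)[OF M(1) rs nk] by (simp add: standard_def)
  ultimately show ?thesis using row_strict_eqI[OF _ rs] nk by simp
qed

section \<open>Linear algebra of two Jordan blocks\<close>

lemma vec_rank_nullity:
  fixes f :: "'a::field ^ 'm::finite \<Rightarrow> 'a ^ 'm"
  assumes f: "Vector_Spaces.linear (*s) (*s) f" and S: "vec.subspace S"
  shows "vec.dim S = vec.dim (f ` S) + vec.dim {x \<in> S. f x = 0}"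
proof -
  interpret f: Vector_Spaces.linear "(*s)" "(*s)" f by fact
  let ?Z = "{x \<in> S. f x = 0}"
  obtain C where C: "C \<subseteq> ?Z" "vec.independent C" "?Z \<subseteq> vec.span C" "card C = vec.dim ?Z"
    using vec.basis_exists[of ?Z] by auto
  obtain D where D: "C \<subseteq> D" "D \<subseteq> S" "vec.independent D" "S \<subseteq> vec.span D"
    using vec.maximal_independent_subset_extend[of C S] C by auto
  have finD: "finite D" using D(3) vec.finiteI_independent by blast
  have dimS: "card D = vec.dim S" using D vec.basis_card_eq_dim by blast
  have indE: "vec.independent (D - C)" using D(3) vec.dependent_mono by blast
  have inter: "x = 0" if x: "x \<in> vec.span (D - C)" "x \<in> vec.span C" for x
  proof -
    have "vec.representation D x = vec.representation (D - C) x"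
      "vec.representation D x = vec.representation C x"
      using vec.representation_extend[OF D(3) x(1)] vec.representation_extend[OF D(3) x(2) D(1)] by auto
    then have "vec.representation D x b = 0" for b
      using vec.representation_ne_zero[of C x b] vec.representation_ne_zero[of "D - C" x b] by auto
    moreover have "x \<in> vec.span D" using x(2) vec.span_mono[OF D(1)] by blast
    ultimately show ?thesis using vec.sum_nonzero_representation_eq[OF D(3), of x] by simp
  qed
  have DS: "vec.span (D - C) \<subseteq> S" using D(2) S by (intro vec.span_minimal) auto
  have inj: "inj_on f (vec.span (D - C))"
  proof (rule inj_onI)
    fix x y assume xy: "x \<in> vec.span (D - C)" "y \<in> vec.span (D - C)" "f x = f y"
    have d: "x - y \<in> vec.span (D - C)" using xy vec.span_diff by blast
    moreover have "x - y \<in> ?Z" using d DS xy(3) by (auto simp: f.diff)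
    ultimately have "x - y = 0" using inter C(3) by blast
    then show "x = y" by simp
  qed
  have "vec.span (f ` S) = vec.span (f ` (D - C))"
  proof
    have "f ` S \<subseteq> f ` vec.span D" using D(4) by auto
    also have "\<dots> = vec.span (f ` D)" by (simp add: f.span_image)
    also have "\<dots> \<subseteq> vec.span (f ` (D - C))"
    proof (rule vec.span_minimal[OF _ vec.subspace_span])
      show "f ` D \<subseteq> vec.span (f ` (D - C))"
      proof
        fix y assume "y \<in> f ` D"
        then obtain x where x: "x \<in> D" "y = f x" by auto
        show "y \<in> vec.span (f ` (D - C))"
        proof (cases "x \<in> C")
          case True
          then have "f x = 0" using C(1) by blast
          then show ?thesis using x(2) vec.span_zero by simp
        next
          case False then show ?thesis using x by (auto intro: vec.span_base)
        qed
      qed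
    qed
    finally show "vec.span (f ` S) \<subseteq> vec.span (f ` (D - C))"
      by (rule vec.span_minimal[OF _ vec.subspace_span])
    show "vec.span (f ` (D - C)) \<subseteq> vec.span (f ` S)" using D(2) by (intro vec.span_mono) auto
  qed
  then have "vec.dim (f ` S) = vec.dim (f ` (D - C))" by (rule vec.span_eq_dim)
  also have "\<dots> = vec.dim (D - C)" by (rule vec.dim_image_eq[OF f inj])
  also have "\<dots> = card (D - C)" by (rule vec.dim_eq_card_independent[OF indE])
  also have "\<dots> = card D - card C" using D(1) finD finite_subset by (intro card_Diff_subset) auto
  finally show ?thesis using C(4) dimS card_mono[OF finD D(1)] by simp
qed

lemma vec_subspace_eqI:
  fixes S T :: "('a::field ^ 'm::finite) set"
  assumes "vec.subspace S" "vec.subspace T" "S \<subseteq> T" "vec.dim T \<le> vec.dim S"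
  shows "S = T"
  using vec.subspace_dim_equal[OF assms] .

text \<open>The basis is fixed once and for all, while flags live in the subspaces \<open>U a b\<close> below, so that an
  induction on the number of cups can decrease both blocks.\<close>
locale two_jordan_blocks =
  fixes A K :: nat and p q :: "nat \<Rightarrow> complex ^ 'm::finite"
    and N :: "complex ^ 'm \<Rightarrow> complex ^ 'm"
  assumes ind: "vec.independent (p ` {1..A} \<union> q ` {1..K})"
    and card_basis: "card (p ` {1..A} \<union> q ` {1..K}) = A + K"
    and p0: "p 0 = 0" and q0: "q 0 = 0"
    and linN: "Vector_Spaces.linear (*s) (*s) N"
    and Np: "\<And>i. i \<in> {1..A} \<Longrightarrow> N (p i) = p (i - 1)"
    and Nq: "\<And>i. i \<in> {1..K} \<Longrightarrow> N (q i) = q (i - 1)"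
begin

sublocale N: Vector_Spaces.linear "(*s)" "(*s)" N by (rule linN)

definition basis :: "(complex ^ 'm) set" where
  "basis = p ` {1..A} \<union> q ` {1..K}"

definition W :: "(complex ^ 'm) set" where
  "W = vec.span basis"

lemma ind_basis: "vec.independent basis"
  using ind by (simp add: basis_def)

lemma W_closed: "0 \<in> W" "u \<in> W \<Longrightarrow> v \<in> W \<Longrightarrow> u + v \<in> W" "u \<in> W \<Longrightarrow> v \<in> W \<Longrightarrow> u - v \<in> W" "v \<in> W \<Longrightarrow> c *s v \<in> W"
  by (simp_all add: W_def vec.span_zero vec.span_add vec.span_diff vec.span_scale)

lemma p_in_basis: "i \<in> {1..A} \<Longrightarrow> p i \<in> basis" and q_in_basis: "i \<in> {1..K} \<Longrightarrow> q i \<in> basis"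
  by (auto simp: basis_def)

lemma inj_basis: "inj_on p {1..A}" "inj_on q {1..K}" "p ` {1..A} \<inter> q ` {1..K} = {}"
proof -
  have 1: "card (p ` {1..A}) \<le> A" "card (q ` {1..K}) \<le> K"
    using card_image_le[of "{1..A}" p] card_image_le[of "{1..K}" q] by simp_all
  have 2: "card (p ` {1..A}) + card (q ` {1..K}) = A + K + card (p ` {1..A} \<inter> q ` {1..K})"
    using card_Un_Int[of "p ` {1..A}" "q ` {1..K}"] card_basis by simp
  have "card (p ` {1..A} \<inter> q ` {1..K}) = 0" using 1 2 by linarith
  then show "p ` {1..A} \<inter> q ` {1..K} = {}" by (subst (asm) card_0_eq) auto
  show "inj_on p {1..A}" "inj_on q {1..K}" using 1 2 by (auto intro!: eq_card_imp_inj_on)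
qed

lemma p_neq_q: "i \<in> {1..A} \<Longrightarrow> j \<in> {1..K} \<Longrightarrow> p i \<noteq> q j"
  using inj_basis(3) by blast

definition p_coord :: "nat \<Rightarrow> complex ^ 'm \<Rightarrow> complex" where
  "p_coord i v = (if i \<in> {1..A} then vec.representation basis v (p i) else 0)"

definition q_coord :: "nat \<Rightarrow> complex ^ 'm \<Rightarrow> complex" where
  "q_coord i v = (if i \<in> {1..K} then vec.representation basis v (q i) else 0)"

lemma coord_add:
  assumes "u \<in> W" "v \<in> W"
  shows "p_coord i (u + v) = p_coord i u + p_coord i v" "q_coord i (u + v) = q_coord i u + q_coord i v"
  using vec.representation_add[OF ind_basis assms(2,1)[unfolded W_def]] by (simp_all add: p_coord_def q_coord_def)

lemma coord_diff:
  assumes "u \<in> W" "v \<in> W"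
  shows "p_coord i (u - v) = p_coord i u - p_coord i v" "q_coord i (u - v) = q_coord i u - q_coord i v"
  using vec.representation_diff[OF ind_basis assms(2,1)[unfolded W_def]] by (simp_all add: p_coord_def q_coord_def)

lemma coord_scale:
  assumes "v \<in> W"
  shows "p_coord i (c *s v) = c * p_coord i v" "q_coord i (c *s v) = c * q_coord i v"
  using vec.representation_scale[OF ind_basis assms[unfolded W_def]] by (simp_all add: p_coord_def q_coord_def)

lemma coord_zero [simp]: "p_coord i 0 = 0" "q_coord i 0 = 0"
  by (simp_all add: p_coord_def q_coord_def vec.representation_zero)

lemma coord_outside [simp]:
  "p_coord 0 v = 0" "A < i \<Longrightarrow> p_coord i v = 0" "q_coord 0 v = 0" "K < i \<Longrightarrow> q_coord i v = 0"
  by (simp_all add: p_coord_def q_coord_def)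

lemma basis_in_W: "i \<le> A \<Longrightarrow> p i \<in> W" "i \<le> K \<Longrightarrow> q i \<in> W"
proof -
  show "p i \<in> W" if "i \<le> A"
    using that p0 W_closed(1) vec.span_base[OF p_in_basis, of i] by (cases "i = 0") (simp_all add: W_def)
  show "q i \<in> W" if "i \<le> K"
    using that q0 W_closed(1) vec.span_base[OF q_in_basis, of i] by (cases "i = 0") (simp_all add: W_def)
qed

lemma coord_basis:
  "i \<in> {1..A} \<Longrightarrow> p_coord j (p i) = (if j = i then 1 else 0)"
  "i \<in> {1..A} \<Longrightarrow> q_coord j (p i) = 0"
  "i \<in> {1..K} \<Longrightarrow> q_coord j (q i) = (if j = i then 1 else 0)"
  "i \<in> {1..K} \<Longrightarrow> p_coord j (q i) = 0"
proof -
  assume i: "i \<in> {1..A}"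
  have r: "vec.representation basis (p i) = (\<lambda>v. if v = p i then 1 else 0)"
    by (rule vec.representation_basis[OF ind_basis p_in_basis[OF i]])
  show "p_coord j (p i) = (if j = i then 1 else 0)"
    using i inj_onD[OF inj_basis(1), of j i] unfolding p_coord_def r by auto
  show "q_coord j (p i) = 0"
    using p_neq_q[OF i, of j] unfolding q_coord_def r by auto
next
  assume i: "i \<in> {1..K}"
  have r: "vec.representation basis (q i) = (\<lambda>v. if v = q i then 1 else 0)"
    by (rule vec.representation_basis[OF ind_basis q_in_basis[OF i]])
  show "q_coord j (q i) = (if j = i then 1 else 0)"
    using i inj_onD[OF inj_basis(2), of j i] unfolding q_coord_def r by auto
  show "p_coord j (q i) = 0"
    using p_neq_q[OF _ i, of j] unfolding p_coord_def r by auto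
qed

lemma N_W: "v \<in> W \<Longrightarrow> N v \<in> W"
proof -
  have "vec.subspace {v. N v \<in> W}"
    by (simp add: vec.subspace_def N.add N.scale W_closed)
  moreover have "basis \<subseteq> {v. N v \<in> W}"
  proof -
    have "N (p i) \<in> W" if "i \<in> {1..A}" for i using Np[OF that] that basis_in_W(1)[of "i - 1"] by auto
    moreover have "N (q i) \<in> W" if "i \<in> {1..K}" for i using Nq[OF that] that basis_in_W(2)[of "i - 1"] by auto
    ultimately show ?thesis unfolding basis_def by blast
  qed
  ultimately have "W \<subseteq> {v. N v \<in> W}" unfolding W_def by (intro vec.span_minimal) (simp_all only: W_def)
  then show "v \<in> W \<Longrightarrow> N v \<in> W" by blast
qed

lemma coord_N:
  assumes v: "v \<in> W" and i: "1 \<le> i"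
  shows "p_coord i (N v) = p_coord (Suc i) v" "q_coord i (N v) = q_coord (Suc i) v"
proof -
  let ?S = "{v \<in> W. p_coord i (N v) = p_coord (Suc i) v \<and> q_coord i (N v) = q_coord (Suc i) v}"
  have "vec.subspace ?S"
    by (simp add: vec.subspace_def N.add N.scale coord_add coord_scale N_W W_closed)
  moreover have "basis \<subseteq> ?S"
  proof -
    have "p j \<in> ?S" if j: "j \<in> {1..A}" for j
    proof (cases "j = 1")
      case True
      then show ?thesis using j i Np[OF j] p0 by (simp add: coord_basis basis_in_W)
    next
      case False
      then have j': "j - 1 \<in> {1..A}" using j by auto
      have "N (p j) = p (j - 1)" by (rule Np[OF j])
      moreover have "(i = j - 1) = (Suc i = j)" using j False by auto
      ultimately show ?thesis using coord_basis(1,2)[OF j] coord_basis(1,2)[OF j'] basis_in_W(1)[of j] j by simp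
    qed
    moreover have "q j \<in> ?S" if j: "j \<in> {1..K}" for j
    proof (cases "j = 1")
      case True
      then show ?thesis using j i Nq[OF j] q0 by (simp add: coord_basis basis_in_W)
    next
      case False
      then have j': "j - 1 \<in> {1..K}" using j by auto
      have "N (q j) = q (j - 1)" by (rule Nq[OF j])
      moreover have "(i = j - 1) = (Suc i = j)" using j False by auto
      ultimately show ?thesis using coord_basis(3,4)[OF j] coord_basis(3,4)[OF j'] basis_in_W(2)[of j] j by simp
    qed
    ultimately show ?thesis unfolding basis_def by blast
  qed
  ultimately have "vec.span basis \<subseteq> ?S" by (intro vec.span_minimal)
  then show "p_coord i (N v) = p_coord (Suc i) v" "q_coord i (N v) = q_coord (Suc i) v"
    using v unfolding W_def by blast+
qed

lemma Npow_linear: "Vector_Spaces.linear (*s) (*s) (N ^^ d)"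
proof (induction d)
  case 0
  show ?case by (simp add: Vector_Spaces.linear_iff vec.vector_space_axioms id_def)
next
  case (Suc d)
  show ?case
    using Vector_Spaces.linear_compose[OF Suc linN] by (simp add: comp_def)
qed

lemma Npow_W: "v \<in> W \<Longrightarrow> (N ^^ d) v \<in> W"
  by (induction d) (simp_all add: N_W)

lemma coord_Npow:
  assumes v: "v \<in> W" and i: "1 \<le> i"
  shows "p_coord i ((N ^^ d) v) = p_coord (i + d) v" "q_coord i ((N ^^ d) v) = q_coord (i + d) v"
  using i by (induction d arbitrary: i) (simp_all add: coord_N Npow_W v)

text \<open>This is the span of \<open>p\<^sub>1, \<dots>, p\<^sub>a, q\<^sub>1, \<dots>, q\<^sub>b\<close> if \<open>a \<le> A\<close> and \<open>b \<le> K\<close>. The definition by coordinates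
  makes preimages under powers of \<open>N\<close> computable without case distinctions.\<close>
definition U :: "nat \<Rightarrow> nat \<Rightarrow> (complex ^ 'm) set" where
  "U a b = {v \<in> W. (\<forall>i>a. p_coord i v = 0) \<and> (\<forall>i>b. q_coord i v = 0)}"

lemma U_subset_W: "U a b \<subseteq> W"
  by (auto simp: U_def)

lemma subspace_U: "vec.subspace (U a b)"
  by (simp add: vec.subspace_def U_def coord_add coord_scale W_closed)

lemma U_mono: "a \<le> a' \<Longrightarrow> b \<le> b' \<Longrightarrow> U a b \<subseteq> U a' b'"
  by (simp add: U_def subset_iff)

lemma U_Int: "U a b \<inter> U a' b' = U (min a a') (min b b')"
proof (intro equalityI subsetI)
  fix v assume v: "v \<in> U a b \<inter> U a' b'"
  show "v \<in> U (min a a') (min b b')"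
    using v by (auto simp: U_def min_def split: if_splits)
qed (auto simp: U_def)

lemma p_in_U: "i \<le> a \<Longrightarrow> i \<le> A \<Longrightarrow> p i \<in> U a b"
  using coord_basis(1,2)[of i] p0 basis_in_W(1)[of i] by (cases "i = 0") (simp_all add: U_def W_closed)

lemma q_in_U: "i \<le> b \<Longrightarrow> i \<le> K \<Longrightarrow> q i \<in> U a b"
  using coord_basis(3,4)[of i] q0 basis_in_W(2)[of i] by (cases "i = 0") (simp_all add: U_def W_closed)

lemma U_eq_span:
  assumes "a \<le> A" "b \<le> K"
  shows "U a b = vec.span (p ` {1..a} \<union> q ` {1..b})"
proof
  let ?S = "vec.span (p ` {1..a} \<union> q ` {1..b})"
  show "?S \<subseteq> U a b"
    by (rule vec.span_minimal[OF _ subspace_U]) (use assms p_in_U q_in_U in auto)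
  show "U a b \<subseteq> ?S"
  proof
    fix v assume v: "v \<in> U a b"
    then have vW: "v \<in> W" using U_subset_W by blast
    have "(\<Sum>x\<in>basis. vec.representation basis v x *s x) = v"
      by (rule vec.sum_representation_eq[OF ind_basis vW[unfolded W_def]]) (auto simp: basis_def)
    moreover have "(\<Sum>x\<in>basis. vec.representation basis v x *s x) \<in> ?S"
    proof (rule vec.span_sum)
      fix x assume x: "x \<in> basis"
      show "vec.representation basis v x *s x \<in> ?S"
      proof (cases "x \<in> p ` {1..a} \<union> q ` {1..b}")
        case True then show ?thesis by (intro vec.span_scale vec.span_base)
      next
        case False
        from x[unfolded basis_def] have "vec.representation basis v x = 0"
        proof
          assume "x \<in> p ` {1..A}"
          then obtain i where i: "i \<in> {1..A}" "x = p i" by auto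
          then have "a < i" using False by (cases "i \<le> a") auto
          then have "p_coord i v = 0" using v by (simp add: U_def)
          then show ?thesis using i by (simp add: p_coord_def)
        next
          assume "x \<in> q ` {1..K}"
          then obtain i where i: "i \<in> {1..K}" "x = q i" by auto
          then have "b < i" using False by (cases "i \<le> b") auto
          then have "q_coord i v = 0" using v by (simp add: U_def)
          then show ?thesis using i by (simp add: q_coord_def)
        qed
        then show ?thesis by (simp add: vec.span_zero)
      qed
    qed
    ultimately show "v \<in> ?S" by simp
  qed
qed

lemma W_eq_U: "W = U A K"
  using U_eq_span[of A K] by (simp add: W_def basis_def)

lemma dim_U:
  assumes "a \<le> A" "b \<le> K"
  shows "vec.dim (U a b) = a + b"
proof -
  have sub: "p ` {1..a} \<subseteq> p ` {1..A}" "q ` {1..b} \<subseteq> q ` {1..K}" using assms by auto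
  have "vec.independent (p ` {1..a} \<union> q ` {1..b})"
    using vec.dependent_mono[of "p ` {1..a} \<union> q ` {1..b}" "p ` {1..A} \<union> q ` {1..K}"] ind sub by blast
  then have "vec.dim (U a b) = card (p ` {1..a} \<union> q ` {1..b})"
    unfolding U_eq_span[OF assms] by (rule vec.dim_span_eq_card_independent)
  also have "\<dots> = card (p ` {1..a}) + card (q ` {1..b})"
    by (rule card_Un_disjoint) (use inj_basis(3) sub in blast)+
  also have "card (p ` {1..a}) = a"
    using card_image[OF inj_on_subset[OF inj_basis(1)], of "{1..a}"] assms by simp
  also have "card (q ` {1..b}) = b"
    using card_image[OF inj_on_subset[OF inj_basis(2)], of "{1..b}"] assms by simp
  finally show ?thesis .
qed

lemma U_0_0: "U 0 0 = {0}"
  using U_eq_span[of 0 0] by simp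

lemma U_min: "U a b = U (min a A) (min b K)"
proof (intro equalityI subsetI)
  fix v assume v: "v \<in> U a b"
  have "p_coord i v = 0" if "min a A < i" for i
    using that v coord_outside(2)[of i v] by (cases "A < i") (simp_all add: U_def)
  moreover have "q_coord i v = 0" if "min b K < i" for i
    using that v coord_outside(4)[of i v] by (cases "K < i") (simp_all add: U_def)
  ultimately show "v \<in> U (min a A) (min b K)" using v by (simp add: U_def)
next
  fix v assume "v \<in> U (min a A) (min b K)"
  then show "v \<in> U a b" by (simp add: U_def)
qed

lemma U_preimage: "{v \<in> U a' b'. (N ^^ d) v \<in> U a b} = U (min a' (a + d)) (min b' (b + d))"
proof (intro equalityI subsetI)
  fix v assume v: "v \<in> {v \<in> U a' b'. (N ^^ d) v \<in> U a b}"
  then have vW: "v \<in> W" by (simp add: U_def)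
  have "p_coord i v = 0 \<and> q_coord i' v = 0" if i: "a + d < i" "b + d < i'" for i i'
  proof -
    have "p_coord (i - d) ((N ^^ d) v) = 0" "q_coord (i' - d) ((N ^^ d) v) = 0"
      using v i by (simp_all add: U_def)
    then show ?thesis using coord_Npow(1)[OF vW, of "i - d" d] coord_Npow(2)[OF vW, of "i' - d" d] i by simp
  qed
  then have "v \<in> U (a + d) (b + d)" using vW by (auto simp: U_def)
  then show "v \<in> U (min a' (a + d)) (min b' (b + d))" using v U_Int by blast
next
  fix v assume v: "v \<in> U (min a' (a + d)) (min b' (b + d))"
  then have v': "v \<in> U a' b'" "v \<in> U (a + d) (b + d)" using U_Int by blast+
  then have vW: "v \<in> W" by (simp add: U_def)
  have "(N ^^ d) v \<in> U a b"
    unfolding U_def using v'(2) by (simp add: Npow_W[OF vW] coord_Npow[OF vW] U_def)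
  then show "v \<in> {v \<in> U a' b'. (N ^^ d) v \<in> U a b}" using v'(1) by simp
qed

lemma U_preimage1: "{v \<in> U a' b'. N v \<in> U a b} = U (min a' (Suc a)) (min b' (Suc b))"
  using U_preimage[of a' b' 1 a b] by simp

lemma N_kernel: "{v \<in> U a b. N v = 0} = U (min a 1) (min b 1)"
  using U_preimage1[of a b 0 0] by (simp add: U_0_0)

text \<open>A linear, hence continuous, right inverse of \<open>N\<close>, along which approximations are lifted from
  the image of \<open>N\<close>.\<close>
lemma right_inverse_exists:
  "\<exists>M. Vector_Spaces.linear (*s) (*s) M \<and> (\<forall>i\<in>{1..<A}. M (p i) = p (Suc i)) \<and> (\<forall>i\<in>{1..<K}. M (q i) = q (Suc i))"
proof -
  define f where "f x = (if x \<in> p ` {1..A} then p (Suc (inv_into {1..A} p x)) else q (Suc (inv_into {1..K} q x)))" for x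
  obtain M where M: "\<And>x. x \<in> basis \<Longrightarrow> M x = f x" "Vector_Spaces.linear (*s) (*s) M"
    using vec.linear_independent_extend[OF ind_basis, of f] by blast
  have "M (p i) = p (Suc i)" if "i \<in> {1..<A}" for i
    using M(1)[OF p_in_basis, of i] that inv_into_f_f[OF inj_basis(1), of i] by (simp add: f_def)
  moreover have "M (q i) = q (Suc i)" if "i \<in> {1..<K}" for i
  proof -
    have "q i \<notin> p ` {1..A}" using p_neq_q[of _ i] that by fastforce
    then show ?thesis using M(1)[OF q_in_basis, of i] that inv_into_f_f[OF inj_basis(2), of i] by (simp add: f_def)
  qed
  ultimately show ?thesis using M(2) by blast
qed

definition up :: "complex ^ 'm \<Rightarrow> complex ^ 'm" where
  "up = (SOME M. Vector_Spaces.linear (*s) (*s) M \<and> (\<forall>i\<in>{1..<A}. M (p i) = p (Suc i)) \<and> (\<forall>i\<in>{1..<K}. M (q i) = q (Suc i)))"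

lemma lin_up: "Vector_Spaces.linear (*s) (*s) up"
  and up_p: "i \<in> {1..<A} \<Longrightarrow> up (p i) = p (Suc i)"
  and up_q: "i \<in> {1..<K} \<Longrightarrow> up (q i) = q (Suc i)"
  using someI_ex[OF right_inverse_exists] unfolding up_def by blast+

sublocale up: Vector_Spaces.linear "(*s)" "(*s)" up by (rule lin_up)

lemma up:
  assumes ab: "a < A" "b < K" and v: "v \<in> U a b"
  shows "N (up v) = v" "up v \<in> U (Suc a) (Suc b)"
proof -
  let ?S = "{v. N (up v) = v \<and> up v \<in> W}"
  have S: "vec.subspace ?S"
    by (simp add: vec.subspace_def up.add up.scale N.add N.scale W_closed)
  have "U a b \<subseteq> ?S"
    unfolding U_eq_span[OF less_imp_le[OF ab(1)] less_imp_le[OF ab(2)]]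
  proof (rule vec.span_minimal[OF _ S])
    have "p i \<in> ?S" if "i \<in> {1..a}" for i
      using up_p[of i] Np[of "Suc i"] basis_in_W(1)[of "Suc i"] that ab by simp
    moreover have "q i \<in> ?S" if "i \<in> {1..b}" for i
      using up_q[of i] Nq[of "Suc i"] basis_in_W(2)[of "Suc i"] that ab by simp
    ultimately show "p ` {1..a} \<union> q ` {1..b} \<subseteq> ?S" by blast
  qed
  then have *: "N (up v) = v" "up v \<in> W" using v by auto
  then have "up v \<in> {v \<in> U A K. N v \<in> U a b}" using v W_eq_U by simp
  then show "N (up v) = v" "up v \<in> U (Suc a) (Suc b)" using * ab U_preimage1[of A K a b] by simp_all
qed

lemma up_p_part:
  assumes "a < A" "0 < K" and v: "v \<in> U a 0"
  shows "up v \<in> U (Suc a) 0"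
proof -
  have "vec.subspace {v. up v \<in> U (Suc a) 0}"
    using subspace_U[of "Suc a" 0] by (simp add: vec.subspace_def up.add up.scale)
  moreover have "p ` {1..a} \<subseteq> {v. up v \<in> U (Suc a) 0}"
    using assms(1) by (auto simp: up_p p_in_U)
  ultimately have "vec.span (p ` {1..a}) \<subseteq> {v. up v \<in> U (Suc a) 0}"
    by (intro vec.span_minimal)
  then show ?thesis using v U_eq_span[of a 0] assms(1) by auto
qed

lemma N_image_U_Suc:
  assumes "a < A" "b < K"
  shows "N ` U (Suc a) (Suc b) = U a b"
proof
  show "N ` U (Suc a) (Suc b) \<subseteq> U a b"
    using U_preimage1[of "Suc a" "Suc b" a b] by auto
  show "U a b \<subseteq> N ` U (Suc a) (Suc b)" using up[OF assms] by (metis image_eqI subsetI)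
qed

lemma subspace_preimage:
  assumes "vec.subspace S" "vec.subspace T"
  shows "vec.subspace {v \<in> T. N v \<in> S}"
  using assms by (simp add: vec.subspace_def N.add N.scale)

lemma dim_preimage:
  assumes ab: "a < A" "b < K" and S: "vec.subspace S"
  shows "N ` {v \<in> U (Suc a) (Suc b). N v \<in> S} = S \<inter> U a b"
    and "vec.dim {v \<in> U (Suc a) (Suc b). N v \<in> S} = vec.dim (S \<inter> U a b) + 2"
proof -
  let ?T = "{v \<in> U (Suc a) (Suc b). N v \<in> S}"
  show im: "N ` ?T = S \<inter> U a b"
    using N_image_U_Suc[OF ab] by auto
  have "{x \<in> ?T. N x = 0} = {x \<in> U (Suc a) (Suc b). N x = 0}"
    using S vec.subspace_0 by auto
  also have "\<dots> = U 1 1" by (simp add: N_kernel)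
  finally show "vec.dim ?T = vec.dim (S \<inter> U a b) + 2"
    using vec_rank_nullity[OF linN subspace_preimage[OF S subspace_U]] im ab by (simp add: dim_U)
qed

lemma dim_N_image:
  assumes S: "vec.subspace S" "S \<subseteq> W"
  shows "vec.dim S \<le> vec.dim (N ` S) + 2"
proof -
  have "{x \<in> S. N x = 0} \<subseteq> U 1 1"
    using S(2) W_eq_U N_kernel[of A K] U_mono[of "min A 1" 1 "min K 1" 1] by auto
  then have "vec.dim {x \<in> S. N x = 0} \<le> vec.dim (U 1 1)" by (rule vec.dim_subset)
  also have "\<dots> = vec.dim (U (min 1 A) (min 1 K))" using U_min by metis
  also have "\<dots> \<le> 2" by (simp add: dim_U)
  finally show ?thesis using vec_rank_nullity[OF linN S(1)] by simp
qed

lemma dim_Npow_image: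
  assumes S: "vec.subspace S" "S \<subseteq> W"
  shows "vec.dim S \<le> vec.dim ((N ^^ d) ` S) + 2 * d"
proof (induction d)
  case (Suc d)
  interpret Nd: Vector_Spaces.linear "(*s)" "(*s)" "N ^^ d" by (rule Npow_linear)
  have "vec.subspace ((N ^^ d) ` S)" using S(1) by (rule Nd.subspace_image)
  moreover have "(N ^^ d) ` S \<subseteq> W" using S(2) Npow_W by blast
  ultimately have "vec.dim ((N ^^ d) ` S) \<le> vec.dim (N ` (N ^^ d) ` S) + 2" by (rule dim_N_image)
  then show ?case using Suc by (simp add: image_image image_comp)
qed simp

lemma U_Suc_subset_span_insert:
  assumes "a < A"
  shows "U (Suc a) b \<subseteq> vec.span (insert (p (Suc a)) (U a b))"
proof
  fix v assume v: "v \<in> U (Suc a) b"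
  let ?u = "v - p_coord (Suc a) v *s p (Suc a)"
  have W: "v \<in> W" "p (Suc a) \<in> W" using v assms basis_in_W(1)[of "Suc a"] by (simp_all add: U_def)
  have sW: "p_coord (Suc a) v *s p (Suc a) \<in> W" by (rule W_closed(4)[OF W(2)])
  have cb: "p_coord i (p (Suc a)) = (if i = Suc a then 1 else 0)" "q_coord i (p (Suc a)) = 0" for i
    using coord_basis(1,2)[of "Suc a" i] assms by simp_all
  have "p_coord i ?u = 0" if "a < i" for i
    using v that by (cases "i = Suc a") (simp_all add: coord_diff[OF W(1) sW] coord_scale[OF W(2)] cb U_def)
  moreover have "q_coord i ?u = 0" if "b < i" for i
    using v that by (simp add: coord_diff[OF W(1) sW] coord_scale[OF W(2)] cb U_def)
  moreover have "?u \<in> W" using W(1) sW by (rule W_closed(3))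
  ultimately have "?u \<in> U a b" by (simp add: U_def)
  then show "v \<in> vec.span (insert (p (Suc a)) (U a b))"
    using vec.span_breakdown_eq[of v "p (Suc a)" "U a b"] vec.span_base by blast
qed

end

section \<open>Counting entries\<close>

definition bot_upto :: "nat set \<Rightarrow> nat \<Rightarrow> nat" where
  "bot_upto B j = card {x \<in> B. x \<le> j}"

definition top_upto :: "nat \<Rightarrow> nat set \<Rightarrow> nat \<Rightarrow> nat" where
  "top_upto n B j = card {x \<in> {1..n} - B. x \<le> j}"

lemma top_upto_plus_bot_upto:
  assumes "B \<subseteq> {1..n}"
  shows "top_upto n B j + bot_upto B j = min j n"
proof -
  have fin: "finite B" using assms finite_subset by blast
  have "{x \<in> {1..n} - B. x \<le> j} \<union> {x \<in> B. x \<le> j} = {1..min j n}" using assms by auto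
  moreover have "card ({x \<in> {1..n} - B. x \<le> j} \<union> {x \<in> B. x \<le> j}) = top_upto n B j + bot_upto B j"
    unfolding top_upto_def bot_upto_def by (rule card_Un_disjoint) (use fin in auto)
  ultimately show ?thesis by simp
qed

lemma bot_upto_le: "finite B \<Longrightarrow> bot_upto B j \<le> card B"
  unfolding bot_upto_def by (rule card_mono) auto

lemma top_upto_le: "B \<subseteq> {1..n} \<Longrightarrow> top_upto n B j \<le> n - card B"
proof -
  assume B: "B \<subseteq> {1..n}"
  have "top_upto n B j \<le> card ({1..n} - B)" unfolding top_upto_def by (rule card_mono) auto
  also have "\<dots> = n - card B" using card_Diff_subset[OF finite_subset[OF B] B] by simp
  finally show ?thesis .
qed

lemma bot_upto_insert:
  assumes "finite B" "1 \<le> i"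
  shows "j < i \<Longrightarrow> bot_upto (insert i (skip i ` B)) j = bot_upto B j"
    and "bot_upto (insert i (skip i ` B)) i = Suc (bot_upto B (i - 1))"
    and "i \<le> Suc j \<Longrightarrow> bot_upto (insert i (skip i ` B)) (j + 2) = Suc (bot_upto B j)"
proof -
  have c: "card (insert i (skip i ` T)) = Suc (card T)" "card (skip i ` T) = card T" if "finite T" for T
    using that by (simp_all add: image_iff card_image inj_skip[THEN inj_on_subset])
  show "bot_upto (insert i (skip i ` B)) j = bot_upto B j" if j: "j < i"
  proof -
    have "{x \<in> insert i (skip i ` B). x \<le> j} = skip i ` {x \<in> B. x \<le> j}"
      using j by (auto simp: skip_def)
    then show ?thesis using c(2)[of "{x \<in> B. x \<le> j}"] assms(1) by (simp add: bot_upto_def)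
  qed
  have "{x \<in> insert i (skip i ` B). x \<le> i} = insert i (skip i ` {x \<in> B. x \<le> i - 1})"
    using assms(2) by (auto simp: skip_def split: if_splits)
  then show "bot_upto (insert i (skip i ` B)) i = Suc (bot_upto B (i - 1))"
    using c(1)[of "{x \<in> B. x \<le> i - 1}"] assms(1) by (simp add: bot_upto_def)
  show "bot_upto (insert i (skip i ` B)) (j + 2) = Suc (bot_upto B j)" if j: "i \<le> Suc j"
  proof -
    have "{x \<in> insert i (skip i ` B). x \<le> j + 2} = insert i (skip i ` {x \<in> B. x \<le> j})"
      using j by (auto simp: skip_def)
    then show ?thesis using c(1)[of "{x \<in> B. x \<le> j}"] assms(1) by (simp add: bot_upto_def)
  qed
qed

lemma top_upto_insert:
  assumes B: "B \<subseteq> {1..n}" and i: "i \<in> {1..n + 1}"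
  shows "j < i \<Longrightarrow> top_upto (n + 2) (insert i (skip i ` B)) j = top_upto n B j"
    and "top_upto (n + 2) (insert i (skip i ` B)) i = top_upto n B (i - 1)"
    and "i \<le> Suc j \<Longrightarrow> top_upto (n + 2) (insert i (skip i ` B)) (j + 2) = Suc (top_upto n B j)"
proof -
  have fin: "finite B" using B finite_subset by blast
  have "insert i (skip i ` B) \<subseteq> {1..n + 2}" using B i skip_range[OF i] by (auto simp: subset_iff)
  note 1 = top_upto_plus_bot_upto[OF this] and 2 = top_upto_plus_bot_upto[OF B]
  have i1: "1 \<le> i" using i by simp
  show "top_upto (n + 2) (insert i (skip i ` B)) j = top_upto n B j" if "j < i"
    using 1[of j] 2[of j] bot_upto_insert(1)[OF fin i1 that] that i by simp
  show "top_upto (n + 2) (insert i (skip i ` B)) i = top_upto n B (i - 1)"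
    using 1[of i] 2[of "i - 1"] bot_upto_insert(2)[OF fin i1] i by simp
  show "top_upto (n + 2) (insert i (skip i ` B)) (j + 2) = Suc (top_upto n B j)" if "i \<le> Suc j"
    using 1[of "j + 2"] 2[of j] bot_upto_insert(3)[OF fin i1 that] by simp
qed

section \<open>Removing an innermost cup\<close>

context two_jordan_blocks
begin

definition Y :: "nat \<Rightarrow> nat \<Rightarrow> 'm flag set" where
  "Y a b = springer_fiber (a + b) (U a b) N"

lemma N_U: "v \<in> U a b \<Longrightarrow> N v \<in> U (a - 1) (b - 1)"
proof -
  assume v: "v \<in> U a b"
  have "v \<in> U (min a (Suc (a - 1))) (min b (Suc (b - 1)))" using v by simp
  then show ?thesis using U_preimage1[of a b "a - 1" "b - 1"] by blast
qed

lemma N_U_stable: "v \<in> U a b \<Longrightarrow> N v \<in> U a b"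
  using N_U[of v a b] U_mono[of "a - 1" a "b - 1" b] by auto

lemma Npow_U: "v \<in> U a b \<Longrightarrow> (N ^^ d) v \<in> U a b"
  by (induction d) (simp_all add: N_U_stable)

lemma flags_U_top:
  assumes F: "F \<in> flags (a + b) (U a b)" and ab: "a \<le> A" "b \<le> K" and j: "a + b \<le> j"
  shows "F j = U a b"
  by (rule vec_subspace_eqI[OF flagsD(1)[OF F] subspace_U flagsD(2)[OF F]])
    (use flagsD(3)[OF F, of j] dim_U[OF ab] j in simp)

lemma Y_iff:
  assumes ab: "a \<le> A" "b \<le> K"
  shows "F \<in> Y a b \<longleftrightarrow> F \<in> flags (a + b) (U a b) \<and> (\<forall>j. N ` F (Suc j) \<subseteq> F j)"
proof
  assume F: "F \<in> Y a b"
  then have Ff: "F \<in> flags (a + b) (U a b)" by (simp add: Y_def springer_fiber_def)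
  have "N ` F (Suc j) \<subseteq> F j" for j
  proof (cases "Suc j \<le> a + b")
    case True
    have "\<forall>i\<in>{1..a + b}. N ` F i \<subseteq> F (i - 1)" using F by (simp add: Y_def springer_fiber_def)
    from bspec[OF this, of "Suc j"] True show ?thesis by simp
  next
    case False
    then have "F (Suc j) = U a b" "F j = U a b" using flags_U_top[OF Ff ab] by simp_all
    then show ?thesis using N_U_stable by auto
  qed
  then show "F \<in> flags (a + b) (U a b) \<and> (\<forall>j. N ` F (Suc j) \<subseteq> F j)" using Ff by blast
next
  assume F: "F \<in> flags (a + b) (U a b) \<and> (\<forall>j. N ` F (Suc j) \<subseteq> F j)"
  have "N ` F i \<subseteq> F (i - 1)" if "i \<in> {1..a + b}" for i
    using conjunct2[OF F, rule_format, of "i - 1"] that by simp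
  then show "F \<in> Y a b" using F by (simp add: Y_def springer_fiber_def)
qed

lemma Y_D:
  assumes F: "F \<in> Y a b" and ab: "a \<le> A" "b \<le> K"
  shows "vec.subspace (F j)" "F j \<subseteq> U a b" "vec.dim (F j) = min j (a + b)"
    "i \<le> j \<Longrightarrow> F i \<subseteq> F j" "N ` F (Suc j) \<subseteq> F j" "a + b \<le> j \<Longrightarrow> F j = U a b" "F 0 = {0}"
proof -
  have f: "F \<in> flags (a + b) (U a b)" and N: "N ` F (Suc j) \<subseteq> F j"
    using F Y_iff[OF ab] by blast+
  show "vec.subspace (F j)" "F j \<subseteq> U a b" "vec.dim (F j) = min j (a + b)" using flagsD[OF f] by blast+
  show "i \<le> j \<Longrightarrow> F i \<subseteq> F j" by (rule flags_mono[OF f])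
  show "N ` F (Suc j) \<subseteq> F j" by (rule N)
  show "a + b \<le> j \<Longrightarrow> F j = U a b" by (rule flags_U_top[OF f ab])
  have "vec.dim (F 0) = 0" using flagsD(3)[OF f, of 0] by simp
  then have "F 0 \<subseteq> {0}" by (simp add: vec.dim_eq_0)
  then show "F 0 = {0}" using vec.subspace_0[OF flagsD(1)[OF f, of 0]] by blast
qed

lemma Y_N_stable: "F \<in> Y a b \<Longrightarrow> a \<le> A \<Longrightarrow> b \<le> K \<Longrightarrow> N ` F j \<subseteq> F j"
proof (cases j)
  case 0
  assume "F \<in> Y a b" "a \<le> A" "b \<le> K"
  then show ?thesis using Y_D(7)[of F a b] 0 by simp
next
  case (Suc i)
  assume "F \<in> Y a b" "a \<le> A" "b \<le> K"
  then show ?thesis using Y_D(5)[of F a b i] Y_D(4)[of F a b i j] Suc by simp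
qed

lemma Y_Npow: "F \<in> Y a b \<Longrightarrow> a \<le> A \<Longrightarrow> b \<le> K \<Longrightarrow> (N ^^ d) ` F (j + d) \<subseteq> F j"
proof (induction d)
  case (Suc d)
  have "(N ^^ Suc d) ` F (j + Suc d) = (N ^^ d) ` (N ` F (Suc (j + d)))"
    by (simp add: image_image funpow_swap1)
  also have "\<dots> \<subseteq> (N ^^ d) ` F (j + d)" using Y_D(5)[OF Suc.prems] by (rule image_mono)
  finally show ?case using Suc by blast
qed simp

definition collapse :: "nat \<Rightarrow> 'm flag \<Rightarrow> 'm flag" where
  "collapse i F j = (if j < i then F j else N ` F (j + 2))"

text \<open>If \<open>N\<close> maps \<open>F (i + 1)\<close> into \<open>F (i - 1)\<close>, then \<open>F (i + 1)\<close> is the full preimage of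
  \<open>F (i - 1)\<close> by dimension, so that all later spaces contain the kernel of \<open>N\<close> and can be
  recovered from their images.\<close>
lemma collapse_flag:
  assumes ab: "a < A" "b < K" and i: "i \<in> {1..a + b + 1}"
    and F: "F \<in> Y (Suc a) (Suc b)" and cup: "N ` F (i + 1) \<subseteq> F (i - 1)"
  shows "collapse i F \<in> Y a b"
    and "i \<le> Suc j \<Longrightarrow> collapse i F j = N ` F (j + 2)"
    and "i \<le> Suc j \<Longrightarrow> F (j + 2) = {v \<in> U (Suc a) (Suc b). N v \<in> collapse i F j}"
proof -
  have ab': "Suc a \<le> A" "Suc b \<le> K" and ab'': "a \<le> A" "b \<le> K" and i1: "1 \<le> i" using ab i by simp_all
  note FD = Y_D[OF F ab']
  let ?S = "{v \<in> U (Suc a) (Suc b). N v \<in> F (i - 1)}"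
  have dimF: "vec.dim (F j) = min j (a + b + 2)" for j using FD(3)[of j] by simp
  have sub: "F (i + 1) \<subseteq> ?S" using FD(2)[of "i + 1"] cup by blast
  have "vec.dim (F (i + 1)) = i + 1" "vec.dim (F (i - 1)) = i - 1" using dimF i by (auto simp: min_def)
  moreover have "vec.dim (F (i + 1)) \<le> vec.dim ?S" by (rule vec.dim_subset[OF sub])
  moreover have "vec.dim ?S = vec.dim (F (i - 1) \<inter> U a b) + 2" by (rule dim_preimage(2)[OF ab FD(1)])
  ultimately have d: "vec.dim (F (i - 1)) \<le> vec.dim (F (i - 1) \<inter> U a b)"
    and d2: "vec.dim (F (i - 1) \<inter> U a b) \<le> vec.dim (F (i - 1)) \<Longrightarrow> vec.dim ?S \<le> vec.dim (F (i + 1))"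
    using i1 by linarith+
  have "F (i - 1) \<inter> U a b = F (i - 1)"
    by (rule vec_subspace_eqI[OF vec.subspace_inter[OF FD(1) subspace_U] FD(1) Int_lower1 d])
  then have inU: "F (i - 1) \<subseteq> U a b" by blast
  have "vec.dim (F (i - 1) \<inter> U a b) \<le> vec.dim (F (i - 1))" by (rule vec.dim_subset) simp
  then have FS: "F (i + 1) = ?S"
    by (intro vec_subspace_eqI[OF FD(1) subspace_preimage[OF FD(1) subspace_U] sub d2])
  have NF: "N ` F (i + 1) = F (i - 1)"
    using dim_preimage(1)[OF ab FD(1), of "i - 1"] inU unfolding FS by blast
  \<comment> \<open>From position \<open>i + 1\<close> on the flag contains the kernel of \<open>N\<close> and is determined by its image.\<close>
  have ker: "{v \<in> U (Suc a) (Suc b). N v = 0} \<subseteq> F (j + 2)" if "i \<le> Suc j" for j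
  proof -
    have "{v \<in> U (Suc a) (Suc b). N v = 0} \<subseteq> F (i + 1)"
      unfolding FS using vec.subspace_0[OF FD(1)] by auto
    also have "\<dots> \<subseteq> F (j + 2)" using that by (intro FD(4)) simp
    finally show ?thesis .
  qed
  show col: "collapse i F j = N ` F (j + 2)" if "i \<le> Suc j" for j
  proof (cases "j < i")
    case True
    then have "j = i - 1" "j + 2 = i + 1" using that by simp_all
    then show ?thesis using NF True by (simp add: collapse_def)
  qed (simp add: collapse_def)
  show "F (j + 2) = {v \<in> U (Suc a) (Suc b). N v \<in> collapse i F j}" if j: "i \<le> Suc j" for j
  proof
    show "F (j + 2) \<subseteq> {v \<in> U (Suc a) (Suc b). N v \<in> collapse i F j}"
      unfolding col[OF j] using FD(2) by blast
    show "{v \<in> U (Suc a) (Suc b). N v \<in> collapse i F j} \<subseteq> F (j + 2)"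
    proof
      fix v assume v: "v \<in> {v \<in> U (Suc a) (Suc b). N v \<in> collapse i F j}"
      then obtain u where u: "u \<in> F (j + 2)" "N v = N u" unfolding col[OF j] by auto
      then have "v - u \<in> {v \<in> U (Suc a) (Suc b). N v = 0}"
        using v FD(2)[of "j + 2"] vec.subspace_diff[OF subspace_U] by (auto simp: N.diff)
      then have "v - u \<in> F (j + 2)" using ker[OF j] by blast
      then have "(v - u) + u \<in> F (j + 2)" using u(1) by (rule vec.subspace_add[OF FD(1)])
      then show "v \<in> F (j + 2)" by simp
    qed
  qed
  have lower: "F j \<subseteq> U a b" if "j < i" for j
  proof -
    have "j \<le> i - 1" using that by linarith
    from FD(4)[OF this] show ?thesis using inU by blast
  qed
  have NW: "N ` F j \<subseteq> U a b" for j using FD(2)[of j] N_U[of _ "Suc a" "Suc b"] by auto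
  have "collapse i F \<in> flags (a + b) (U a b)"
    unfolding flags_def mem_Collect_eq
  proof (intro conjI allI)
    fix j
    show "vec.subspace (collapse i F j)" using FD(1) N.subspace_image by (simp add: collapse_def)
    show "collapse i F j \<subseteq> U a b" using lower NW by (simp add: collapse_def)
    show "vec.dim (collapse i F j) = min j (a + b)"
    proof (cases "j < i")
      case True then show ?thesis using dimF[of j] i by (simp add: collapse_def)
    next
      case False
      have "{x \<in> F (j + 2). N x = 0} = {v \<in> U (Suc a) (Suc b). N v = 0}"
        using ker[of j] False FD(2)[of "j + 2"] by auto
      also have "\<dots> = U 1 1" by (simp add: N_kernel)
      finally have "vec.dim (F (j + 2)) = vec.dim (N ` F (j + 2)) + 2"
        using vec_rank_nullity[OF linN FD(1), of "j + 2"] ab by (simp add: dim_U)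
      then show ?thesis using dimF[of "j + 2"] False by (simp add: collapse_def)
    qed
    show "collapse i F j \<subseteq> collapse i F (Suc j)"
    proof (cases "Suc j < i")
      case True then show ?thesis using FD(4)[of j "Suc j"] by (simp add: collapse_def)
    next
      case False
      then show ?thesis using col[of j] col[of "Suc j"] FD(4)[of "j + 2" "Suc j + 2"] by (simp add: image_mono)
    qed
  qed
  moreover have "N ` collapse i F (Suc j) \<subseteq> collapse i F j" for j
  proof (cases "Suc j < i")
    case True then show ?thesis using FD(5)[of j] by (simp add: collapse_def)
  next
    case False
    then have "collapse i F (Suc j) = N ` F (Suc (j + 2))" "collapse i F j = N ` F (j + 2)"
      using col[of "Suc j"] col[of j] by simp_all
    then show ?thesis using FD(5)[of "j + 2"] by (simp only: image_mono)
  qed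
  ultimately show "collapse i F \<in> Y a b" using Y_iff[OF ab''] by blast
qed

text \<open>The inverse of \<open>collapse\<close>. The space \<open>L\<close> in position \<open>i\<close> varies in a projective line.\<close>
definition expand :: "nat \<Rightarrow> nat \<Rightarrow> nat \<Rightarrow> 'm flag \<Rightarrow> (complex ^ 'm) set \<Rightarrow> 'm flag" where
  "expand a b i G L j = (if j < i then G j else if j = i then L
     else {v \<in> U (Suc a) (Suc b). N v \<in> G (j - 2)})"

lemma index_cases:
  fixes i j :: nat
  assumes "1 \<le> i"
  obtains "j < i" | "j = i" | l where "j = l + 2" "i \<le> Suc l"
proof -
  consider "j < i" | "j = i" | "i < j" by linarith
  then show ?thesis using that(1,2) that(3)[of "j - 2"] assms by cases auto
qed

lemma expand_flag:
  assumes ab: "a < A" "b < K" and i: "i \<in> {1..a + b + 1}" and G: "G \<in> Y a b"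
    and L: "vec.subspace L" "vec.dim L = i" "G (i - 1) \<subseteq> L" "L \<subseteq> {v \<in> U (Suc a) (Suc b). N v \<in> G (i - 1)}"
  shows "expand a b i G L \<in> Y (Suc a) (Suc b)"
    and "N ` expand a b i G L (i + 1) \<subseteq> expand a b i G L (i - 1)"
    and "collapse i (expand a b i G L) = G"
proof -
  have ab': "Suc a \<le> A" "Suc b \<le> K" and ab'': "a \<le> A" "b \<le> K" using ab by simp_all
  note GD = Y_D[OF G ab'']
  let ?E = "expand a b i G L"
  let ?V = "U (Suc a) (Suc b)"
  have GV: "G j \<subseteq> ?V" for j using GD(2)[of j] U_mono[of a "Suc a" b "Suc b"] by simp
  have E3: "?E (l + 2) = {v \<in> ?V. N v \<in> G l}" if "i \<le> Suc l" for l using that by (simp add: expand_def)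
  have i1: "1 \<le> i" using i by simp
  have E1: "?E (i + 1) = {v \<in> ?V. N v \<in> G (i - 1)}" using E3[of "i - 1"] i by (simp add: expand_def)
  have sub: "?E j \<subseteq> ?E (Suc j)" for j
  proof (rule index_cases[OF i1, of j])
    assume j: "j < i"
    show ?thesis
    proof (cases "Suc j = i")
      case True then show ?thesis using L(3) j by (auto simp: expand_def)
    next
      case False then show ?thesis using j GD(4)[of j "Suc j"] by (simp add: expand_def)
    qed
  next
    assume "j = i" then show ?thesis using L(4) E1 by (simp add: expand_def)
  next
    fix l assume l: "j = l + 2" "i \<le> Suc l"
    then show ?thesis using E3[of l] E3[of "Suc l"] GD(4)[of l "Suc l"] by auto
  qed
  have nil: "N ` ?E (Suc j) \<subseteq> ?E j" for j
  proof (rule index_cases[OF i1, of "Suc j"])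
    assume "Suc j < i" then show ?thesis using GD(5)[of j] by (simp add: expand_def)
  next
    assume j: "Suc j = i"
    then have "?E j = G (i - 1)" "?E (Suc j) = L" by (auto simp: expand_def)
    then show ?thesis using L(4) by auto
  next
    fix l assume l: "Suc j = l + 2" "i \<le> Suc l"
    then have 1: "?E (Suc j) = {v \<in> ?V. N v \<in> G l}" using E3[of l] by simp
    show ?thesis
    proof (cases "i = Suc l")
      case True
      then have "?E j = L" "G l = G (i - 1)" using l by (simp_all add: expand_def)
      then show ?thesis using 1 L(3) by auto
    next
      case False
      then obtain m where m: "l = Suc m" "i \<le> Suc m" using l i by (cases l) auto
      then have "?E j = {v \<in> ?V. N v \<in> G m}" using E3[of m] l by simp
      then show ?thesis using 1 GD(5)[of m] GV[of l] m by auto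
    qed
  qed
  have dimE: "vec.dim (?E j) = min j (a + b + 2)" for j
  proof (rule index_cases[OF i1, of j])
    assume "j < i" then show ?thesis using GD(3)[of j] i by (simp add: expand_def)
  next
    assume "j = i" then show ?thesis using L(2) i by (simp add: expand_def)
  next
    fix l assume l: "j = l + 2" "i \<le> Suc l"
    have "G l \<inter> U a b = G l" using GD(2) by blast
    then have "vec.dim (?E j) = vec.dim (G l) + 2"
      using dim_preimage(2)[OF ab GD(1), of l] E3[of l] l by simp
    then show ?thesis using GD(3)[of l] l by simp
  qed
  have "?E \<in> flags (Suc a + Suc b) ?V"
    unfolding flags_def mem_Collect_eq
  proof (intro conjI allI sub)
    fix j
    show "vec.subspace (?E j)"
      using GD(1) L(1) subspace_preimage[OF GD(1) subspace_U] by (simp add: expand_def)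
    have "L \<subseteq> ?V" using L(4) by blast
    then show "?E j \<subseteq> ?V" using GV by (auto simp: expand_def)
    show "vec.dim (?E j) = min j (Suc a + Suc b)" using dimE by simp
  qed
  then show "?E \<in> Y (Suc a) (Suc b)" using nil Y_iff[OF ab'] by blast
  show "N ` ?E (i + 1) \<subseteq> ?E (i - 1)" unfolding E1 using i by (auto simp: expand_def)
  show "collapse i ?E = G"
  proof
    fix j show "collapse i ?E j = G j"
    proof (cases "j < i")
      case True then show ?thesis by (simp add: collapse_def expand_def)
    next
      case False
      then have "collapse i ?E j = N ` {v \<in> ?V. N v \<in> G j}" by (simp add: collapse_def expand_def)
      also have "\<dots> = G j" using dim_preimage(1)[OF ab GD(1), of j] GD(2)[of j] by blast
      finally show ?thesis .
    qed
  qed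
qed

section \<open>Cells and their closures along cup diagrams\<close>

text \<open>The right-hand side of the theorem in terms of the cup diagram \<open>M\<close> alone. The condition at the
  points outside \<open>B\<close> that are not right ends of cups comprises both the rays and the left ends of
  cups of the second round.\<close>
definition cup_variety :: "nat \<Rightarrow> nat \<Rightarrow> nat set \<Rightarrow> (nat \<times> nat) set \<Rightarrow> 'm flag set" where
  "cup_variety n k B M = {F \<in> Y (n - k) k.
     (\<forall>(x, y)\<in>M. (N ^^ ((y - x + 1) div 2)) ` F y \<subseteq> F (x - 1)) \<and>
     (\<forall>j\<in>{1..n} - B - snd ` M. F j = U (top_upto n B j) (bot_upto B j))}"

text \<open>By \<open>cell_eq_p_cell\<close> this is the attracting cell.\<close>
definition p_cell :: "nat \<Rightarrow> nat \<Rightarrow> nat set \<Rightarrow> 'm flag set" where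
  "p_cell n k B = {F \<in> Y (n - k) k. \<forall>j. F j \<inter> U A 0 = U (top_upto n B j) 0}"

section \<open>Nested cups\<close>

lemma flag_determined_by_p_part:
  assumes F: "F \<in> Y a b" and ab: "a \<le> A" "b \<le> K" and p: "F a = U a 0"
  shows "F j = U (min j a) (min (j - a) b)"
proof -
  note FD = Y_D[OF F ab]
  have "F j \<subseteq> U (min j a) (min (j - a) b)"
  proof (cases "j \<le> a")
    case True
    have "v \<in> U j 0" if v: "v \<in> F j" for v
    proof -
      have "(N ^^ j) v \<in> F 0" using Y_Npow[OF F ab, of j 0] v by auto
      moreover have "v \<in> U a 0" using FD(4)[OF True] p v by auto
      ultimately have "v \<in> {v \<in> U a 0. (N ^^ j) v \<in> U 0 0}" using FD(7) U_0_0 by simp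
      then have "v \<in> U (min a (0 + j)) (min 0 (0 + j))" unfolding U_preimage .
      then show ?thesis using True by (simp add: min_absorb2)
    qed
    moreover have "U (min j a) (min (j - a) b) = U j 0" using True by (simp add: min_absorb1)
    ultimately show ?thesis by blast
  next
    case False
    have "v \<in> U a (min b (j - a))" if v: "v \<in> F j" for v
    proof -
      have "j = a + (j - a)" using False by simp
      then have "(N ^^ (j - a)) v \<in> F a" using Y_Npow[OF F ab, of "j - a" a] v by auto
      then have "v \<in> {v \<in> U a b. (N ^^ (j - a)) v \<in> U a 0}" using FD(2)[of j] v p by blast
      then have "v \<in> U (min a (a + (j - a))) (min b (0 + (j - a)))" unfolding U_preimage .
      then show ?thesis by simp
    qed
    moreover have "U (min j a) (min (j - a) b) = U a (min b (j - a))"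
      using False by (simp add: min_absorb2 min.commute)
    ultimately show ?thesis by blast
  qed
  moreover have "min j a \<le> A" "min (j - a) b \<le> K" "min j a + min (j - a) b = min j (a + b)"
    using ab by linarith+
  ultimately show ?thesis
    using vec_subspace_eqI[OF FD(1) subspace_U, of j "min j a" "min (j - a) b"] FD(3)[of j] dim_U by simp
qed

lemma counts_nested:
  assumes "k \<le> n"
  shows "bot_upto {n - k + 1..n} j = min (j - (n - k)) k" "top_upto n {n - k + 1..n} j = min j (n - k)"
proof -
  have "{x \<in> {n - k + 1..n}. x \<le> j} = {n - k + 1..min j n}" by auto
  moreover have "card {n - k + 1..min j n} = min (j - (n - k)) k"
    unfolding card_atLeastAtMost using assms by linarith
  ultimately show "bot_upto {n - k + 1..n} j = min (j - (n - k)) k" by (simp add: bot_upto_def)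
  have "{x \<in> {1..n} - {n - k + 1..n}. x \<le> j} = {1..min j (n - k)}" by auto
  then show "top_upto n {n - k + 1..n} j = min j (n - k)" by (simp add: top_upto_def)
qed

text \<open>For the weight sequence \<open>\<and>\<dots>\<and>\<or>\<dots>\<or>\<close> both sets consist of a single flag.\<close>
lemma nested_cell_eq:
  assumes nk: "2 * k \<le> n" and A: "n - k \<le> A" "k \<le> K"
  defines "B \<equiv> {n - k + 1..n}" and "M \<equiv> (\<lambda>d. (n - k + 1 - d, n - k + d)) ` {1..k}"
  shows "cup_variety n k B M = p_cell n k B"
proof -
  have kn: "k \<le> n" using nk by simp
  have B: "bot_upto B j = min (j - (n - k)) k" "top_upto n B j = min j (n - k)" for j
    unfolding B_def using counts_nested[OF kn] by blast+
  have "F \<in> cup_variety n k B M \<longleftrightarrow> F \<in> Y (n - k) k \<and> F (n - k) = U (n - k) 0" for F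
  proof
    assume F: "F \<in> cup_variety n k B M"
    then have Y: "F \<in> Y (n - k) k" by (simp add: cup_variety_def)
    have "F (n - k) = U (n - k) 0"
    proof (cases "n - k = 0")
      case True then show ?thesis using Y_D(7)[OF Y A] U_0_0 by simp
    next
      case False
      have "n - k \<notin> snd ` M" by (auto simp: M_def)
      then have "n - k \<in> {1..n} - B - snd ` M" using False by (simp add: B_def)
      then have "F (n - k) = U (top_upto n B (n - k)) (bot_upto B (n - k))"
        using F unfolding cup_variety_def by blast
      then show ?thesis by (simp add: B)
    qed
    then show "F \<in> Y (n - k) k \<and> F (n - k) = U (n - k) 0" using Y by blast
  next
    assume F: "F \<in> Y (n - k) k \<and> F (n - k) = U (n - k) 0"
    have FU: "F j = U (min j (n - k)) (min (j - (n - k)) k)" for j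
      using flag_determined_by_p_part[of F "n - k" k j] F A by blast
    have "(N ^^ ((y - x + 1) div 2)) ` F y \<subseteq> F (x - 1)" if xy: "(x, y) \<in> M" for x y
    proof -
      obtain d where d: "1 \<le> d" "d \<le> k" "x = n - k + 1 - d" "y = n - k + d"
        using xy by (auto simp: M_def)
      have e: "(y - x + 1) div 2 = d" "x - 1 = n - k - d" "min y (n - k) = n - k" "y - (n - k) = d"
        "min (n - k - d) (n - k) = n - k - d"
        using d nk by auto
      have Fx: "F (x - 1) = U (n - k - d) 0" and Fy: "F y = U (n - k) d"
        using FU[of "x - 1"] FU[of y] d(2) unfolding e by simp_all
      have "U (n - k) d = {v \<in> U (n - k) d. (N ^^ d) v \<in> U (n - k - d) 0}"
        using d nk by (simp add: U_preimage)
      then show ?thesis unfolding Fx Fy e(1) by blast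
    qed
    moreover have "F j = U (top_upto n B j) (bot_upto B j)" for j using FU[of j] by (simp add: B)
    ultimately show "F \<in> cup_variety n k B M" using F by (auto simp: cup_variety_def)
  qed
  moreover have "F \<in> p_cell n k B \<longleftrightarrow> F \<in> Y (n - k) k \<and> F (n - k) = U (n - k) 0" for F
  proof
    assume F: "F \<in> p_cell n k B"
    then have Y: "F \<in> Y (n - k) k" by (simp add: p_cell_def)
    have "F (n - k) \<inter> U A 0 = U (top_upto n B (n - k)) 0" using F by (simp add: p_cell_def)
    then have sub: "U (n - k) 0 \<subseteq> F (n - k)" using B(2)[of "n - k"] by auto
    have "U (n - k) 0 = F (n - k)"
      by (rule vec_subspace_eqI[OF subspace_U Y_D(1)[OF Y A] sub])
        (use Y_D(3)[OF Y A, of "n - k"] A in \<open>simp add: dim_U\<close>)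
    then show "F \<in> Y (n - k) k \<and> F (n - k) = U (n - k) 0" using Y by simp
  next
    assume F: "F \<in> Y (n - k) k \<and> F (n - k) = U (n - k) 0"
    have "F j \<inter> U A 0 = U (top_upto n B j) 0" for j
    proof -
      have "F j = U (min j (n - k)) (min (j - (n - k)) k)"
        using flag_determined_by_p_part[of F "n - k" k j] F A by blast
      then show ?thesis using A by (simp add: U_Int B min_def)
    qed
    then show "F \<in> p_cell n k B" using F by (simp add: p_cell_def)
  qed
  ultimately show ?thesis by blast
qed

section \<open>Adding an innermost cup\<close>

text \<open>A cup around the removed one loses one from its \<open>\<delta>\<close>, which is made up for by the application of
  \<open>N\<close> in \<open>collapse\<close>. For a cup on the right of it \<open>N\<close> is applied on both sides.\<close>
lemma cup_condition_collapse:
  assumes ab: "a < A" "b < K" and i: "i \<in> {1..a + b + 1}"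
    and F: "F \<in> Y (Suc a) (Suc b)" and cup: "N ` F (i + 1) \<subseteq> F (i - 1)"
    and xy: "1 \<le> x" "x < y"
  shows "(N ^^ ((skip i y - skip i x + 1) div 2)) ` F (skip i y) \<subseteq> F (skip i x - 1) \<longleftrightarrow>
    (N ^^ ((y - x + 1) div 2)) ` collapse i F y \<subseteq> collapse i F (x - 1)"
proof -
  note col = collapse_flag[OF ab i F cup]
  have ab': "Suc a \<le> A" "Suc b \<le> K" using ab by simp_all
  consider "y < i" | "x < i" "i \<le> y" | "i \<le> x" by linarith
  then show ?thesis
  proof cases
    case 1
    then have "x - 1 < i" "x < i" using xy by linarith+
    then show ?thesis using 1 by (simp add: skip_def collapse_def)
  next
    case 2
    have "x - 1 < i" using 2 by linarith
    have e: "skip i x = x" "skip i y = y + 2" "(y + 2 - x + 1) div 2 = Suc ((y - x + 1) div 2)"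
      using 2 xy by (simp_all add: skip_def)
    have c: "collapse i F y = N ` F (y + 2)" "collapse i F (x - 1) = F (x - 1)"
      using 2 \<open>x - 1 < i\<close> by (simp_all add: collapse_def)
    show ?thesis unfolding e c by (simp add: image_image funpow_swap1)
  next
    case 3
    define d where "d = (y - x + 1) div 2"
    have e: "skip i x - 1 = (x - 1) + 2" "skip i y = y + 2" "(y + 2 - (x + 2) + 1) div 2 = d" "skip i x = x + 2"
      using 3 xy by (simp_all add: skip_def d_def)
    have x1: "i \<le> Suc (x - 1)" using 3 xy by simp
    have c: "collapse i F y = N ` F (y + 2)" using 3 xy by (simp add: collapse_def)
    have V: "(N ^^ d) v \<in> U (Suc a) (Suc b)" if "v \<in> F (y + 2)" for v
      using Npow_U Y_D(2)[OF F ab', of "y + 2"] that by blast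
    have "(N ^^ d) ` F (y + 2) \<subseteq> F ((x - 1) + 2) \<longleftrightarrow> (\<forall>v\<in>F (y + 2). N ((N ^^ d) v) \<in> collapse i F (x - 1))"
      unfolding col(3)[OF x1] using V by blast
    also have "\<dots> \<longleftrightarrow> (N ^^ d) ` collapse i F y \<subseteq> collapse i F (x - 1)"
      unfolding c by (auto simp: funpow_swap1)
    finally show ?thesis unfolding e(1) unfolding e(2,4) e(3) d_def[symmetric] .
  qed
qed

lemma cup_variety_adjacent_iff:
  assumes D: "diagram n k B M" and A: "n - k < A" "k < K" and i: "i \<in> {1..n + 1}"
    and F: "F \<in> Y (Suc (n - k)) (Suc k)"
  shows "F \<in> cup_variety (n + 2) (k + 1) (insert i (skip i ` B)) (insert (i, i + 1) (map_prod (skip i) (skip i) ` M))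
    \<longleftrightarrow> N ` F (i + 1) \<subseteq> F (i - 1) \<and> collapse i F \<in> cup_variety n k B M"
    (is "F \<in> cup_variety _ _ ?B ?M \<longleftrightarrow> ?cup \<and> _")
proof (cases ?cup)
  case False
  have "(i, i + 1) \<in> ?M" by simp
  then have "F \<in> cup_variety (n + 2) (k + 1) ?B ?M \<Longrightarrow> (N ^^ ((i + 1 - i + 1) div 2)) ` F (i + 1) \<subseteq> F (i - 1)"
    unfolding cup_variety_def by blast
  then show ?thesis using False by auto
next
  case cup: True
  have nk: "2 * k \<le> n" "B \<subseteq> {1..n}" "card B = k" using diagram_set[OF D] by auto
  have finB: "finite B" using nk finite_subset by blast
  have i': "i \<in> {1..(n - k) + k + 1}" using i nk by simp
  note col = collapse_flag[OF A i' F cup]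
  have dims: "n + 2 - (k + 1) = Suc (n - k)" "k + 1 = Suc k" using nk by simp_all
  have split: "(\<forall>(x, y)\<in>?M. Q x y) \<longleftrightarrow> Q i (i + 1) \<and> (\<forall>(x, y)\<in>M. Q (skip i x) (skip i y))"
    for Q :: "nat \<Rightarrow> nat \<Rightarrow> bool" by (simp add: case_prod_unfold)
  have cup': "(N ^^ ((i + 1 - i + 1) div 2)) ` F (i + 1) \<subseteq> F (i - 1)" using cup by simp
  have cups: "(\<forall>(x, y)\<in>?M. (N ^^ ((y - x + 1) div 2)) ` F y \<subseteq> F (x - 1)) \<longleftrightarrow>
    (\<forall>(x, y)\<in>M. (N ^^ ((y - x + 1) div 2)) ` collapse i F y \<subseteq> collapse i F (x - 1))"
  proof -
    have "(\<forall>(x, y)\<in>?M. (N ^^ ((y - x + 1) div 2)) ` F y \<subseteq> F (x - 1)) \<longleftrightarrow>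
      (\<forall>(x, y)\<in>M. (N ^^ ((skip i y - skip i x + 1) div 2)) ` F (skip i y) \<subseteq> F (skip i x - 1))"
      using split[of "\<lambda>x y. (N ^^ ((y - x + 1) div 2)) ` F y \<subseteq> F (x - 1)"] cup' by (simp only: simp_thms)
    also have "\<dots> \<longleftrightarrow> (\<forall>(x, y)\<in>M. (N ^^ ((y - x + 1) div 2)) ` collapse i F y \<subseteq> collapse i F (x - 1))"
    proof (rule ball_cong[OF refl])
      fix c assume c: "c \<in> M"
      obtain x y where xy: "c = (x, y)" by (cases c)
      have "1 \<le> x" "x < y" using diagram_cup_bounds[OF D, of x y] c xy by simp_all
      then show "(case c of (x, y) \<Rightarrow> (N ^^ ((skip i y - skip i x + 1) div 2)) ` F (skip i y) \<subseteq> F (skip i x - 1)) =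
        (case c of (x, y) \<Rightarrow> (N ^^ ((y - x + 1) div 2)) ` collapse i F y \<subseteq> collapse i F (x - 1))"
        unfolding xy using cup_condition_collapse[OF A i' F cup, of x y] by simp
    qed
    finally show ?thesis .
  qed
  have pts: "{1..n + 2} - ?B - snd ` ?M = skip i ` ({1..n} - B - snd ` M)"
  proof (rule set_eqI)
    fix c
    have sM: "snd ` ?M = insert (Suc i) (skip i ` snd ` M)" by (simp add: image_image)
    show "c \<in> {1..n + 2} - ?B - snd ` ?M \<longleftrightarrow> c \<in> skip i ` ({1..n} - B - snd ` M)"
    proof (rule skip_cases[of c i])
      assume "c = i" then show ?thesis by auto
    next
      assume "c = Suc i" then show ?thesis unfolding sM by auto
    next
      fix c' assume c: "c = skip i c'"
      have m: "skip i c' \<in> skip i ` X \<longleftrightarrow> c' \<in> X" for X by auto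
      show ?thesis unfolding sM c using skip_range[OF i, of c'] m by simp
    qed
  qed
  have pt: "F (skip i j) = U (top_upto (n + 2) ?B (skip i j)) (bot_upto ?B (skip i j)) \<longleftrightarrow>
      collapse i F j = U (top_upto n B j) (bot_upto B j)" for j
  proof (cases "j < i")
    case True
    then show ?thesis using top_upto_insert(1)[OF nk(2) i True] bot_upto_insert(1)[OF finB _ True] i
      by (simp add: skip_def collapse_def)
  next
    case False
    have j: "i \<le> Suc j" "skip i j = j + 2" using False by (simp_all add: skip_def)
    have cnt: "top_upto (n + 2) ?B (j + 2) = Suc (top_upto n B j)" "bot_upto ?B (j + 2) = Suc (bot_upto B j)"
      using top_upto_insert(3)[OF nk(2) i j(1)] bot_upto_insert(3)[OF finB _ j(1)] i by simp_all
    have le: "top_upto n B j \<le> n - k" "bot_upto B j \<le> k" using top_upto_le[OF nk(2)] bot_upto_le[OF finB] nk(3) by simp_all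
    show ?thesis unfolding j(2) cnt
    proof
      assume "F (j + 2) = U (Suc (top_upto n B j)) (Suc (bot_upto B j))"
      then show "collapse i F j = U (top_upto n B j) (bot_upto B j)"
        using col(2)[OF j(1)] N_image_U_Suc[of "top_upto n B j" "bot_upto B j"] le A by simp
    next
      assume "collapse i F j = U (top_upto n B j) (bot_upto B j)"
      then show "F (j + 2) = U (Suc (top_upto n B j)) (Suc (bot_upto B j))"
        using col(3)[OF j(1)] U_preimage1[of "Suc (n - k)" "Suc k" "top_upto n B j" "bot_upto B j"] le by simp
    qed
  qed
  have pts': "(\<forall>j\<in>{1..n + 2} - ?B - snd ` ?M. F j = U (top_upto (n + 2) ?B j) (bot_upto ?B j)) \<longleftrightarrow>
    (\<forall>j\<in>{1..n} - B - snd ` M. collapse i F j = U (top_upto n B j) (bot_upto B j))"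
    unfolding pts using pt by (simp only: ball_simps)
  have FY: "F \<in> Y (n + 2 - (k + 1)) (k + 1)" unfolding dims(1) unfolding dims(2) by (rule F)
  show ?thesis
    using cup FY col(1) cups pts' by (simp only: cup_variety_def mem_Collect_eq simp_thms)
qed

text \<open>In the cell, \<open>F (i + 1)\<close> is obtained from \<open>F i\<close> by adding the next basis vector of the first
  block, whose image under \<open>N\<close> is already in \<open>F (i - 1)\<close>.\<close>
lemma p_cell_adjacent_collapse:
  assumes D: "diagram n k B M" and A: "n - k < A" "k < K" and i: "i \<in> {1..n + 1}"
    and F: "F \<in> p_cell (n + 2) (k + 1) (insert i (skip i ` B))"
  shows "N ` F (i + 1) \<subseteq> F (i - 1)" "collapse i F \<in> p_cell n k B"
proof -
  let ?B = "insert i (skip i ` B)"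
  have nk: "2 * k \<le> n" "B \<subseteq> {1..n}" "card B = k" using diagram_set[OF D] by auto
  have i': "i \<in> {1..(n - k) + k + 1}" using i nk by simp
  have i1: "i + 1 = (i - 1) + 2" "i \<le> Suc (i - 1)" "i - 1 < i" using i by simp_all
  have A': "Suc (n - k) \<le> A" "Suc k \<le> K" using A by simp_all
  have "n + 2 - (k + 1) = Suc (n - k)" "k + 1 = Suc k" using nk by simp_all
  then have FY: "F \<in> Y (Suc (n - k)) (Suc k)" using F by (simp add: p_cell_def)
  note FD = Y_D[OF FY A']
  have FP: "F j \<inter> U A 0 = U (top_upto (n + 2) ?B j) 0" for j using F by (simp add: p_cell_def)
  let ?t = "top_upto n B (i - 1)"
  have t: "?t \<le> n - k" using top_upto_le[OF nk(2)] nk(3) by simp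
  have F0: "F (i - 1) \<inter> U A 0 = U ?t 0" using FP[of "i - 1"] top_upto_insert(1)[OF nk(2) i i1(3)] by simp
  have F1: "F i \<inter> U A 0 = U ?t 0" using FP[of i] top_upto_insert(2)[OF nk(2) i] by simp
  have F2: "F (i + 1) \<inter> U A 0 = U (Suc ?t) 0" using FP[of "i + 1"] top_upto_insert(3)[OF nk(2) i i1(2)] i1(1) by simp
  have pU: "p (Suc ?t) \<in> U (Suc ?t) 0" "p (Suc ?t) \<in> U A 0" "p ?t \<in> U ?t 0"
    using t A by (simp_all add: p_in_U)
  have tA: "Suc ?t \<in> {1..A}" using t A by simp
  have "p_coord (Suc ?t) (p (Suc ?t)) = 1" using coord_basis(1)[OF tA] by simp
  then have "p (Suc ?t) \<notin> U ?t 0" by (auto simp: U_def)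
  then have pF: "p (Suc ?t) \<in> F (i + 1)" "p (Suc ?t) \<notin> F i" using pU F1 F2 by blast+
  have sF: "vec.span (F i) = F i" using FD(1) by (simp add: vec.span_eq_iff)
  have "vec.span (insert (p (Suc ?t)) (F i)) = F (i + 1)"
  proof (rule vec_subspace_eqI[OF vec.subspace_span FD(1)])
    show "vec.span (insert (p (Suc ?t)) (F i)) \<subseteq> F (i + 1)"
      using FD(4)[of i "i + 1"] pF(1) by (intro vec.span_minimal FD(1)) auto
    have "p (Suc ?t) \<notin> vec.span (F i)" using pF(2) unfolding sF .
    then have "vec.dim (insert (p (Suc ?t)) (F i)) = vec.dim (F i) + 1" by (simp add: vec.dim_insert)
    then show "vec.dim (F (i + 1)) \<le> vec.dim (vec.span (insert (p (Suc ?t)) (F i)))"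
      using FD(3)[of i] FD(3)[of "i + 1"] by (simp add: min_def)
  qed
  then have FI: "F (i + 1) \<subseteq> vec.span (insert (p (Suc ?t)) (F i))" by simp
  show cup: "N ` F (i + 1) \<subseteq> F (i - 1)"
  proof
    fix v assume "v \<in> N ` F (i + 1)"
    then obtain u where u: "u \<in> F (i + 1)" "v = N u" by blast
    then have "u \<in> vec.span (insert (p (Suc ?t)) (F i))" using FI by blast
    then obtain c where "u - c *s p (Suc ?t) \<in> vec.span (F i)"
      using vec.span_breakdown_eq by blast
    then have f: "u - c *s p (Suc ?t) \<in> F i" unfolding sF .
    have "N (u - c *s p (Suc ?t)) \<in> F (i - 1)" using FD(5)[of "i - 1"] f i by auto
    moreover have "N (c *s p (Suc ?t)) \<in> F (i - 1)"
    proof -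
      have "N (p (Suc ?t)) = p ?t" using Np[OF tA] by simp
      moreover have "p ?t \<in> F (i - 1)" using pU(3) F0 by blast
      ultimately show ?thesis using vec.subspace_scale[OF FD(1)] by (simp add: N.scale)
    qed
    ultimately have "N (u - c *s p (Suc ?t)) + N (c *s p (Suc ?t)) \<in> F (i - 1)"
      by (rule vec.subspace_add[OF FD(1)])
    then show "v \<in> F (i - 1)" using u(2) by (simp add: N.diff)
  qed
  note col = collapse_flag[OF A i' FY cup]
  have "collapse i F j \<inter> U A 0 = U (top_upto n B j) 0" for j
  proof (cases "j < i")
    case True then show ?thesis using FP[of j] top_upto_insert(1)[OF nk(2) i True] by (simp add: collapse_def)
  next
    case False
    then have j: "i \<le> Suc j" by simp
    have tj: "top_upto n B j \<le> n - k" using top_upto_le[OF nk(2)] nk(3) by simp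
    have F2j: "F (j + 2) \<inter> U A 0 = U (Suc (top_upto n B j)) 0"
      using FP[of "j + 2"] top_upto_insert(3)[OF nk(2) i j] by simp
    have pre: "{v \<in> U A 0. N v \<in> U (top_upto n B j) 0} = U (Suc (top_upto n B j)) 0"
      using U_preimage1[of A 0 "top_upto n B j" 0] tj A by simp
    show ?thesis
    proof (intro equalityI subsetI)
      fix v assume v: "v \<in> collapse i F j \<inter> U A 0"
      then have vU: "v \<in> U (n - k) k" using Y_D(2)[OF col(1)] A by force
      have "v \<in> U (min A (n - k)) (min 0 k)" using v vU U_Int by blast
      then have v0: "v \<in> U (n - k) 0" using A by simp
      have K: "0 < K" using A by simp
      have "up v \<in> U (Suc (n - k)) 0" by (rule up_p_part[OF A(1) K v0])
      then have upA: "up v \<in> U A 0" using U_mono[of "Suc (n - k)" A 0 0] A by auto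
      have "up v \<in> F (j + 2)" unfolding col(3)[OF j] using up[OF A vU] v by simp
      then have "up v \<in> U (Suc (top_upto n B j)) 0" using upA F2j by blast
      then have "N (up v) \<in> U (top_upto n B j) 0" using pre by blast
      then show "v \<in> U (top_upto n B j) 0" using up(1)[OF A vU] by simp
    next
      fix v assume v: "v \<in> U (top_upto n B j) 0"
      have K: "0 < K" and tjA: "top_upto n B j < A" using A tj by simp_all
      have "up v \<in> U (Suc (top_upto n B j)) 0" by (rule up_p_part[OF tjA K v])
      then have "N (up v) \<in> N ` F (j + 2)" using F2j by blast
      moreover have "N (up v) = v" by (rule up(1)[OF tjA K v])
      ultimately have "v \<in> collapse i F j" using col(2)[OF j] by simp
      then show "v \<in> collapse i F j \<inter> U A 0" using v U_mono[of "top_upto n B j" A 0 0] tjA by auto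
    qed
  qed
  then show "collapse i F \<in> p_cell n k B" using col(1) by (simp add: p_cell_def)
qed

lemma p_cell_adjacent_expand:
  assumes D: "diagram n k B M" and A: "n - k < A" "k < K" and i: "i \<in> {1..n + 1}"
    and G: "G \<in> p_cell n k B"
    and L: "vec.subspace L" "vec.dim L = i" "G (i - 1) \<subseteq> L"
      "L \<subseteq> {v \<in> U (Suc (n - k)) (Suc k). N v \<in> G (i - 1)}" "L \<inter> U A 0 \<subseteq> G (i - 1)"
  shows "expand (n - k) k i G L \<in> p_cell (n + 2) (k + 1) (insert i (skip i ` B))"
proof -
  let ?B = "insert i (skip i ` B)" and ?E = "expand (n - k) k i G L"
  have nk: "2 * k \<le> n" "B \<subseteq> {1..n}" "card B = k" using diagram_set[OF D] by auto
  have i': "i \<in> {1..(n - k) + k + 1}" using i nk by simp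
  have GY: "G \<in> Y (n - k) k" and GP: "\<And>j. G j \<inter> U A 0 = U (top_upto n B j) 0"
    using G by (simp_all add: p_cell_def)
  have dims: "n + 2 - (k + 1) = Suc (n - k)" "k + 1 = Suc k" using nk by simp_all
  have EY: "?E \<in> Y (n + 2 - (k + 1)) (k + 1)"
    unfolding dims(1) unfolding dims(2) by (rule expand_flag(1)[OF A i' GY L(1-4)])
  have "?E j \<inter> U A 0 = U (top_upto (n + 2) ?B j) 0" for j
  proof -
    have "1 \<le> i" using i by simp
    then show ?thesis
    proof (cases rule: index_cases[of i j])
      case 1 then show ?thesis using GP[of j] top_upto_insert(1)[OF nk(2) i 1] by (simp add: expand_def)
    next
      case 2
      have "L \<inter> U A 0 = G (i - 1) \<inter> U A 0" using L(3,5) by blast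
      then show ?thesis using 2 GP[of "i - 1"] top_upto_insert(2)[OF nk(2) i] by (simp add: expand_def)
    next
      case (3 l)
      have E: "?E j = {v \<in> U (Suc (n - k)) (Suc k). N v \<in> G l}" using 3 by (simp add: expand_def)
      have t: "top_upto n B l \<le> n - k" using top_upto_le[OF nk(2)] nk(3) by simp
      have pre: "{v \<in> U (Suc (n - k)) 0. N v \<in> U (top_upto n B l) 0} = U (Suc (top_upto n B l)) 0"
        using U_preimage1[of "Suc (n - k)" 0 "top_upto n B l" 0] t by simp
      have UI: "U (Suc (n - k)) (Suc k) \<inter> U A 0 = U (Suc (n - k)) 0" using A by (simp add: U_Int)
      have st: "N v \<in> U A 0" if "v \<in> U A 0" for v using that by (rule N_U_stable)
      have UA: "U (Suc (n - k)) 0 \<subseteq> U A 0" using A by (intro U_mono) simp_all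
      have "?E j \<inter> U A 0 = {v \<in> U (Suc (n - k)) 0. N v \<in> G l \<inter> U A 0}"
        unfolding E using UI UA st by blast
      then show ?thesis unfolding GP pre using top_upto_insert(3)[OF nk(2) i 3(2)] 3(1) by simp
    qed
  qed
  then show ?thesis using EY by (simp add: p_cell_def)
qed

text \<open>The preimage of \<open>G (i - 1)\<close> exceeds \<open>G (i - 1)\<close> by two dimensions, but its intersection with the
  first block exceeds that of \<open>G (i - 1)\<close> by only one.\<close>
lemma transversal_vector_exists:
  assumes nk: "2 * k \<le> n" "B \<subseteq> {1..n}" "card B = k" and A: "n - k < A" "k < K" and i: "i \<in> {1..n + 1}"
    and G: "G \<in> p_cell n k B"
  shows "\<exists>h \<in> {v \<in> U (Suc (n - k)) (Suc k). N v \<in> G (i - 1)}. h \<notin> {x + y |x y. x \<in> G (i - 1) \<and> y \<in> U A 0}"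
proof (rule ccontr)
  let ?S = "{v \<in> U (Suc (n - k)) (Suc k). N v \<in> G (i - 1)}" and ?t = "top_upto n B (i - 1)"
  assume "\<not> ?thesis"
  then have sub: "\<And>h. h \<in> ?S \<Longrightarrow> \<exists>x y. h = x + y \<and> x \<in> G (i - 1) \<and> y \<in> U A 0" by blast
  have A': "n - k \<le> A" "k \<le> K" using A by simp_all
  have GY: "G \<in> Y (n - k) k" and GP: "G (i - 1) \<inter> U A 0 = U ?t 0"
    using G by (simp_all add: p_cell_def)
  note GD = Y_D[OF GY A']
  have t: "?t \<le> n - k" using top_upto_le[OF nk(2)] nk(3) by simp
  have tA: "?t < A" using t A by simp
  have GV: "G (i - 1) \<subseteq> U (Suc (n - k)) (Suc k)" using GD(2)[of "i - 1"] U_mono[of "n - k" "Suc (n - k)" k "Suc k"] by simp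
  let ?T = "vec.span (insert (p (Suc ?t)) (G (i - 1)))"
  have "?S \<subseteq> ?T"
  proof
    fix h assume h: "h \<in> ?S"
    then obtain x y where xy: "h = x + y" "x \<in> G (i - 1)" "y \<in> U A 0" using sub by blast
    have Nx: "N x \<in> G (i - 1)" using Y_N_stable[OF GY A'] xy(2) by blast
    have "N y = N h - N x" using xy(1) by (simp add: N.add)
    then have "N y \<in> G (i - 1)" using h Nx vec.subspace_diff[OF GD(1)] by simp
    then have "N y \<in> U ?t 0" using GP N_U_stable[OF xy(3)] by blast
    then have "y \<in> {v \<in> U A 0. N v \<in> U ?t 0}" using xy(3) by simp
    then have "y \<in> U (min A (Suc ?t)) (min 0 (Suc 0))" unfolding U_preimage1 .
    then have "y \<in> U (Suc ?t) 0" using tA by simp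
    then have "y \<in> vec.span (insert (p (Suc ?t)) (U ?t 0))" using U_Suc_subset_span_insert[OF tA] by blast
    moreover have "vec.span (insert (p (Suc ?t)) (U ?t 0)) \<subseteq> ?T" using GP by (intro vec.span_mono) blast
    moreover have "x \<in> ?T" using xy(2) by (intro vec.span_base) simp
    ultimately show "h \<in> ?T" unfolding xy(1) by (intro vec.span_add) auto
  qed
  then have "vec.dim ?S \<le> vec.dim ?T" by (rule vec.dim_subset)
  also have "\<dots> \<le> vec.dim (G (i - 1)) + 1" by (simp add: vec.dim_insert)
  also have dG: "vec.dim (G (i - 1)) = i - 1" using GD(3)[of "i - 1"] i nk by (auto simp: min_def)
  finally have "vec.dim ?S \<le> i - 1 + 1" .
  moreover have "G (i - 1) \<inter> U (n - k) k = G (i - 1)" using GD(2)[of "i - 1"] by blast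
  then have "vec.dim ?S = (i - 1) + 2" using dim_preimage(2)[OF A GD(1), of "i - 1"] dG by (simp only:)
  ultimately show False by linarith
qed

lemma transversal_line:
  assumes x: "x \<notin> {g + y |g y. g \<in> G \<and> y \<in> P}" and G: "vec.subspace G" and P: "vec.subspace P"
  shows "vec.dim (vec.span (insert x G)) = vec.dim G + 1" "vec.span (insert x G) \<inter> P \<subseteq> G"
proof -
  have "x \<notin> G"
  proof
    assume "x \<in> G"
    then have "x = x + 0 \<and> x \<in> G \<and> 0 \<in> P" using vec.subspace_0[OF P] by simp
    then show False using x by blast
  qed
  have sG: "vec.span G = G" using G by (simp add: vec.span_eq_iff)
  have "x \<notin> vec.span G" unfolding sG by fact
  then show "vec.dim (vec.span (insert x G)) = vec.dim G + 1" by (simp add: vec.dim_insert)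
  show "vec.span (insert x G) \<inter> P \<subseteq> G"
  proof
    fix v assume v: "v \<in> vec.span (insert x G) \<inter> P"
    then obtain c where c: "v - c *s x \<in> vec.span G" using vec.span_breakdown_eq by blast
    then have g: "v - c *s x \<in> G" unfolding sG .
    have "c = 0"
    proof (rule ccontr)
      assume c0: "c \<noteq> 0"
      let ?g = "inverse c *s (c *s x - v)" and ?y = "inverse c *s v"
      have "- (v - c *s x) \<in> G" using g vec.subspace_neg[OF G] by blast
      then have "c *s x - v \<in> G" by simp
      then have "?g \<in> G" by (rule vec.subspace_scale[OF G])
      moreover have "?y \<in> P" using v by (intro vec.subspace_scale[OF P]) simp
      moreover have "x = ?g + ?y" using c0 by (simp add: vec.scale_right_diff_distrib)
      ultimately show False using x by blast
    qed
    then show "v \<in> G" using g by simp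
  qed
qed

end

text \<open>Where the given approximation fails to be transversal, a small multiple of a transversal
  vector is added.\<close>
lemma transversal_approximation:
  fixes z :: "nat \<Rightarrow> complex ^ 'm::finite"
  assumes S: "\<And>m. vec.subspace (S m)" and T: "\<And>m. vec.subspace (T m)"
    and z: "\<And>m. z m \<in> S m" "z \<longlonglongrightarrow> x" and ex: "\<And>m. \<exists>h\<in>S m. h \<notin> T m"
  shows "\<exists>y. (\<forall>m. y m \<in> S m \<and> y m \<notin> T m) \<and> y \<longlonglongrightarrow> x"
proof -
  have "\<forall>m. \<exists>h. h \<in> S m \<and> h \<notin> T m" using ex by blast
  then have "\<exists>h. \<forall>m. h m \<in> S m \<and> h m \<notin> T m" by (rule choice)
  then obtain h where h: "\<And>m. h m \<in> S m" "\<And>m. h m \<notin> T m" by blast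
  define c where "c m = inverse (real (Suc m) * (1 + norm (h m)))" for m
  have c: "c m > 0" "norm (c m *\<^sub>R h m) \<le> inverse (real (Suc m))" for m
  proof -
    have pos: "0 < real (Suc m)" "0 < 1 + norm (h m)" by (simp, smt (verit) norm_ge_zero)
    show "c m > 0" unfolding c_def using pos by (simp only: inverse_positive_iff_positive mult_pos_pos)
    have "norm (c m *\<^sub>R h m) = inverse (real (Suc m)) * (norm (h m) / (1 + norm (h m)))"
      using pos \<open>c m > 0\<close> by (simp add: c_def divide_inverse inverse_mult_distrib)
    also have "\<dots> \<le> inverse (real (Suc m)) * 1"
      by (intro mult_left_mono) (use pos in simp_all)
    finally show "norm (c m *\<^sub>R h m) \<le> inverse (real (Suc m))" by simp
  qed
  define y where "y m = (if z m \<in> T m then z m + c m *\<^sub>R h m else z m)" for m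
  have "y m \<in> S m" for m
    using z(1)[of m] vec.subspace_add[OF S z(1) vec.subspace_scale[OF S h(1)]]
    unfolding y_def scaleR_eq_complex_scale by (simp split: if_split)
  moreover have "y m \<notin> T m" for m
  proof (cases "z m \<in> T m")
    case True
    show ?thesis
    proof
      assume "y m \<in> T m"
      then have "z m + complex_of_real (c m) *s h m \<in> T m"
        using True by (simp add: y_def scaleR_eq_complex_scale)
      from vec.subspace_diff[OF T this True] have "complex_of_real (c m) *s h m \<in> T m" by simp
      then have "inverse (complex_of_real (c m)) *s (complex_of_real (c m) *s h m) \<in> T m"
        by (rule vec.subspace_scale[OF T])
      moreover have "complex_of_real (c m) \<noteq> 0" using c(1)[of m] by simp
      ultimately show False using h(2)[of m] by simp
    qed
  qed (simp add: y_def)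
  moreover have "y \<longlonglongrightarrow> x"
  proof -
    have "(\<lambda>m. y m - z m) \<longlonglongrightarrow> 0"
    proof (rule Lim_null_comparison)
      show "\<forall>\<^sub>F m in sequentially. norm (y m - z m) \<le> inverse (real (Suc m))"
      proof (rule always_eventually, rule allI)
        fix m
        show "norm (y m - z m) \<le> inverse (real (Suc m))"
          using c(2)[of m] by (cases "z m \<in> T m") (simp_all add: y_def)
      qed
    qed (rule LIMSEQ_inverse_real_of_nat)
    from tendsto_add[OF this z(2)] show ?thesis by simp
  qed
  ultimately show ?thesis by (intro exI[of _ y]) blast
qed

context two_jordan_blocks
begin

lemma p_cell_subset_cup_variety:
  "diagram n k B M \<Longrightarrow> n - k \<le> A \<Longrightarrow> k \<le> K \<Longrightarrow> p_cell n k B \<subseteq> cup_variety n k B M"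
proof (induction rule: diagram.induct)
  case (nested k n)
  then show ?case using nested_cell_eq by simp
next
  case (adjacent n k B M i)
  have nk: "2 * k \<le> n" using diagram_set[OF adjacent.hyps(1)] by simp
  have A: "n - k < A" "k < K" using adjacent.prems nk by simp_all
  have IH: "p_cell n k B \<subseteq> cup_variety n k B M" using adjacent.IH A by simp
  have dims: "n + 2 - (k + 1) = Suc (n - k)" "k + 1 = Suc k" using nk by simp_all
  show ?case
  proof
    fix F assume F: "F \<in> p_cell (n + 2) (k + 1) (insert i (skip i ` B))"
    then have "F \<in> Y (n + 2 - (k + 1)) (k + 1)" unfolding p_cell_def by blast
    then have FY: "F \<in> Y (Suc (n - k)) (Suc k)" unfolding dims(1) unfolding dims(2) .
    note c = p_cell_adjacent_collapse[OF adjacent.hyps(1) A adjacent.hyps(2) F]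
    show "F \<in> cup_variety (n + 2) (k + 1) (insert i (skip i ` B)) (insert (i, i + 1) (map_prod (skip i) (skip i) ` M))"
      unfolding cup_variety_adjacent_iff[OF adjacent.hyps(1) A adjacent.hyps(2) FY]
      using c IH by blast
  qed
qed

text \<open>Convergence from below, which for flags of the same dimensions is convergence.\<close>
definition approximates :: "(nat \<Rightarrow> 'm flag) \<Rightarrow> 'm flag \<Rightarrow> bool" where
  "approximates G F \<longleftrightarrow> (\<forall>j. \<forall>v\<in>F j. \<exists>u. (\<forall>m. u m \<in> G m j) \<and> u \<longlonglongrightarrow> v)"

lemma approximation_preimage:
  assumes A: "a < A" "b < K" and v: "v \<in> U (Suc a) (Suc b)" "N v \<in> U a b"
    and u: "\<And>m. u m \<in> G m" "\<And>m. G m \<subseteq> U a b" "u \<longlonglongrightarrow> N v"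
  shows "\<exists>z. (\<forall>m. z m \<in> {v \<in> U (Suc a) (Suc b). N v \<in> G m}) \<and> z \<longlonglongrightarrow> v"
proof -
  have d: "u m - N v \<in> U a b" for m
    using u(1,2)[of m] v(2) by (intro vec.subspace_diff[OF subspace_U]) auto
  let ?z = "\<lambda>m. v + up (u m - N v)"
  have "?z m \<in> {v \<in> U (Suc a) (Suc b). N v \<in> G m}" for m
    using up[OF A d[of m]] v(1) u(1)[of m] vec.subspace_add[OF subspace_U] by (auto simp: N.add)
  moreover have "?z \<longlonglongrightarrow> v"
  proof -
    have "bounded_linear up"
      using linear_of_vec_linear[OF lin_up] linear_conv_bounded_linear by blast
    moreover have "(\<lambda>m. u m - N v) \<longlonglongrightarrow> N v - N v" by (intro tendsto_intros u(3))
    ultimately have "(\<lambda>m. up (u m - N v)) \<longlonglongrightarrow> up (N v - N v)" by (rule bounded_linear.tendsto)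
    then have "?z \<longlonglongrightarrow> v + up (N v - N v)" by (intro tendsto_intros)
    then show ?thesis by (simp add: up.zero)
  qed
  ultimately show ?thesis by (intro exI[of _ ?z] conjI allI)
qed

text \<open>The inductive step: an approximation of the collapsed flag by cell elements is lifted to one of
  \<open>F\<close>. Below position \<open>i\<close> the spaces are those of the collapsed flag, above it they are preimages; in
  position \<open>i\<close> a line has to be chosen that is close to the given one and transversal to the first
  block.\<close>
lemma approximates_expand:
  assumes nk: "2 * k \<le> n" "B \<subseteq> {1..n}" "card B = k" and D: "diagram n k B M"
    and A: "n - k < A" "k < K" and i: "i \<in> {1..n + 1}"
    and F: "F \<in> Y (Suc (n - k)) (Suc k)" and cup: "N ` F (i + 1) \<subseteq> F (i - 1)"
    and G: "\<And>m. G m \<in> p_cell n k B" and appr: "approximates G (collapse i F)"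
  shows "\<exists>H. (\<forall>m. H m \<in> p_cell (n + 2) (k + 1) (insert i (skip i ` B))) \<and> approximates H F"
proof -
  have i': "i \<in> {1..(n - k) + k + 1}" using i nk by simp
  have A': "Suc (n - k) \<le> A" "Suc k \<le> K" and A'': "n - k \<le> A" "k \<le> K" using A by simp_all
  note FD = Y_D[OF F A'] and col = collapse_flag[OF A i' F cup]
  have GY: "G m \<in> Y (n - k) k" for m using G[of m] by (simp add: p_cell_def)
  note GD = Y_D[OF GY A'']
  let ?V = "U (Suc (n - k)) (Suc k)"
  have GV: "G m j \<subseteq> ?V" for m j
    using GD(2)[of m j] U_mono[of "n - k" "Suc (n - k)" k "Suc k"] by simp
  have lift: "\<exists>u. (\<forall>m. u m \<in> {v \<in> ?V. N v \<in> G m j}) \<and> u \<longlonglongrightarrow> v" if j: "i \<le> Suc j" and v: "v \<in> F (j + 2)" for j v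
  proof -
    have Nv: "N v \<in> collapse i F j" using v col(2)[OF j] by blast
    then obtain u where u: "\<And>m. u m \<in> G m j" "u \<longlonglongrightarrow> N v"
      using appr unfolding approximates_def by blast
    have "v \<in> ?V" "N v \<in> U (n - k) k" using v FD(2)[of "j + 2"] Nv Y_D(2)[OF col(1) A''] by auto
    then show ?thesis by (rule approximation_preimage[OF A _ _ u(1) GD(2) u(2)])
  qed
  have i1: "i + 1 = (i - 1) + 2" "i \<le> Suc (i - 1)" "i - 1 < i" using i by simp_all
  have "F (i - 1) \<noteq> F i" using FD(3)[of i] FD(3)[of "i - 1"] i nk by auto
  then obtain x where x: "x \<in> F i" "x \<notin> F (i - 1)" using FD(4)[of "i - 1" i] by auto
  have Fi: "F i = vec.span (insert x (F (i - 1)))"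
  proof (rule vec_subspace_eqI[symmetric, OF vec.subspace_span FD(1)])
    show "vec.span (insert x (F (i - 1))) \<subseteq> F i"
      using x FD(4)[of "i - 1" i] by (intro vec.span_minimal FD(1)) auto
    have "vec.span (F (i - 1)) = F (i - 1)" using FD(1) by (simp add: vec.span_eq_iff)
    then have "x \<notin> vec.span (F (i - 1))" using x(2) by blast
    then have "vec.dim (insert x (F (i - 1))) = vec.dim (F (i - 1)) + 1" by (simp add: vec.dim_insert)
    then show "vec.dim (F i) \<le> vec.dim (vec.span (insert x (F (i - 1))))"
      using FD(3)[of i] FD(3)[of "i - 1"] by (auto simp: min_def)
  qed
  have "x \<in> F ((i - 1) + 2)" using x(1) FD(4)[of i "i + 1"] i1(1) by auto
  then obtain z where z: "\<And>m. z m \<in> {v \<in> ?V. N v \<in> G m (i - 1)}" "z \<longlonglongrightarrow> x"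
    using lift[OF i1(2)] by blast
  define T where "T m = {g + y |g y. g \<in> G m (i - 1) \<and> y \<in> U A 0}" for m
  have subT: "vec.subspace (T m)" for m
    unfolding T_def by (rule vec.subspace_sums[OF GD(1) subspace_U])
  have h: "\<exists>h\<in>{v \<in> ?V. N v \<in> G m (i - 1)}. h \<notin> T m" for m
    using transversal_vector_exists[OF nk A i G] unfolding T_def by blast
  have "vec.subspace {v \<in> ?V. N v \<in> G m (i - 1)}" for m
    by (rule subspace_preimage[OF GD(1) subspace_U])
  from transversal_approximation[OF this subT z h] obtain y
    where yS: "\<And>m. y m \<in> {v \<in> ?V. N v \<in> G m (i - 1)}" and yT: "\<And>m. y m \<notin> T m" and ylim: "y \<longlonglongrightarrow> x"
    by blast
  define L where "L m = vec.span (insert (y m) (G m (i - 1)))" for m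
  have dimG: "vec.dim (G m (i - 1)) = i - 1" for m using GD(3)[of m "i - 1"] i nk by (auto simp: min_def)
  have L: "vec.subspace (L m)" "vec.dim (L m) = i" "G m (i - 1) \<subseteq> L m"
    "L m \<subseteq> {v \<in> ?V. N v \<in> G m (i - 1)}" "L m \<inter> U A 0 \<subseteq> G m (i - 1)" for m
  proof -
    show "vec.subspace (L m)" by (simp add: L_def)
    note t = transversal_line[OF yT[of m, unfolded T_def] GD(1) subspace_U]
    show "vec.dim (L m) = i" using t(1) dimG[of m] i unfolding L_def by simp
    show "L m \<inter> U A 0 \<subseteq> G m (i - 1)" using t(2) unfolding L_def .
    show "G m (i - 1) \<subseteq> L m" unfolding L_def by (auto intro: vec.span_base)
    have "G m (i - 1) \<subseteq> {v \<in> ?V. N v \<in> G m (i - 1)}"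
      using GV[of m "i - 1"] Y_N_stable[OF GY A'', of m "i - 1"] by blast
    then show "L m \<subseteq> {v \<in> ?V. N v \<in> G m (i - 1)}"
      unfolding L_def using yS[of m] by (intro vec.span_minimal subspace_preimage GD(1) subspace_U) simp
  qed
  define H where "H m = expand (n - k) k i (G m) (L m)" for m
  have "H m \<in> p_cell (n + 2) (k + 1) (insert i (skip i ` B))" for m
    unfolding H_def by (rule p_cell_adjacent_expand[OF D A i G L])
  moreover have "approximates H F"
    unfolding approximates_def
  proof (intro allI ballI)
    fix j v assume v: "v \<in> F j"
    have "1 \<le> i" using i by simp
    then show "\<exists>u. (\<forall>m. u m \<in> H m j) \<and> u \<longlonglongrightarrow> v"
    proof (cases rule: index_cases[of i j])
      case 1
      then have "v \<in> collapse i F j" using v by (simp add: collapse_def)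
      then have "\<exists>u. (\<forall>m. u m \<in> G m j) \<and> u \<longlonglongrightarrow> v" using appr unfolding approximates_def by blast
      then show ?thesis using 1 by (simp add: H_def expand_def)
    next
      case 2
      have sF: "vec.span (F (i - 1)) = F (i - 1)" using FD(1) by (simp add: vec.span_eq_iff)
      obtain d where "v - d *s x \<in> vec.span (F (i - 1))"
        using v 2 Fi vec.span_breakdown_eq by blast
      then have "v - d *s x \<in> collapse i F (i - 1)" unfolding sF using i1(3) by (simp add: collapse_def)
      then obtain u where u: "\<And>m. u m \<in> G m (i - 1)" "u \<longlonglongrightarrow> v - d *s x"
        using appr unfolding approximates_def by blast
      have "u m + d *s y m \<in> L m" for m
        using L(3)[of m] u(1)[of m] vec.span_base[of "y m" "insert (y m) (G m (i - 1))"]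
          vec.subspace_add[OF L(1)] vec.subspace_scale[OF L(1)] by (auto simp: L_def)
      moreover have "(\<lambda>m. u m + d *s y m) \<longlonglongrightarrow> (v - d *s x) + d *s x"
      proof (intro tendsto_add u(2) vec_tendstoI)
        fix r show "(\<lambda>m. (d *s y m) $ r) \<longlonglongrightarrow> (d *s x) $ r"
          unfolding vector_smult_component by (intro tendsto_intros tendsto_vec_nth ylim)
      qed
      ultimately show ?thesis using 2 by (intro exI[of _ "\<lambda>m. u m + d *s y m"]) (simp add: H_def expand_def)
    next
      case (3 l)
      then show ?thesis using lift[OF 3(2), of v] v by (simp add: H_def expand_def)
    qed
  qed
  ultimately show ?thesis by blast
qed

lemma cup_variety_approximated:
  "diagram n k B M \<Longrightarrow> n - k \<le> A \<Longrightarrow> k \<le> K \<Longrightarrow> F \<in> cup_variety n k B M \<Longrightarrow>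
    \<exists>G. (\<forall>m. G m \<in> p_cell n k B) \<and> approximates G F"
proof (induction arbitrary: F rule: diagram.induct)
  case (nested k n)
  then have "F \<in> p_cell n k {n - k + 1..n}" using nested_cell_eq by simp
  moreover have "approximates (\<lambda>m. F) F" unfolding approximates_def
  proof (intro allI ballI)
    fix j v assume "v \<in> F j"
    then show "\<exists>u. (\<forall>m::nat. u m \<in> F j) \<and> u \<longlonglongrightarrow> v" by (intro exI[of _ "\<lambda>_. v"]) simp
  qed
  ultimately show ?case by (intro exI[of _ "\<lambda>m. F"] conjI allI)
next
  case (adjacent n k B M i)
  have nk: "2 * k \<le> n" "B \<subseteq> {1..n}" "card B = k" using diagram_set[OF adjacent.hyps(1)] by auto
  have A: "n - k < A" "k < K" and A': "n - k \<le> A" "k \<le> K" using adjacent.prems(1,2) nk by simp_all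
  have dims: "n + 2 - (k + 1) = Suc (n - k)" "k + 1 = Suc k" using nk by simp_all
  have "F \<in> Y (n + 2 - (k + 1)) (k + 1)" using adjacent.prems(3) unfolding cup_variety_def by blast
  then have FY: "F \<in> Y (Suc (n - k)) (Suc k)" unfolding dims(1) unfolding dims(2) .
  have F: "N ` F (i + 1) \<subseteq> F (i - 1)" "collapse i F \<in> cup_variety n k B M"
    using adjacent.prems(3) cup_variety_adjacent_iff[OF adjacent.hyps(1) A adjacent.hyps(2) FY] by blast+
  obtain G where G: "\<And>m. G m \<in> p_cell n k B" "approximates G (collapse i F)"
    using adjacent.IH[OF A' F(2)] by blast
  show ?case
    by (rule approximates_expand[OF nk adjacent.hyps(1) A adjacent.hyps(2) FY F(1) G])
qed

section \<open>Attracting cells\<close>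

lemma dim_U': "vec.dim (U a b) = min a A + min b K"
  using dim_U[of "min a A" "min b K"] U_min[of a b] by simp

lemma U_sum_p:
  assumes S: "vec.subspace S" "S \<inter> U A 0 = U t 0" "S \<subseteq> U A b" and d: "t \<le> A" "vec.dim S = t + b"
  shows "{x + y |x y. x \<in> S \<and> y \<in> U A 0} = U A b"
proof (rule vec_subspace_eqI)
  show "vec.subspace {x + y |x y. x \<in> S \<and> y \<in> U A 0}" by (rule vec.subspace_sums[OF S(1) subspace_U])
  show "vec.subspace (U A b)" by (rule subspace_U)
  show "{x + y |x y. x \<in> S \<and> y \<in> U A 0} \<subseteq> U A b"
    using S(3) U_mono[of A A 0 b] vec.subspace_add[OF subspace_U] by blast
  have "vec.dim {x + y |x y. x \<in> S \<and> y \<in> U A 0} + vec.dim (S \<inter> U A 0) = vec.dim S + vec.dim (U A 0)"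
    by (rule vec.dim_sums_Int[OF S(1) subspace_U])
  then have "vec.dim {x + y |x y. x \<in> S \<and> y \<in> U A 0} = A + b" using d by (simp add: S(2) dim_U')
  then show "vec.dim (U A b) \<le> vec.dim {x + y |x y. x \<in> S \<and> y \<in> U A 0}" by (simp add: dim_U')
qed

text \<open>\<open>F j\<close> meets the first block in an initial segment, and its image in the second block is an
  initial segment, too. The latter is expressed by the upper bound \<open>U A b\<close>, which is attained by the
  sum of \<open>F j\<close> and the first block for dimension reasons.\<close>
lemma flag_jordan_type:
  assumes F: "F \<in> Y A K" and j: "j \<le> A + K"
  shows "\<exists>t b. t \<le> A \<and> b \<le> K \<and> t + b = j \<and> F j \<inter> U A 0 = U t 0 \<and> F j \<subseteq> U A b"
  using j
proof (induction j)
  case 0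
  have "F 0 = {0}" using Y_D(7)[OF F] by simp
  then have "F 0 \<inter> U A 0 = U 0 0" "F 0 \<subseteq> U A 0" using vec.subspace_0[OF subspace_U] U_0_0 by auto
  then show ?case by (intro exI[of _ 0]) simp
next
  case (Suc j)
  note FD = Y_D[OF F order_refl order_refl]
  obtain t b where tb: "t \<le> A" "b \<le> K" "t + b = j" "F j \<inter> U A 0 = U t 0" "F j \<subseteq> U A b"
    using Suc by auto
  have dj: "vec.dim (F j) = t + b" "vec.dim (F (Suc j)) = Suc (t + b)" using FD(3) Suc.prems tb(3) by simp_all
  have S: "vec.subspace (F (Suc j) \<inter> U A 0)" by (rule vec.subspace_inter[OF FD(1) subspace_U])
  have mono: "F j \<subseteq> F (Suc j)" by (rule FD(4)) simp
  have lo: "U t 0 \<subseteq> F (Suc j) \<inter> U A 0" using tb(4) mono by blast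
  have hi: "F (Suc j) \<inter> U A 0 \<subseteq> U (Suc t) 0"
  proof
    fix v assume v: "v \<in> F (Suc j) \<inter> U A 0"
    then have "N v \<in> F j \<inter> U A 0" using FD(5)[of j] N_U_stable[of v A 0] by blast
    then have "v \<in> {v \<in> U A 0. N v \<in> U t 0}" using tb(4) v by blast
    then have "v \<in> U (min A (Suc t)) (min 0 (Suc 0))" unfolding U_preimage1 .
    then show "v \<in> U (Suc t) 0" using U_mono[of "min A (Suc t)" "Suc t" "min 0 (Suc 0)" 0] by auto
  qed
  have sum: "{x + y |x y. x \<in> F j \<and> y \<in> U A 0} = U A b"
    by (rule U_sum_p[OF FD(1) tb(4,5,1) dj(1)])
  \<comment> \<open>Either the image in the second block grows or the intersection with the first one.\<close>
  show ?case
  proof (cases "vec.dim (F (Suc j) \<inter> U A 0) \<le> t")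
    case True
    have e: "F (Suc j) \<inter> U A 0 = U t 0"
      by (rule vec_subspace_eqI[symmetric, OF subspace_U S lo]) (use True tb(1) in \<open>simp add: dim_U'\<close>)
    have sub: "F (Suc j) \<subseteq> U A (Suc b)"
    proof
      fix v assume v: "v \<in> F (Suc j)"
      then have "v \<in> {v \<in> U A K. N v \<in> U A b}" using FD(2)[of "Suc j"] FD(5)[of j] tb(5) by blast
      then have "v \<in> U (min A (Suc A)) (min K (Suc b))" unfolding U_preimage1 .
      then show "v \<in> U A (Suc b)" using U_mono[of "min A (Suc A)" A "min K (Suc b)" "Suc b"] by auto
    qed
    have dS: "vec.dim (F (Suc j)) = t + Suc b" using dj(2) by simp
    have "{x + y |x y. x \<in> F (Suc j) \<and> y \<in> U A 0} = U A (Suc b)"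
      by (rule U_sum_p[OF FD(1) e sub tb(1) dS])
    then have "vec.dim (U A (Suc b)) + vec.dim (F (Suc j) \<inter> U A 0) = vec.dim (F (Suc j)) + vec.dim (U A 0)"
      using vec.dim_sums_Int[OF FD(1)[of "Suc j"] subspace_U[of A 0]] by simp
    then have "Suc b \<le> K" using dS e tb(1) by (simp add: dim_U' min_def split: if_splits)
    then show ?thesis using e sub tb(1,3) by (intro exI[of _ t] exI[of _ "Suc b"]) simp
  next
    case False
    then have t': "Suc t \<le> vec.dim (F (Suc j) \<inter> U A 0)" by simp
    also have "\<dots> \<le> vec.dim (U A 0)" by (rule vec.dim_subset) simp
    finally have tA: "Suc t \<le> A" by (simp add: dim_U')
    have e: "F (Suc j) \<inter> U A 0 = U (Suc t) 0"
      by (rule vec_subspace_eqI[OF S subspace_U hi]) (use t' tA in \<open>simp add: dim_U'\<close>)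
    let ?T = "{x + y |x y. x \<in> F (Suc j) \<and> y \<in> U A 0}"
    have "vec.dim ?T + vec.dim (F (Suc j) \<inter> U A 0) = vec.dim (F (Suc j)) + vec.dim (U A 0)"
      by (rule vec.dim_sums_Int[OF FD(1) subspace_U])
    then have "vec.dim ?T = A + b" using dj(2) e tA by (simp add: dim_U')
    moreover have "U A b \<subseteq> ?T" unfolding sum[symmetric] using mono by blast
    ultimately have "U A b = ?T"
      using tb(2) by (intro vec_subspace_eqI[OF subspace_U vec.subspace_sums[OF FD(1) subspace_U]]) (simp_all add: dim_U')
    moreover have "F (Suc j) \<subseteq> ?T"
    proof
      fix v assume "v \<in> F (Suc j)"
      then have "v = v + 0 \<and> v \<in> F (Suc j) \<and> 0 \<in> U A 0" using vec.subspace_0[OF subspace_U] by simp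
      then show "v \<in> ?T" by blast
    qed
    ultimately have "F (Suc j) \<subseteq> U A b" by blast
    then show ?thesis using e tA tb(2,3) by (intro exI[of _ "Suc t"] exI[of _ b]) simp
  qed
qed

lemma flag_jordan_type_sum:
  assumes F: "F \<in> Y A K"
  shows "\<exists>t b. t \<le> A \<and> b \<le> K \<and> t + b = min j (A + K) \<and> F j \<inter> U A 0 = U t 0 \<and>
    (\<forall>v\<in>U A b. \<exists>x y. v = x + y \<and> x \<in> F j \<and> y \<in> U A 0)"
proof -
  note FD = Y_D[OF F order_refl order_refl]
  have Fj: "F j = F (min j (A + K))" using FD(6)[of j] FD(6)[of "A + K"] by (auto simp: min_def)
  obtain t b where tb: "t \<le> A" "b \<le> K" "t + b = min j (A + K)" "F j \<inter> U A 0 = U t 0" "F j \<subseteq> U A b"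
    using flag_jordan_type[OF F, of "min j (A + K)"] unfolding Fj[symmetric] by auto
  have d: "vec.dim (F j) = t + b" using FD(3)[of j] tb(3) by simp
  have "{x + y |x y. x \<in> F j \<and> y \<in> U A 0} = U A b" by (rule U_sum_p[OF FD(1) tb(4,5,1) d])
  then have "\<forall>v\<in>U A b. \<exists>x y. v = x + y \<and> x \<in> F j \<and> y \<in> U A 0" by blast
  then show ?thesis using tb by blast
qed

lemma U_inject:
  assumes "U t b = U t' b'" "t \<le> A" "t' \<le> A"
  shows "t = t'"
proof -
  have "U t 0 = U t' 0" using arg_cong[OF assms(1), of "\<lambda>S. S \<inter> U A 0"] assms(2,3) by (simp add: U_Int min_absorb1)
  then have "vec.dim (U t 0) = vec.dim (U t' 0)" by simp
  then show ?thesis using assms(2,3) by (simp add: dim_U')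
qed

end

locale two_jordan_blocks_action = two_jordan_blocks A K p q N
  for A K :: nat and p q :: "nat \<Rightarrow> complex ^ 'm::finite" and N :: "complex ^ 'm \<Rightarrow> complex ^ 'm" +
  fixes act :: "complex \<Rightarrow> complex ^ 'm \<Rightarrow> complex ^ 'm"
  assumes lin_act: "\<And>t. t \<noteq> 0 \<Longrightarrow> Vector_Spaces.linear (*s) (*s) (act t)"
    and act_p: "\<And>t i. t \<noteq> 0 \<Longrightarrow> i \<in> {1..A} \<Longrightarrow> act t (p i) = inverse t *s p i"
    and act_q: "\<And>t i. t \<noteq> 0 \<Longrightarrow> i \<in> {1..K} \<Longrightarrow> act t (q i) = t *s q i"
begin

lemma act_induct:
  assumes v: "v \<in> W" and sub: "vec.subspace {v. P v}"
    and p: "\<And>i. i \<in> {1..A} \<Longrightarrow> P (p i)" and q: "\<And>i. i \<in> {1..K} \<Longrightarrow> P (q i)"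
  shows "P v"
proof -
  have "basis \<subseteq> {v. P v}" using p q unfolding basis_def by blast
  then have "W \<subseteq> {v. P v}" unfolding W_def by (rule vec.span_minimal[OF _ sub])
  then show ?thesis using v by blast
qed

lemma act_W:
  assumes t: "t \<noteq> 0" and v: "v \<in> W"
  shows "act t v \<in> W" "N (act t v) = act t (N v)" "act (inverse t) (act t v) = v"
proof -
  interpret a: Vector_Spaces.linear "(*s)" "(*s)" "act t" by (rule lin_act[OF t])
  interpret b: Vector_Spaces.linear "(*s)" "(*s)" "act (inverse t)" by (rule lin_act) (use t in simp)
  let ?P = "\<lambda>v. act t v \<in> W \<and> N (act t v) = act t (N v) \<and> act (inverse t) (act t v) = v"
  have "?P v"
  proof (rule act_induct[OF v])
    show "vec.subspace {v. ?P v}"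
      by (simp add: vec.subspace_def a.add a.scale b.add b.scale N.add N.scale W_closed a.zero b.zero N.zero)
    fix i
    show "?P (p i)" if i: "i \<in> {1..A}"
    proof (intro conjI)
      have e: "act t (p i) = inverse t *s p i" by (rule act_p[OF t i])
      show "act t (p i) \<in> W" using basis_in_W(1)[of i] i by (simp add: e W_closed)
      show "act (inverse t) (act t (p i)) = p i" using t act_p[OF _ i, of "inverse t"] by (simp add: e b.scale)
      show "N (act t (p i)) = act t (N (p i))"
      proof (cases "i = 1")
        case True then show ?thesis using e Np[OF i] p0 by (simp add: N.scale a.zero)
      next
        case False
        then have "i - 1 \<in> {1..A}" using i by auto
        then show ?thesis using e Np[OF i] act_p[OF t] by (simp add: N.scale)
      qed
    qed
    show "?P (q i)" if i: "i \<in> {1..K}"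
    proof (intro conjI)
      have e: "act t (q i) = t *s q i" by (rule act_q[OF t i])
      show "act t (q i) \<in> W" using basis_in_W(2)[of i] i by (simp add: e W_closed)
      show "act (inverse t) (act t (q i)) = q i" using t act_q[OF _ i, of "inverse t"] by (simp add: e b.scale)
      show "N (act t (q i)) = act t (N (q i))"
      proof (cases "i = 1")
        case True then show ?thesis using e Nq[OF i] q0 by (simp add: N.scale a.zero)
      next
        case False
        then have "i - 1 \<in> {1..K}" using i by auto
        then show ?thesis using e Nq[OF i] act_q[OF t] by (simp add: N.scale)
      qed
    qed
  qed
  then show "act t v \<in> W" "N (act t v) = act t (N v)" "act (inverse t) (act t v) = v" by blast+
qed

lemma act_p_part:
  assumes t: "t \<noteq> 0" and v: "v \<in> U A 0"
  shows "act t v = inverse t *s v"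
proof -
  interpret a: Vector_Spaces.linear "(*s)" "(*s)" "act t" by (rule lin_act[OF t])
  have "vec.subspace {v. act t v = inverse t *s v}"
    by (simp add: vec.subspace_def a.add a.scale a.zero vec.scale_right_distrib mult.commute)
  moreover have "p ` {1..A} \<union> q ` {1..0} \<subseteq> {v. act t v = inverse t *s v}" using act_p[OF t] by auto
  ultimately have "vec.span (p ` {1..A} \<union> q ` {1..0}) \<subseteq> {v. act t v = inverse t *s v}"
    by (intro vec.span_minimal)
  then show ?thesis using v U_eq_span[of A 0] by blast
qed

lemma act_subspace:
  assumes t: "t \<noteq> 0" and S: "vec.subspace S" "S \<subseteq> W"
  shows "vec.subspace (act t ` S)" "act t ` S \<subseteq> W" "vec.dim (act t ` S) = vec.dim S"
proof -
  interpret a: Vector_Spaces.linear "(*s)" "(*s)" "act t" by (rule lin_act[OF t])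
  show "vec.subspace (act t ` S)" using S(1) by (rule a.subspace_image)
  show "act t ` S \<subseteq> W" using act_W(1)[OF t] S(2) by blast
  have inj: "inj_on (act t) S"
    by (rule inj_on_inverseI[of _ "act (inverse t)"]) (use act_W(3)[OF t] S(2) in blast)
  have sS: "vec.span S = S" using S(1) by (simp add: vec.span_eq_iff)
  have "inj_on (act t) (vec.span S)" unfolding sS by (rule inj)
  then show "vec.dim (act t ` S) = vec.dim S" by (rule vec.dim_image_eq[OF lin_act[OF t]])
qed

lemma act_Y:
  assumes t: "t \<noteq> 0" and F: "F \<in> Y A K"
  shows "(\<lambda>i. act t ` F i) \<in> Y A K"
proof -
  note FD = Y_D[OF F order_refl order_refl]
  have FW: "F i \<subseteq> W" for i using FD(2)[of i] by (simp add: W_eq_U)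
  have "(\<lambda>i. act t ` F i) \<in> flags (A + K) (U A K)"
    unfolding flags_def mem_Collect_eq
  proof (intro conjI allI)
    fix i
    show "vec.subspace (act t ` F i)" by (rule act_subspace(1)[OF t FD(1) FW])
    show "act t ` F i \<subseteq> U A K" using act_subspace(2)[OF t FD(1) FW] by (simp add: W_eq_U)
    show "vec.dim (act t ` F i) = min i (A + K)" using act_subspace(3)[OF t FD(1) FW] FD(3) by simp
    show "act t ` F i \<subseteq> act t ` F (Suc i)" by (intro image_mono FD(4)) simp
  qed
  moreover have "N ` act t ` F (Suc i) \<subseteq> act t ` F i" for i
  proof clarify
    fix v assume v: "v \<in> F (Suc i)"
    then have "N (act t v) = act t (N v)" using act_W(2)[OF t] FW by blast
    moreover have "N v \<in> F i" using FD(5)[of i] v by blast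
    ultimately show "N (act t v) \<in> act t ` F i" by blast
  qed
  ultimately show ?thesis using Y_iff[OF order_refl order_refl] by blast
qed

lemma eventually_at_infinity_nonzero: "\<forall>\<^sub>F t :: complex in at_infinity. t \<noteq> 0"
  unfolding eventually_at_infinity by (intro exI[of _ 1]) auto

text \<open>As \<open>t\<close> tends to infinity the second block dominates, so that a subspace tends to the sum of
  its part in the first block and its projection to the second.\<close>
lemma act_limit:
  assumes S: "vec.subspace S" "S \<subseteq> W" and tb: "a \<le> A" "b \<le> K" "vec.dim S = a + b"
    and p: "S \<inter> U A 0 = U a 0" and q: "\<And>v. v \<in> U A b \<Longrightarrow> \<exists>x y. v = x + y \<and> x \<in> S \<and> y \<in> U A 0"
  shows "((\<lambda>t. closest_point (act t ` S) v) \<longlongrightarrow> closest_point (U a b) v) at_infinity"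
proof (rule closest_point_tendsto)
  show "subspace (U a b)" by (rule subspace_of_vec_subspace[OF subspace_U])
  show "\<forall>\<^sub>F t in at_infinity. subspace (act t ` S) \<and> dim (act t ` S) = dim (U a b)"
    using eventually_at_infinity_nonzero
  proof eventually_elim
    case (elim t)
    note s = act_subspace[OF elim S]
    have "vec.dim (act t ` S) = vec.dim (U a b)" using s(3) tb dim_U[OF tb(1,2)] by simp
    then show ?case using dim_eq_of_vec_dim_eq[OF subspace_U s(1)] subspace_of_vec_subspace[OF s(1)] by blast
  qed
next
  let ?L = "{x. \<exists>u. (\<forall>\<^sub>F t in at_infinity. u t \<in> act t ` S) \<and> (u \<longlongrightarrow> x) at_infinity}"
  have scale: "((\<lambda>t. f t *s x) \<longlongrightarrow> c *s x) Z" if "(f \<longlongrightarrow> c) Z" for f :: "complex \<Rightarrow> complex" and c and x :: "complex ^ 'm" and Z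
    by (rule vec_tendstoI) (simp add: that tendsto_mult_right)
  have scale2: "((\<lambda>t. c *s u t) \<longlongrightarrow> c *s x) Z" if "(u \<longlongrightarrow> x) Z" for u and c and x :: "complex ^ 'm" and Z :: "complex filter"
    by (rule vec_tendstoI) (simp add: tendsto_mult_left tendsto_vec_nth[OF that])
  have L: "vec.subspace ?L"
    unfolding vec.subspace_def
  proof (intro conjI ballI allI)
    show "0 \<in> ?L"
    proof -
      have "\<forall>\<^sub>F t in at_infinity. 0 \<in> act t ` S"
        using eventually_at_infinity_nonzero
        by eventually_elim (use act_subspace(1)[OF _ S] vec.subspace_0 in blast)
      then show ?thesis by (intro CollectI exI[of _ "\<lambda>_. 0"]) simp
    qed
    fix x y c assume x: "x \<in> ?L"
    then obtain u where u: "\<forall>\<^sub>F t in at_infinity. u t \<in> act t ` S" "(u \<longlongrightarrow> x) at_infinity" by blast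
    show "c *s x \<in> ?L"
    proof -
      have "\<forall>\<^sub>F t in at_infinity. c *s u t \<in> act t ` S"
        using eventually_at_infinity_nonzero u(1)
        by eventually_elim (use act_subspace(1)[OF _ S] vec.subspace_scale in blast)
      then show ?thesis using scale2[OF u(2), of c] by (intro CollectI exI[of _ "\<lambda>t. c *s u t"] conjI)
    qed
    assume "y \<in> ?L"
    then obtain w where w: "\<forall>\<^sub>F t in at_infinity. w t \<in> act t ` S" "(w \<longlongrightarrow> y) at_infinity" by blast
    have "\<forall>\<^sub>F t in at_infinity. u t + w t \<in> act t ` S"
      using eventually_at_infinity_nonzero u(1) w(1)
      by eventually_elim (use act_subspace(1)[OF _ S] vec.subspace_add in blast)
    then show "x + y \<in> ?L" using tendsto_add[OF u(2) w(2)] by (intro CollectI exI[of _ "\<lambda>t. u t + w t"] conjI)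
  qed
  have "p i \<in> ?L" if i: "i \<in> {1..a}" for i
  proof -
    have iA: "i \<in> {1..A}" using i tb(1) by simp
    have "p i \<in> U a 0" using i iA by (intro p_in_U) simp_all
    then have pS: "p i \<in> S" using p by blast
    have "\<forall>\<^sub>F t in at_infinity. p i \<in> act t ` S"
      using eventually_at_infinity_nonzero
    proof eventually_elim
      case (elim t)
      interpret a: Vector_Spaces.linear "(*s)" "(*s)" "act t" by (rule lin_act[OF elim])
      have "act t (t *s p i) = p i" using act_p[OF elim iA] elim by (simp add: a.scale)
      moreover have "t *s p i \<in> S" using pS by (rule vec.subspace_scale[OF S(1)])
      ultimately show ?case by (metis image_eqI)
    qed
    then show ?thesis by (intro CollectI exI[of _ "\<lambda>_. p i"]) simp
  qed
  moreover have "q i \<in> ?L" if i: "i \<in> {1..b}" for i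
  proof -
    have iK: "i \<in> {1..K}" using i tb(2) by simp
    have "q i \<in> U A b" using i iK by (intro q_in_U) simp_all
    then obtain x y where xy: "q i = x + y" "x \<in> S" "y \<in> U A 0" using q by blast
    let ?u = "\<lambda>t. q i - (inverse t * inverse t) *s y"
    have "\<forall>\<^sub>F t in at_infinity. ?u t \<in> act t ` S"
      using eventually_at_infinity_nonzero
    proof eventually_elim
      case (elim t)
      interpret a: Vector_Spaces.linear "(*s)" "(*s)" "act t" by (rule lin_act[OF elim])
      have "x = q i - y" using xy(1) by simp
      then have "act t (inverse t *s x) = ?u t"
        using act_q[OF elim iK] act_p_part[OF elim xy(3)] elim
        by (simp add: a.scale a.diff vec.scale_right_diff_distrib)
      moreover have "inverse t *s x \<in> S" using xy(2) by (rule vec.subspace_scale[OF S(1)])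
      ultimately show ?case by (metis image_eqI)
    qed
    moreover have "(?u \<longlongrightarrow> q i - (0 * 0) *s y) at_infinity"
      by (intro tendsto_diff tendsto_const scale tendsto_mult tendsto_inverse_0)
    ultimately show ?thesis by (intro CollectI exI[of _ ?u]) simp
  qed
  ultimately have "p ` {1..a} \<union> q ` {1..b} \<subseteq> ?L" by blast
  then have "U a b \<subseteq> ?L" unfolding U_eq_span[OF tb(1,2)] by (rule vec.span_minimal[OF _ L])
  then show "\<exists>u. (\<forall>\<^sub>F t in at_infinity. u t \<in> act t ` S) \<and> (u \<longlongrightarrow> x) at_infinity" if "x \<in> U a b" for x
    using that by blast
qed

definition fixed :: "nat set \<Rightarrow> 'm flag" where
  "fixed B j = U (top_upto (A + K) B j) (bot_upto B j)"

lemma fixed_Y: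
  assumes B: "B \<subseteq> {1..A + K}" "card B = K"
  shows "fixed B \<in> Y A K"
proof -
  have fin: "finite B" using B(1) finite_subset by blast
  have le: "top_upto (A + K) B j \<le> A" "bot_upto B j \<le> K" for j using top_upto_le[OF B(1)] bot_upto_le[OF fin] B(2) by auto
  have mono: "top_upto (A + K) B j \<le> top_upto (A + K) B (Suc j)" "bot_upto B j \<le> bot_upto B (Suc j)" for j
    unfolding top_upto_def bot_upto_def by (rule card_mono, use fin in auto)+
  have "top_upto (A + K) B (Suc j) + bot_upto B (Suc j) \<le> Suc (top_upto (A + K) B j + bot_upto B j)" for j
    using top_upto_plus_bot_upto[OF B(1)] by simp
  note grow = this
  have step: "top_upto (A + K) B (Suc j) - 1 \<le> top_upto (A + K) B j" "bot_upto B (Suc j) - 1 \<le> bot_upto B j" for j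
    using grow[of j] mono[of j] by linarith+
  have "fixed B \<in> flags (A + K) (U A K)"
    unfolding flags_def mem_Collect_eq
  proof (intro conjI allI)
    fix j
    show "vec.subspace (fixed B j)" by (simp add: fixed_def subspace_U)
    show "fixed B j \<subseteq> U A K" unfolding fixed_def by (rule U_mono[OF le])
    show "vec.dim (fixed B j) = min j (A + K)" using top_upto_plus_bot_upto[OF B(1), of j] dim_U[OF le] by (simp add: fixed_def)
    show "fixed B j \<subseteq> fixed B (Suc j)" unfolding fixed_def by (rule U_mono[OF mono])
  qed
  moreover have "N ` fixed B (Suc j) \<subseteq> fixed B j" for j
    unfolding fixed_def using N_U U_mono[OF step[of j]] by blast
  ultimately show ?thesis using Y_iff[OF order_refl order_refl] by blast
qed

text \<open>Each space of the flag tends to some \<open>U t b\<close> with \<open>t + b\<close> its dimension. Limits being unique, the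
  limit is the fixed flag if and only if \<open>t\<close> is the number of top entries.\<close>
lemma cell_eq_p_cell:
  assumes B: "B \<subseteq> {1..A + K}" "card B = K"
  shows "cell (A + K) W N act (fixed B) = p_cell (A + K) K B"
proof (rule set_eqI)
  fix F
  have fin: "finite B" using B(1) finite_subset by blast
  have le: "top_upto (A + K) B j \<le> A" "bot_upto B j \<le> K" for j using top_upto_le[OF B(1)] bot_upto_le[OF fin] B(2) by auto
  have Yeq: "springer_fiber (A + K) W N = Y A K" by (simp add: Y_def W_eq_U)
  have Yf: "Y A K \<subseteq> flags (A + K) W" unfolding Yeq[symmetric] springer_fiber_def by blast
  have ev: "\<forall>\<^sub>F t in at_infinity. (\<lambda>i. act t ` F i) \<in> Y A K" if F: "F \<in> Y A K"
    using eventually_at_infinity_nonzero by eventually_elim (rule act_Y[OF _ F])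
  have "F \<in> cell (A + K) W N act (fixed B) \<longleftrightarrow> F \<in> Y A K \<and>
    limitin (flag_topology (A + K) W) (\<lambda>t i. act t ` F i) (fixed B) at_infinity"
    unfolding cell_def Yeq limitin_subtopology mem_Collect_eq using fixed_Y[OF B] ev by blast
  also have "\<dots> \<longleftrightarrow> F \<in> Y A K \<and> (\<forall>i x. ((\<lambda>t. closest_point (act t ` F i) x) \<longlongrightarrow> closest_point (fixed B i) x) at_infinity)"
  proof (cases "F \<in> Y A K")
    case True
    have "\<forall>\<^sub>F t in at_infinity. (\<lambda>i. act t ` F i) \<in> flags (A + K) W"
      using ev[OF True] by eventually_elim (use Yf in blast)
    moreover have "fixed B \<in> flags (A + K) W" using fixed_Y[OF B] Yf by blast
    ultimately show ?thesis unfolding limitin_flag_topology_iff by blast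
  qed simp
  also have "\<dots> \<longleftrightarrow> F \<in> Y A K \<and> (\<forall>i. F i \<inter> U A 0 = U (top_upto (A + K) B i) 0)"
  proof (rule conj_cong[OF refl], rule all_cong1)
    fix i
    assume F: "F \<in> Y A K"
    note FD = Y_D[OF F order_refl order_refl]
    obtain t b where tb: "t \<le> A" "b \<le> K" "t + b = min i (A + K)" "F i \<inter> U A 0 = U t 0"
      "\<forall>v\<in>U A b. \<exists>x y. v = x + y \<and> x \<in> F i \<and> y \<in> U A 0"
      using flag_jordan_type_sum[OF F, of i] by blast
    have FW: "F i \<subseteq> W" using FD(2)[of i] by (simp add: W_eq_U)
    have d: "vec.dim (F i) = t + b" using FD(3)[of i] tb(3) by simp
    have lim: "((\<lambda>t. closest_point (act t ` F i) x) \<longlongrightarrow> closest_point (U t b) x) at_infinity" for x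
      by (rule act_limit[OF FD(1) FW tb(1,2) d tb(4)]) (rule bspec[OF tb(5)])
    show "(\<forall>x. ((\<lambda>t. closest_point (act t ` F i) x) \<longlongrightarrow> closest_point (fixed B i) x) at_infinity)
      \<longleftrightarrow> F i \<inter> U A 0 = U (top_upto (A + K) B i) 0"
    proof
      assume h: "\<forall>x. ((\<lambda>t. closest_point (act t ` F i) x) \<longlongrightarrow> closest_point (fixed B i) x) at_infinity"
      have eq: "closest_point (U t b) x = closest_point (fixed B i) x" for x
        by (rule tendsto_unique[OF trivial_limit_at_infinity lim h[rule_format]])
      have s: "subspace (U a c)" for a c by (rule subspace_of_vec_subspace[OF subspace_U])
      have mem: "x \<in> U a c \<longleftrightarrow> closest_point (U a c) x = x" for x a c
        using s[of a c] closed_subspace[OF s[of a c]] subspace_0[OF s[of a c]]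
        by (intro closest_point_refl[symmetric]) auto
      have "U t b = U (top_upto (A + K) B i) (bot_upto B i)"
      proof (rule set_eqI)
        fix x
        show "x \<in> U t b \<longleftrightarrow> x \<in> U (top_upto (A + K) B i) (bot_upto B i)"
          unfolding mem[of x t b] mem[of x "top_upto (A + K) B i"] eq[unfolded fixed_def] by (rule refl)
      qed
      then have "t = top_upto (A + K) B i" using U_inject tb(1) le(1) by blast
      then show "F i \<inter> U A 0 = U (top_upto (A + K) B i) 0" using tb(4) by simp
    next
      assume "F i \<inter> U A 0 = U (top_upto (A + K) B i) 0"
      then have t: "t = top_upto (A + K) B i" using U_inject[of t 0 "top_upto (A + K) B i" 0] tb(1,4) le(1)[of i] by simp
      then have "b = bot_upto B i" using top_upto_plus_bot_upto[OF B(1), of i] tb(3) by simp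
      then have "fixed B i = U t b" using t by (simp add: fixed_def)
      then show "\<forall>x. ((\<lambda>t. closest_point (act t ` F i) x) \<longlongrightarrow> closest_point (fixed B i) x) at_infinity"
        using lim by simp
    qed
  qed
  also have "\<dots> \<longleftrightarrow> F \<in> p_cell (A + K) K B" by (simp add: p_cell_def)
  finally show "F \<in> cell (A + K) W N act (fixed B) \<longleftrightarrow> F \<in> p_cell (A + K) K B" .
qed

end

lemma closedin_Collect_ball:
  assumes "\<And>c. c \<in> I \<Longrightarrow> closedin X {F \<in> topspace X. P c F}"
  shows "closedin X {F \<in> topspace X. \<forall>c\<in>I. P c F}"
proof -
  have "closedin X (\<Inter>(insert (topspace X) ((\<lambda>c. {F \<in> topspace X. P c F}) ` I)))"
    by (rule closedin_Inter) (use assms in auto)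
  moreover have "\<Inter>(insert (topspace X) ((\<lambda>c. {F \<in> topspace X. P c F}) ` I)) = {F \<in> topspace X. \<forall>c\<in>I. P c F}"
    by auto
  ultimately show ?thesis by simp
qed

section \<open>Rays\<close>

text \<open>No ray starts inside a cup, so that every cup lies on one side of a given ray. Hence \<open>w\<close> and its
  standardization have the same counts there, and on either side there are at least as many \<open>\<and>\<close> as
  \<open>\<or>\<close>.\<close>
lemma ray_counts:
  assumes D: "diagram n k B M" and j: "j \<in> {1..n} - endpoints M"
  shows "bot_upto (fst ` M) j = bot_upto B j" "top_upto n (fst ` M) j = top_upto n B j"
    "bot_upto B j \<le> top_upto n B j" "k - bot_upto B j \<le> n - k - top_upto n B j"
proof -
  have B: "B \<subseteq> {1..n}" "card B = k" "2 * k \<le> n" using diagram_set[OF D] by auto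
  have finM: "finite M" by (rule diagram_finite[OF D])
  have cardM: "card M = k" using bij_betw_same_card[OF diagram_bij_betw[OF D]] B(2) by simp
  note inj = crossingless_matching_inj[OF diagram_crossingless[OF D]]
  let ?L = "{c \<in> M. fst c \<le> j}"
  have side: "a \<le> j \<longleftrightarrow> b \<le> j" if ab: "(a, b) \<in> M" for a b
  proof
    assume "b \<le> j" then show "a \<le> j" using diagram_cup_bounds[OF D ab] by simp
  next
    assume a: "a \<le> j"
    have nj: "a \<noteq> j" "b \<noteq> j" using j endpointsI[OF ab, of j] by auto
    show "b \<le> j"
    proof (rule ccontr)
      assume "\<not> b \<le> j"
      then have "a < j" "j < b" using a nj by simp_all
      then obtain x y where "(x, y) \<in> M" "j = x \<or> j = y" using diagram_inside_cup[OF D ab] by blast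
      then show False using j endpointsI[of x y M j] by simp
    qed
  qed
  have fstM: "fst ` M \<subseteq> {1..n}"
  proof clarify
    fix a b assume "(a, b) \<in> M"
    from diagram_cup_bounds[OF D this] show "fst (a, b) \<in> {1..n}" by simp
  qed
  have "{x \<in> fst ` M. x \<le> j} = fst ` ?L" by auto
  then have bS: "bot_upto (fst ` M) j = card ?L"
    unfolding bot_upto_def using card_image[OF inj_on_subset[OF inj(1)], of ?L] by simp
  have "{x \<in> B. x \<le> j} = (\<lambda>(a, b). if a \<in> B then a else b) ` ?L"
  proof -
    let ?f = "\<lambda>(a, b). if a \<in> B then a else b"
    have im: "?f ` M = B" using diagram_bij_betw[OF D] by (rule bij_betw_imp_surj_on)
    have f: "?f c \<le> j \<longleftrightarrow> fst c \<le> j" if "c \<in> M" for c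
      using side[of "fst c" "snd c"] that by (cases c) simp
    show ?thesis
    proof (intro equalityI subsetI)
      fix x assume x: "x \<in> {x \<in> B. x \<le> j}"
      then have "x \<in> ?f ` M" unfolding im by simp
      then obtain c where c: "c \<in> M" "x = ?f c" by (rule imageE)
      then show "x \<in> ?f ` ?L" using f[OF c(1)] x by (intro image_eqI[of _ _ c]) simp_all
    next
      fix x assume "x \<in> ?f ` ?L"
      then obtain c where c: "c \<in> ?L" "x = ?f c" by (rule imageE)
      then have cM: "c \<in> M" by simp
      then have "x \<in> ?f ` M" unfolding c(2) by (rule imageI)
      then show "x \<in> {x \<in> B. x \<le> j}" using f[OF cM] c unfolding im by simp
    qed
  qed
  moreover have "inj_on (\<lambda>(a, b). if a \<in> B then a else b) ?L"
    using bij_betw_imp_inj_on[OF diagram_bij_betw[OF D]] by (rule inj_on_subset) simp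
  ultimately have bB: "bot_upto B j = card ?L" unfolding bot_upto_def by (simp add: card_image)
  show 1: "bot_upto (fst ` M) j = bot_upto B j" using bS bB by simp
  show 2: "top_upto n (fst ` M) j = top_upto n B j" using top_upto_plus_bot_upto[OF fstM, of j] top_upto_plus_bot_upto[OF B(1), of j] 1 by simp
  have snd: "snd c \<in> {1..n} - fst ` M" if c: "c \<in> M" for c
  proof -
    obtain a b where ab: "c = (a, b)" by (cases c)
    have "b \<notin> fst ` M"
    proof
      assume "b \<in> fst ` M"
      then obtain d where "(b, d) \<in> M" by auto
      then show False using diagram_disjoint[OF D, of a b b d] diagram_cup_bounds[OF D, of a b] c ab by simp
    qed
    then show ?thesis using diagram_cup_bounds[OF D, of a b] c ab by simp
  qed
  have "card ?L = card (snd ` ?L)" using card_image[OF inj_on_subset[OF inj(2)], of ?L] by simp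
  also have "\<dots> \<le> card {x \<in> {1..n} - fst ` M. x \<le> j}"
  proof (rule card_mono)
    show "snd ` ?L \<subseteq> {x \<in> {1..n} - fst ` M. x \<le> j}"
    proof clarify
      fix a b assume "(a, b) \<in> M" "fst (a, b) \<le> j"
      then show "snd (a, b) \<in> {1..n} - fst ` M \<and> snd (a, b) \<le> j" using snd[of "(a, b)"] side[of a b] by simp
    qed
  qed simp
  finally show 3: "bot_upto B j \<le> top_upto n B j" unfolding bB[symmetric] top_upto_def[symmetric] 2 .
  let ?R = "{c \<in> M. \<not> fst c \<le> j}"
  have "?R = M - ?L" by blast
  then have "card ?R = card M - card ?L" using card_Diff_subset[of ?L M] finM by simp
  then have R: "card ?R = k - bot_upto B j" using cardM bB by simp
  have "card ?R = card (snd ` ?R)" using card_image[OF inj_on_subset[OF inj(2)], of ?R] by simp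
  also have "\<dots> \<le> card ({1..n} - fst ` M - {x \<in> {1..n} - fst ` M. x \<le> j})"
  proof (rule card_mono)
    show "snd ` ?R \<subseteq> {1..n} - fst ` M - {x \<in> {1..n} - fst ` M. x \<le> j}"
    proof clarify
      fix a b assume "(a, b) \<in> M" "\<not> fst (a, b) \<le> j"
      then show "snd (a, b) \<in> {1..n} - fst ` M - {x \<in> {1..n} - fst ` M. x \<le> j}"
        using snd[of "(a, b)"] side[of a b] by simp
    qed
  qed simp
  also have "\<dots> = card ({1..n} - fst ` M) - top_upto n B j"
  proof -
    have "{x \<in> {1..n} - fst ` M. x \<le> j} \<subseteq> {1..n} - fst ` M" by blast
    then show ?thesis
      using card_Diff_subset[of "{x \<in> {1..n} - fst ` M. x \<le> j}" "{1..n} - fst ` M"] 2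
      unfolding top_upto_def[of n "fst ` M"] by simp
  qed
  also have "card ({1..n} - fst ` M) = n - k"
    using card_Diff_subset[OF _ fstM] finM card_image[OF inj(1)] cardM by simp
  finally show "k - bot_upto B j \<le> n - k - top_upto n B j" unfolding R .
qed

section \<open>Closures of cells and components\<close>

context two_jordan_blocks
begin

lemma Npow_image_W: "(N ^^ d) ` W = U (A - d) (K - d)"
proof (induction d)
  case 0 then show ?case by (simp add: W_eq_U)
next
  case (Suc d)
  have "N ` U (A - d) (K - d) = U (A - Suc d) (K - Suc d)"
  proof
    show "N ` U (A - d) (K - d) \<subseteq> U (A - Suc d) (K - Suc d)" using N_U[of _ "A - d" "K - d"] by auto
    have "p i \<in> N ` U (A - d) (K - d)" if "i \<in> {1..A - Suc d}" for i
      using that Np[of "Suc i"] p_in_U[of "Suc i" "A - d" "K - d"] by (intro image_eqI[of _ _ "p (Suc i)"]) auto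
    moreover have "q i \<in> N ` U (A - d) (K - d)" if "i \<in> {1..K - Suc d}" for i
      using that Nq[of "Suc i"] q_in_U[of "Suc i" "K - d" "A - d"] by (intro image_eqI[of _ _ "q (Suc i)"]) auto
    ultimately have "p ` {1..A - Suc d} \<union> q ` {1..K - Suc d} \<subseteq> N ` U (A - d) (K - d)" by blast
    then have "vec.span (p ` {1..A - Suc d} \<union> q ` {1..K - Suc d}) \<subseteq> N ` U (A - d) (K - d)"
      by (rule vec.span_minimal[OF _ N.subspace_image[OF subspace_U]])
    then show "U (A - Suc d) (K - Suc d) \<subseteq> N ` U (A - d) (K - d)" by (simp add: U_eq_span)
  qed
  moreover have "(N ^^ Suc d) ` W = N ` ((N ^^ d) ` W)" by (simp add: image_image)
  ultimately show ?case using Suc by simp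
qed

text \<open>The condition imposed on a component at a ray fixes a subspace spanned by basis vectors.\<close>
lemma ray_space:
  assumes "t \<le> A" "b \<le> K" "b \<le> t" "K - b \<le> A - t"
  shows "{v \<in> W. (N ^^ b) v \<in> (N ^^ (A - t + b)) ` W} = U t b"
proof -
  have "A - (A - t + b) = t - b" "K - (A - t + b) = 0" using assms by linarith+
  then have "(N ^^ (A - t + b)) ` W = U (t - b) 0" using Npow_image_W[of "A - t + b"] by simp
  then have "{v \<in> W. (N ^^ b) v \<in> (N ^^ (A - t + b)) ` W} = {v \<in> U A K. (N ^^ b) v \<in> U (t - b) 0}"
    by (simp add: W_eq_U)
  also have "\<dots> = U (min A (t - b + b)) (min K (0 + b))" by (rule U_preimage)
  finally show ?thesis using assms by (simp add: min_absorb2)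
qed

text \<open>\<open>N\<close> lowers the dimension by at most two, so that the inclusion forces equality. Inclusions, unlike
  equalities, are visibly closed conditions.\<close>
lemma cup_condition_eq_iff:
  assumes F: "F \<in> Y A K" and xy: "1 \<le> x" "x < y" "y \<le> A + K" "odd (y - x)"
  shows "(N ^^ ((y - x + 1) div 2)) ` F y = F (x - 1) \<longleftrightarrow> (N ^^ ((y - x + 1) div 2)) ` F y \<subseteq> F (x - 1)"
proof
  note FD = Y_D[OF F order_refl order_refl]
  let ?d = "(y - x + 1) div 2"
  interpret Nd: Vector_Spaces.linear "(*s)" "(*s)" "N ^^ ?d" by (rule Npow_linear)
  assume sub: "(N ^^ ?d) ` F y \<subseteq> F (x - 1)"
  show "(N ^^ ?d) ` F y = F (x - 1)"
  proof (rule vec_subspace_eqI[OF Nd.subspace_image[OF FD(1)] FD(1) sub])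
    have "2 * ((m + 1) div 2) = m + 1" if "odd m" for m :: nat using that by simp
    then have d: "2 * ?d = y - x + 1" using xy(4) by blast
    have "F y \<subseteq> W" using FD(2) by (simp add: W_eq_U)
    then have "vec.dim (F y) \<le> vec.dim ((N ^^ ?d) ` F y) + 2 * ?d" by (rule dim_Npow_image[OF FD(1)])
    moreover have "vec.dim (F y) = y" "vec.dim (F (x - 1)) = x - 1" using FD(3) xy(2,3) by simp_all
    ultimately show "vec.dim (F (x - 1)) \<le> vec.dim ((N ^^ ?d) ` F y)" using d xy(1,2) by linarith
  qed
qed simp

lemma springer_fiber_W: "springer_fiber (A + K) W N = Y A K"
  by (simp add: Y_def W_eq_U)

lemma closedin_cup_variety:
  assumes B: "B \<subseteq> {1..A + K}" "card B = K"
  shows "closedin (subtopology (flag_topology (A + K) W) (springer_fiber (A + K) W N)) (cup_variety (A + K) K B M)"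
proof -
  let ?X = "flag_topology (A + K) W" and ?S = "springer_fiber (A + K) W N"
  let ?d = "\<lambda>c. (snd c - fst c + 1) div 2"
  have ts: "topspace ?X = flags (A + K) W"
    by (simp add: flag_topology_def topspace_pullback_topology)
  define T1 where "T1 = {F \<in> topspace ?X. \<forall>c\<in>M. (N ^^ ?d c) ` F (snd c) \<subseteq> F (fst c - 1)}"
  define T2 where "T2 = {F \<in> topspace ?X. \<forall>j\<in>{1..A + K} - B - snd ` M. U (top_upto (A + K) B j) (bot_upto B j) \<subseteq> F j}"
  have "closedin ?X T1" "closedin ?X T2"
    unfolding T1_def T2_def unfolding ts
    by (rule closedin_Collect_ball[of _ ?X, unfolded ts],
        rule closedin_flag_incidence[OF Npow_linear] closedin_flag_contains)+
  then have "closedin (subtopology ?X ?S) (?S \<inter> (T1 \<inter> T2))"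
    by (intro closedin_subtopology_Int_closed closedin_Int)
  moreover have "?S \<inter> (T1 \<inter> T2) = cup_variety (A + K) K B M"
  proof (rule set_eqI)
    fix F
    show "F \<in> ?S \<inter> (T1 \<inter> T2) \<longleftrightarrow> F \<in> cup_variety (A + K) K B M"
    proof (cases "F \<in> ?S")
      case True
      then have Ff: "F \<in> flags (A + K) W" by (simp add: springer_fiber_def)
      have FY: "F \<in> Y A K" using True unfolding springer_fiber_W .
      note FD = Y_D[OF FY order_refl order_refl]
      have pt: "U (top_upto (A + K) B j) (bot_upto B j) \<subseteq> F j \<longleftrightarrow> F j = U (top_upto (A + K) B j) (bot_upto B j)" for j
      proof
        assume s: "U (top_upto (A + K) B j) (bot_upto B j) \<subseteq> F j"
        have le: "top_upto (A + K) B j \<le> A" "bot_upto B j \<le> K"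
          using top_upto_le[OF B(1), of j] bot_upto_le[OF finite_subset[OF B(1)], of j] B(2) by simp_all
        show "F j = U (top_upto (A + K) B j) (bot_upto B j)"
          by (rule vec_subspace_eqI[symmetric, OF subspace_U FD(1) s])
            (use FD(3)[of j] top_upto_plus_bot_upto[OF B(1), of j] dim_U[OF le] in simp)
      qed simp
      show ?thesis
        using True Ff FY unfolding T1_def T2_def cup_variety_def ts by (simp add: case_prod_unfold pt)
    qed (simp add: cup_variety_def springer_fiber_W)
  qed
  ultimately show ?thesis by simp
qed

lemma closure_of_p_cell:
  assumes D: "diagram (A + K) K B M"
  shows "subtopology (flag_topology (A + K) W) (springer_fiber (A + K) W N) closure_of p_cell (A + K) K B
    = cup_variety (A + K) K B M"
proof
  let ?X = "flag_topology (A + K) W" and ?S = "springer_fiber (A + K) W N"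
  have B: "B \<subseteq> {1..A + K}" "card B = K" using diagram_set[OF D] by auto
  show "subtopology ?X ?S closure_of p_cell (A + K) K B \<subseteq> cup_variety (A + K) K B M"
    by (rule closure_of_minimal[OF p_cell_subset_cup_variety[OF D] closedin_cup_variety[OF B]]) simp_all
  show "cup_variety (A + K) K B M \<subseteq> subtopology ?X ?S closure_of p_cell (A + K) K B"
  proof
    fix F assume F: "F \<in> cup_variety (A + K) K B M"
    then obtain G where G: "\<And>m. G m \<in> p_cell (A + K) K B" "approximates G F"
      using cup_variety_approximated[OF D, of F] by auto
    have GY: "G m \<in> ?S" for m using G(1)[of m] by (simp add: p_cell_def springer_fiber_W)
    have FS: "F \<in> ?S" using F by (simp add: cup_variety_def springer_fiber_W)
    have "limitin ?X G F sequentially"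
    proof (rule limitin_flag_topologyI)
      show "F \<in> flags (A + K) W" using FS by (simp add: springer_fiber_def)
      show "\<forall>\<^sub>F m in sequentially. G m \<in> flags (A + K) W" using GY by (simp add: springer_fiber_def)
      show "\<exists>u. (\<forall>\<^sub>F m in sequentially. u m \<in> G m i) \<and> u \<longlonglongrightarrow> x" if "x \<in> F i" for i x
        using G(2) that unfolding approximates_def by (meson always_eventually)
    qed
    then have lim: "limitin (subtopology ?X ?S) G F sequentially"
      using GY FS by (simp add: limitin_subtopology)
    show "F \<in> subtopology ?X ?S closure_of p_cell (A + K) K B"
      unfolding in_closure_of
    proof (intro conjI allI impI)
      show "F \<in> topspace (subtopology ?X ?S)" using lim by (rule limitin_topspace)
      fix T assume T: "F \<in> T \<and> openin (subtopology ?X ?S) T"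
      then have "\<forall>\<^sub>F m in sequentially. G m \<in> T" using lim unfolding limitin_def by blast
      then obtain m where "G m \<in> T" using eventually_happens by fastforce
      then show "\<exists>y. y \<in> p_cell (A + K) K B \<and> y \<in> T" using G(1) by blast
    qed
  qed
qed

text \<open>The conditions at cups and rays agree with those of \<open>cup_variety\<close>; the condition on
  \<open>w\<^sub>\<and> \<inter> S(w)\<^sub>\<or>\<close> accounts for the left ends of cups of the second round.\<close>
lemma component_eq_cup_variety:
  assumes D: "diagram (A + K) K (bot_entries w) M" and w: "row_strict (A + K) K w"
    and S: "row_strict (A + K) K S" "matching_of (A + K) K S = M" "bot_entries S = fst ` M"
  shows "{F \<in> component (A + K) K W N S. \<forall>i \<in> top_entries w \<inter> bot_entries S.
      F i = U (top_upto (A + K) (bot_entries w) i) (bot_upto (bot_entries w) i)}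
    = cup_variety (A + K) K (bot_entries w) M"
proof (rule set_eqI)
  fix F
  let ?n = "A + K" and ?B = "bot_entries w"
  let ?fix = "\<lambda>i. U (top_upto ?n ?B i) (bot_upto ?B i)"
  have B: "?B \<subseteq> {1..?n}" "card ?B = K" using diagram_set[OF D] by auto
  have Kn: "K \<le> ?n" by simp
  have topw: "top_entries w = {1..?n} - ?B" by (rule row_strict_entries(3)[OF w Kn])
  have topS: "top_entries S = {1..?n} - fst ` M" using row_strict_entries(3)[OF S(1) Kn] S(3) by simp
  have fstM: "fst ` M \<subseteq> {1..?n}" using row_strict_entries(4)[OF S(1) Kn] S(3) by simp
  have ce: "cup_end ?n K S x = y" if xy: "(x, y) \<in> M" for x y
    unfolding cup_end_def S(2)
  proof (rule the_equality)
    show "(x, y) \<in> M" by (rule xy)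
    fix z assume "(x, z) \<in> M"
    from diagram_disjoint[OF D xy this] show "z = y" by simp
  qed
  have ends: "cup_end ?n K S ` bot_entries S = snd ` M"
  proof -
    have "cup_end ?n K S ` fst ` M = (\<lambda>c. cup_end ?n K S (fst c)) ` M" by (simp add: image_image)
    also have "\<dots> = snd ` M"
    proof (rule image_cong[OF refl])
      fix c assume "c \<in> M" then show "cup_end ?n K S (fst c) = snd c" using ce[of "fst c" "snd c"] by simp
    qed
    finally show ?thesis unfolding S(3) .
  qed
  have rays: "top_entries S - cup_end ?n K S ` bot_entries S = {1..?n} - endpoints M"
    unfolding topS ends endpoints_def by blast
  show "F \<in> {F \<in> component ?n K W N S. \<forall>i \<in> top_entries w \<inter> bot_entries S. F i = ?fix i}
    \<longleftrightarrow> F \<in> cup_variety ?n K ?B M"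
  proof (cases "F \<in> Y A K")
    case True
    have cups: "(\<forall>i\<in>bot_entries S. (N ^^ cup_width ?n K S i) ` F (cup_end ?n K S i) = F (i - 1)) \<longleftrightarrow>
      (\<forall>(x, y)\<in>M. (N ^^ ((y - x + 1) div 2)) ` F y \<subseteq> F (x - 1))"
    proof -
      have "(\<forall>i\<in>bot_entries S. (N ^^ cup_width ?n K S i) ` F (cup_end ?n K S i) = F (i - 1)) \<longleftrightarrow>
        (\<forall>c\<in>M. (N ^^ cup_width ?n K S (fst c)) ` F (cup_end ?n K S (fst c)) = F (fst c - 1))"
        unfolding S(3) by simp
      also have "\<dots> \<longleftrightarrow> (\<forall>c\<in>M. case c of (x, y) \<Rightarrow> (N ^^ ((y - x + 1) div 2)) ` F y \<subseteq> F (x - 1))"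
      proof (rule ball_cong[OF refl])
        fix c assume c: "c \<in> M"
        obtain x y where xy: "c = (x, y)" by (cases c)
        have "(x, y) \<in> M" using c xy by simp
        then have "1 \<le> x" "x < y" "y \<le> ?n" "odd (y - x)" "cup_end ?n K S x = y"
          using diagram_cup_bounds[OF D, of x y] ce by simp_all
        then show "((N ^^ cup_width ?n K S (fst c)) ` F (cup_end ?n K S (fst c)) = F (fst c - 1)) =
          (case c of (x, y) \<Rightarrow> (N ^^ ((y - x + 1) div 2)) ` F y \<subseteq> F (x - 1))"
          using cup_condition_eq_iff[OF True, of x y] unfolding xy by (simp add: cup_width_def)
      qed
      finally show ?thesis .
    qed
    have ray: "{v \<in> W. (N ^^ bot_count S j) v \<in> (N ^^ (?n - K - top_count S j + bot_count S j)) ` W} = ?fix j"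
      if j: "j \<in> {1..?n} - endpoints M" for j
    proof -
      note rc = ray_counts[OF D j]
      have b: "bot_count S j = bot_upto ?B j" using rc(1) by (simp add: bot_count_def bot_upto_def S(3))
      have t: "top_count S j = top_upto ?n ?B j" using rc(2) unfolding top_count_def top_upto_def topS by simp
      have le: "top_upto ?n ?B j \<le> A" "bot_upto ?B j \<le> K"
        using top_upto_le[OF B(1), of j] bot_upto_le[OF finite_subset[OF B(1)], of j] B(2) by simp_all
      show ?thesis unfolding b t using ray_space[OF le rc(3)] rc(4) by simp
    qed
    have pts: "{1..?n} - ?B - snd ` M = ({1..?n} - endpoints M) \<union> (top_entries w \<inter> fst ` M)"
    proof -
      have "?B \<subseteq> endpoints M" by (rule diagram_covers[OF D])
      moreover have "fst ` M \<inter> snd ` M = {}"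
      proof -
        have no: False if "(x, y) \<in> M" "(z, x) \<in> M" for x y z
          using diagram_disjoint[OF D that] diagram_cup_bounds[OF D that(1)] by simp
        show ?thesis
        proof (rule equals0I)
          fix x assume "x \<in> fst ` M \<inter> snd ` M"
          then obtain y z where "(x, y) \<in> M" "(z, x) \<in> M" by auto
          then show False by (rule no)
        qed
      qed
      ultimately show ?thesis unfolding topw endpoints_def using fstM by blast
    qed
    have comp: "F \<in> component ?n K W N S \<longleftrightarrow>
      (\<forall>(x, y)\<in>M. (N ^^ ((y - x + 1) div 2)) ` F y \<subseteq> F (x - 1)) \<and>
      (\<forall>j\<in>{1..?n} - endpoints M. F j = {v \<in> W. (N ^^ bot_count S j) v \<in> (N ^^ (?n - K - top_count S j + bot_count S j)) ` W})"
      using True by (simp only: component_def springer_fiber_W mem_Collect_eq cups rays simp_thms)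
    have rays': "(\<forall>j\<in>{1..?n} - endpoints M. F j = {v \<in> W. (N ^^ bot_count S j) v \<in> (N ^^ (?n - K - top_count S j + bot_count S j)) ` W})
      \<longleftrightarrow> (\<forall>j\<in>{1..?n} - endpoints M. F j = ?fix j)"
      by (rule ball_cong[OF refl]) (simp only: ray)
    have "F \<in> cup_variety ?n K ?B M \<longleftrightarrow>
      (\<forall>(x, y)\<in>M. (N ^^ ((y - x + 1) div 2)) ` F y \<subseteq> F (x - 1)) \<and>
      ((\<forall>j\<in>{1..?n} - endpoints M. F j = ?fix j) \<and> (\<forall>j\<in>top_entries w \<inter> fst ` M. F j = ?fix j))"
      using True by (simp only: cup_variety_def mem_Collect_eq pts ball_Un simp_thms add_diff_cancel_right')
    then show ?thesis by (simp only: mem_Collect_eq comp rays' S(3) conj_assoc)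
  next
    case False
    then show ?thesis unfolding component_def cup_variety_def springer_fiber_W by simp
  qed
qed

end

theorem theorem15:
  fixes n k :: nat
    and p q :: "nat \<Rightarrow> complex ^ 'm::finite"
    and V :: "(complex ^ 'm) set"
    and N :: "complex ^ 'm \<Rightarrow> complex ^ 'm"
    and act :: "complex \<Rightarrow> complex ^ 'm \<Rightarrow> complex ^ 'm"
    and w :: tableau
  assumes "2 * k \<le> n"
    and "vec.independent (p ` {1..n - k} \<union> q ` {1..k})"
    and "card (p ` {1..n - k} \<union> q ` {1..k}) = n"
    and "V = vec.span (p ` {1..n - k} \<union> q ` {1..k})"
    and "p 0 = 0" and "q 0 = 0"
    and "Vector_Spaces.linear (*s) (*s) N"
    and "\<And>i. i \<in> {1..n - k} \<Longrightarrow> N (p i) = p (i - 1)"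
    and "\<And>i. i \<in> {1..k} \<Longrightarrow> N (q i) = q (i - 1)"
    and "\<And>t. t \<noteq> 0 \<Longrightarrow> Vector_Spaces.linear (*s) (*s) (act t)"
    and "\<And>t i. t \<noteq> 0 \<Longrightarrow> i \<in> {1..n - k} \<Longrightarrow> act t (p i) = inverse t *s p i"
    and "\<And>t i. t \<noteq> 0 \<Longrightarrow> i \<in> {1..k} \<Longrightarrow> act t (q i) = t *s q i"
    and "row_strict n k w"
  shows "cell_closure n V N act (fixed_flag p q w) =
           {F \<in> component n k V N (standardization n k w).
              \<forall>i \<in> top_entries w \<inter> bot_entries (standardization n k w).
                F i = fixed_flag p q w i}
         \<and> (\<forall>S. standard n k S \<longrightarrow>
              cell_closure n V N act (fixed_flag p q S) = component n k V N S)"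
proof -
  have nk: "n - k + k = n" and kn: "k \<le> n" using assms(1) by simp_all
  interpret two_jordan_blocks_action "n - k" k p q N act
  proof (intro two_jordan_blocks_action.intro two_jordan_blocks.intro two_jordan_blocks_action_axioms.intro)
    show "card (p ` {1..n - k} \<union> q ` {1..k}) = n - k + k" unfolding nk by (rule assms(3))
  qed (fact assms)+
  have V: "V = W" using assms(4) by (simp add: W_def basis_def)
  have main: "cell_closure n V N act (fixed_flag p q w) =
           {F \<in> component n k V N (standardization n k w).
              \<forall>i \<in> top_entries w \<inter> bot_entries (standardization n k w).
                F i = fixed_flag p q w i}" if w: "row_strict n k w" for w
  proof -
    let ?B = "bot_entries w" and ?S = "standardization n k w"
    note we = row_strict_entries[OF w kn]
    obtain M where D: "diagram n k ?B M" using diagram_exists[OF we(4,1) assms(1)] by blast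
    note S = standardization_diagram[OF D w assms(1)]
    have Srs: "row_strict n k ?S" using S(1) by (simp add: standard_def)
    have fx: "fixed_flag p q w i = U (top_upto n ?B i) (bot_upto ?B i)" for i
    proof -
      have "top_count w i = top_upto n ?B i" unfolding top_count_def top_upto_def we(3) ..
      moreover have "bot_count w i = bot_upto ?B i" unfolding bot_count_def bot_upto_def ..
      moreover have "top_upto n ?B i \<le> n - k" "bot_upto ?B i \<le> k"
        using top_upto_le[OF we(4), of i] bot_upto_le[OF finite_subset[OF we(4)], of i] we(1) by simp_all
      ultimately show ?thesis unfolding fixed_flag_def by (simp add: U_eq_span)
    qed
    then have fixed_eq: "fixed_flag p q w = fixed ?B" by (intro ext) (simp add: fixed_def nk)
    have "cell_closure n V N act (fixed_flag p q w) = cup_variety n k ?B M"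
      unfolding cell_closure_def V fixed_eq
      using cell_eq_p_cell[unfolded nk, OF we(4,1)] closure_of_p_cell[unfolded nk, OF D] by simp
    also have "\<dots> = {F \<in> component n k V N ?S. \<forall>i \<in> top_entries w \<inter> bot_entries ?S. F i = fixed_flag p q w i}"
      unfolding V fx using component_eq_cup_variety[unfolded nk, OF D w Srs S(2,3)] by simp
    finally show ?thesis .
  qed
  moreover have "cell_closure n V N act (fixed_flag p q S) = component n k V N S" if S: "standard n k S" for S
  proof -
    have rs: "row_strict n k S" using S by (simp add: standard_def)
    have "top_entries S \<inter> bot_entries S = {}" using row_strict_entries(3)[OF rs kn] by blast
    then show ?thesis using main[OF rs] standardization_standard[OF S assms(1)] by simp
  qed
  ultimately show ?thesis using assms(13) by blast
qed

end
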